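(* Let $\Gamma$ and $\Lambda$ be $3$-dimensional simplicial complexes with barycentric subdivisions $\Gamma'$ and $\Lambda'$. Then there is a choice of $4$-colourings of $\Gamma'$ and $\Lambda'$ that makes $\Gamma',\Lambda'$ pairwise 5-large (and hence each connected component of the universal cover $\widetilde X_{\Gamma',\Lambda'}$ is hyperbolic). Moreover, if $H_3(\Gamma;\mathbb Z_2)$ and $H_3(\Lambda;\mathbb Z_2)$ are non-trivial, then $H_4(X_{\Gamma',\Lambda'};\mathbb Z_2)$ is also non-trivial.
   Context: All simplicial complexes are finite, and the empty set counts as a simplex of every complex. An $n$-coloured simplicial complex is a simplicial complex whose vertex set is partitioned into $n$ labelled (possibly empty) classes, the colours $1,\dots,n$, so that adjacent vertices have different colours. Let $\Gamma_A,\Gamma_B$ be $n$-coloured with colour classes $A_1,\dots,A_n$ and $B_1,\dots,B_n$. Let $K=\prod_{i=1}^n (A_i*B_i)$, a product of complete bipartite graphs, viewed as a cube complex. A vertex $(x_1,\dots,x_n)$ of $K$, $x_i\in A_i\sqcup B_i$, is identified with the pair $(\mathfrak a,\mathfrak b)$, $\mathfrak a=\{x_i: x_i\in A_i\}$, $\mathfrak b=\{x_i: x_i\in B_i\}$. The coupled link cube complex $X_{\Gamma_A,\Gamma_B}$ is the full subcomplex of $K$ (all cubes all of whose vertices belong to it) on the vertices $(\mathfrak a,\mathfrak b)$ such that $\mathfrak a$ is a (possibly empty) simplex of $\Gamma_A$ and $\mathfrak b$ is a (possibly empty) simplex of $\Gamma_B$. $\widetilde X_{\Gamma_A,\Gamma_B}$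 denotes the disjoint union of the universal covers of the connected components of $X_{\Gamma_A,\Gamma_B}$, each with the path metric induced by Euclidean unit cubes; hyperbolic means Gromov hyperbolic. A simplicial complex is flag if every set of pairwise adjacent vertices spans a simplex. A square in a simplicial complex is a cycle $(v_1,v_2,v_3,v_4)$ of length $4$ in its $1$-skeleton; it is flat if neither pair of diagonally opposite vertices is joined by an edge. Two $n$-coloured flag simplicial complexes are pairwise 5-large if, whenever $(v_1,v_2,v_3,v_4)$ is a flat square in one of the complexes, with $v_j$ of colour $k_j$, there exists $j\in\{1,\dots,4\}$ such that the other complex contains no flat square having two adjacent vertices of colours $k_j$ and $k_{j+1}$ (indices mod $4$). *)

theory Defs
  imports "HOL-Analysis.Analysis" "HOL-Algebra.Elementary_Groups" "HOL-Library.Z2"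
begin

section \<open>Abstract simplicial complexes and colourings\<close>

text \<open>Complexes are abstract (unlike the geometric \<open>simplicial_complex\<close> of HOL-Analysis). The vertex
  set of \<open>\<Gamma>\<close> is \<open>\<Union>\<Gamma>\<close>, and the empty simplex always belongs to \<open>\<Gamma>\<close>.\<close>

definition abstract_complex :: "'v set set \<Rightarrow> bool" where
  "abstract_complex \<Gamma> \<longleftrightarrow>
     finite \<Gamma> \<and> (\<forall>s\<in>\<Gamma>. finite s) \<and> {} \<in> \<Gamma> \<and> (\<forall>s\<in>\<Gamma>. \<forall>t. t \<subseteq> s \<longrightarrow> t \<in> \<Gamma>)"

definition complex_dim :: "'v set set \<Rightarrow> int" where
  "complex_dim \<Gamma> = int (Max (card ` \<Gamma>)) - 1"

definition simplices :: "'v set set \<Rightarrow> nat \<Rightarrow> 'v set set" where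
  "simplices \<Gamma> k = {s \<in> \<Gamma>. card s = k + 1}"

definition adjacent :: "'v set set \<Rightarrow> 'v \<Rightarrow> 'v \<Rightarrow> bool" where
  "adjacent \<Gamma> u v \<longleftrightarrow> u \<noteq> v \<and> {u, v} \<in> \<Gamma>"

definition flag_complex :: "'v set set \<Rightarrow> bool" where
  "flag_complex \<Gamma> \<longleftrightarrow>
     (\<forall>S \<subseteq> \<Union>\<Gamma>. (\<forall>u\<in>S. \<forall>v\<in>S. u \<noteq> v \<longrightarrow> adjacent \<Gamma> u v) \<longrightarrow> S \<in> \<Gamma>)"

definition barycentric_subdivision :: "'v set set \<Rightarrow> 'v set set set" where
  "barycentric_subdivision \<Gamma> =
     {C. C \<subseteq> \<Gamma> - {{}} \<and> (\<forall>s\<in>C. \<forall>t\<in>C. s \<subseteq> t \<or> t \<subseteq> s)}"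

text \<open>A colouring is a function on the vertices; the colour classes are its fibres over
  \<open>1,\<dots>,n\<close> and may be empty.\<close>

definition coloured_complex :: "nat \<Rightarrow> 'v set set \<Rightarrow> ('v \<Rightarrow> nat) \<Rightarrow> bool" where
  "coloured_complex n \<Gamma> c \<longleftrightarrow>
     abstract_complex \<Gamma> \<and> (\<forall>v\<in>\<Union>\<Gamma>. c v \<in> {1..n}) \<and> (\<forall>u v. adjacent \<Gamma> u v \<longrightarrow> c u \<noteq> c v)"

definition colour_class :: "'v set set \<Rightarrow> ('v \<Rightarrow> nat) \<Rightarrow> nat \<Rightarrow> 'v set" where
  "colour_class \<Gamma> c i = {v \<in> \<Union>\<Gamma>. c v = i}"


section \<open>Flat squares and pairwise 5-largeness\<close>

text \<open>The square \<open>(v\<^sub>1,v\<^sub>2,v\<^sub>3,v\<^sub>4)\<close> is indexed here by \<open>0,1,2,3\<close>; only these values of \<open>v\<close> matter.\<close>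

definition square :: "'v set set \<Rightarrow> (nat \<Rightarrow> 'v) \<Rightarrow> bool" where
  "square \<Gamma> v \<longleftrightarrow> inj_on v {..<4} \<and> (\<forall>j<4. adjacent \<Gamma> (v j) (v ((j + 1) mod 4)))"

definition flat_square :: "'v set set \<Rightarrow> (nat \<Rightarrow> 'v) \<Rightarrow> bool" where
  "flat_square \<Gamma> v \<longleftrightarrow> square \<Gamma> v \<and> (\<forall>j<4. \<not> adjacent \<Gamma> (v j) (v ((j + 2) mod 4)))"

text \<open>Adjacent vertices have distinct colours, so equality of two-element colour sets says that
  the adjacent vertices \<open>w i\<close>, \<open>w (i + 1)\<close> have the two prescribed colours, in some order.\<close>

definition has_flat_square_with_colours ::
    "'v set set \<Rightarrow> ('v \<Rightarrow> nat) \<Rightarrow> nat \<Rightarrow> nat \<Rightarrow> bool" where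
  "has_flat_square_with_colours \<Gamma> c k l \<longleftrightarrow>
     (\<exists>w. flat_square \<Gamma> w \<and> (\<exists>i<4. {c (w i), c (w ((i + 1) mod 4))} = {k, l}))"

definition five_large_against ::
    "'v set set \<Rightarrow> ('v \<Rightarrow> nat) \<Rightarrow> 'w set set \<Rightarrow> ('w \<Rightarrow> nat) \<Rightarrow> bool" where
  "five_large_against A cA B cB \<longleftrightarrow>
     (\<forall>v. flat_square A v \<longrightarrow>
        (\<exists>j<4. \<not> has_flat_square_with_colours B cB (cA (v j)) (cA (v ((j + 1) mod 4)))))"

definition pairwise_5_large ::
    "nat \<Rightarrow> 'v set set \<Rightarrow> ('v \<Rightarrow> nat) \<Rightarrow> 'w set set \<Rightarrow> ('w \<Rightarrow> nat) \<Rightarrow> bool" where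
  "pairwise_5_large n A cA B cB \<longleftrightarrow>
     coloured_complex n A cA \<and> flag_complex A \<and> coloured_complex n B cB \<and> flag_complex B \<and>
     five_large_against A cA B cB \<and> five_large_against B cB A cA"


section \<open>The coupled link cube complex\<close>

definition factor_vertices ::
    "'v set set \<Rightarrow> ('v \<Rightarrow> nat) \<Rightarrow> 'w set set \<Rightarrow> ('w \<Rightarrow> nat) \<Rightarrow> nat \<Rightarrow> ('v + 'w) set" where
  "factor_vertices A cA B cB i = colour_class A cA i <+> colour_class B cB i"

text \<open>Cells (vertices and edges) of the complete bipartite graph \<open>A\<^sub>i * B\<^sub>i\<close>, as vertex sets.\<close>

definition factor_cells ::
    "'v set set \<Rightarrow> ('v \<Rightarrow> nat) \<Rightarrow> 'w set set \<Rightarrow> ('w \<Rightarrow> nat) \<Rightarrow> nat \<Rightarrow> ('v + 'w) set set" where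
  "factor_cells A cA B cB i =
     {{x} | x. x \<in> factor_vertices A cA B cB i} \<union>
     {{Inl a, Inr b} | a b. a \<in> colour_class A cA i \<and> b \<in> colour_class B cB i}"

text \<open>The factors \<open>A\<^sub>i * B\<^sub>i\<close> have disjoint vertex sets. Hence a vertex \<open>(x\<^sub>1,\<dots>,x\<^sub>n)\<close> of the product
  \<open>K\<close> is determined by the set \<open>{x\<^sub>1,\<dots>,x\<^sub>n}\<close>, and a cube \<open>\<sigma>\<^sub>1 \<times> \<dots> \<times> \<sigma>\<^sub>n\<close> of \<open>K\<close> by the set
  \<open>\<sigma>\<^sub>1 \<union> \<dots> \<union> \<sigma>\<^sub>n\<close>. Under this encoding \<open>c\<close> is a face of \<open>d\<close> iff \<open>c \<subseteq> d\<close>, the vertices of \<open>c\<close> are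
  the vertices of \<open>K\<close> contained in \<open>c\<close>, and \<open>c\<close> has dimension \<open>card c - n\<close>. The pair associated
  with a vertex \<open>x\<close> is \<open>(Inl -` x, Inr -` x)\<close>.\<close>

definition K_vertices ::
    "nat \<Rightarrow> 'v set set \<Rightarrow> ('v \<Rightarrow> nat) \<Rightarrow> 'w set set \<Rightarrow> ('w \<Rightarrow> nat) \<Rightarrow> ('v + 'w) set set" where
  "K_vertices n A cA B cB =
     {x ` {1..n} | x. \<forall>i\<in>{1..n}. x i \<in> factor_vertices A cA B cB i}"

definition K_cubes ::
    "nat \<Rightarrow> 'v set set \<Rightarrow> ('v \<Rightarrow> nat) \<Rightarrow> 'w set set \<Rightarrow> ('w \<Rightarrow> nat) \<Rightarrow> ('v + 'w) set set" where
  "K_cubes n A cA B cB =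
     {(\<Union>i\<in>{1..n}. \<sigma> i) | \<sigma>. \<forall>i\<in>{1..n}. \<sigma> i \<in> factor_cells A cA B cB i}"

definition X_vertices ::
    "nat \<Rightarrow> 'v set set \<Rightarrow> ('v \<Rightarrow> nat) \<Rightarrow> 'w set set \<Rightarrow> ('w \<Rightarrow> nat) \<Rightarrow> ('v + 'w) set set" where
  "X_vertices n A cA B cB = {x \<in> K_vertices n A cA B cB. Inl -` x \<in> A \<and> Inr -` x \<in> B}"

definition X_cubes ::
    "nat \<Rightarrow> 'v set set \<Rightarrow> ('v \<Rightarrow> nat) \<Rightarrow> 'w set set \<Rightarrow> ('w \<Rightarrow> nat) \<Rightarrow> ('v + 'w) set set" where
  "X_cubes n A cA B cB =
     {c \<in> K_cubes n A cA B cB.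
        \<forall>x \<in> K_vertices n A cA B cB. x \<subseteq> c \<longrightarrow> x \<in> X_vertices n A cA B cB}"

definition X_cubes_of_dim ::
    "nat \<Rightarrow> 'v set set \<Rightarrow> ('v \<Rightarrow> nat) \<Rightarrow> 'w set set \<Rightarrow> ('w \<Rightarrow> nat) \<Rightarrow> nat \<Rightarrow> ('v + 'w) set set" where
  "X_cubes_of_dim n A cA B cB k = {c \<in> X_cubes n A cA B cB. card c = n + k}"


section \<open>Geometric realisation and its metric\<close>

text \<open>A point of \<open>\<sigma>\<^sub>1 \<times> \<dots> \<times> \<sigma>\<^sub>n\<close> is given by barycentric coordinates in each factor \<open>\<sigma>\<^sub>i\<close> (a vertex or
  an edge), collected into one function on all vertices. The function type carries the product
  topology, which on these finitely supported functions is the Euclidean one.\<close>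

definition cube_points ::
    "nat \<Rightarrow> 'v set set \<Rightarrow> ('v \<Rightarrow> nat) \<Rightarrow> 'w set set \<Rightarrow> ('w \<Rightarrow> nat) \<Rightarrow> ('v + 'w) set
     \<Rightarrow> ('v + 'w \<Rightarrow> real) set" where
  "cube_points n A cA B cB c =
     {x. (\<forall>v. 0 \<le> x v) \<and> (\<forall>v. v \<notin> c \<longrightarrow> x v = 0) \<and>
         (\<forall>i\<in>{1..n}. (\<Sum>v \<in> c \<inter> factor_vertices A cA B cB i. x v) = 1)}"

definition X_space ::
    "nat \<Rightarrow> 'v set set \<Rightarrow> ('v \<Rightarrow> nat) \<Rightarrow> 'w set set \<Rightarrow> ('w \<Rightarrow> nat) \<Rightarrow> ('v + 'w \<Rightarrow> real) set" where
  "X_space n A cA B cB = (\<Union>c \<in> X_cubes n A cA B cB. cube_points n A cA B cB c)"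

text \<open>In barycentric coordinates an edge is the segment joining two standard basis vectors, of
  length \<open>sqrt 2\<close>; after rescaling, every cube is isometric to a Euclidean unit cube.\<close>

definition cube_dist :: "'c set \<Rightarrow> ('c \<Rightarrow> real) \<Rightarrow> ('c \<Rightarrow> real) \<Rightarrow> real" where
  "cube_dist V x y = L2_set (\<lambda>v. x v - y v) V / sqrt 2"

definition X_dist :: "'v set set \<Rightarrow> 'w set set \<Rightarrow> ('v + 'w \<Rightarrow> real) \<Rightarrow> ('v + 'w \<Rightarrow> real) \<Rightarrow> real" where
  "X_dist A B = cube_dist (\<Union>A <+> \<Union>B)"

definition polygonal_lengths :: "('p \<Rightarrow> 'p \<Rightarrow> real) \<Rightarrow> (real \<Rightarrow> 'p) \<Rightarrow> real set" where
  "polygonal_lengths d g =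
     {(\<Sum>i<m. d (g (t i)) (g (t (Suc i)))) | (m::nat) t.
        (\<forall>i\<le>m. t i \<in> {0..1}) \<and> (\<forall>i<m. t i \<le> t (Suc i))}"

definition rectifiable :: "('p \<Rightarrow> 'p \<Rightarrow> real) \<Rightarrow> (real \<Rightarrow> 'p) \<Rightarrow> bool" where
  "rectifiable d g \<longleftrightarrow> bdd_above (polygonal_lengths d g)"

definition path_len :: "('p \<Rightarrow> 'p \<Rightarrow> real) \<Rightarrow> (real \<Rightarrow> 'p) \<Rightarrow> real" where
  "path_len d g = Sup (polygonal_lengths d g)"


section \<open>Universal covers and hyperbolicity\<close>

text \<open>The standard model of the universal cover of the component of \<open>x0\<close> in \<open>S\<close>: classes, up to
  homotopy with fixed endpoints, of paths in \<open>S\<close> starting at \<open>x0\<close>. The covering map sends a class to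
  the common endpoint of its members.\<close>

definition universal_cover :: "'p::topological_space set \<Rightarrow> 'p \<Rightarrow> (real \<Rightarrow> 'p) set set" where
  "universal_cover S x0 =
     {{q. homotopic_paths S p q} | p. path p \<and> path_image p \<subseteq> S \<and> pathstart p = x0}"

text \<open>The lift, starting at \<open>P\<close>, of a path \<open>g\<close> that begins at the endpoint of \<open>p \<in> P\<close> ends at the
  class of \<open>p +++ g\<close>, and it has the same length as \<open>g\<close>. So the infimum below runs over the lengths
  of the rectifiable paths from \<open>P\<close> to \<open>Q\<close> in the universal cover.\<close>

definition universal_cover_dist ::
    "('p::topological_space \<Rightarrow> 'p \<Rightarrow> real) \<Rightarrow> 'p set \<Rightarrow> (real \<Rightarrow> 'p) set \<Rightarrow> (real \<Rightarrow> 'p) set \<Rightarrow> real" where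
  "universal_cover_dist d S P Q =
     Inf {path_len d g | g. path g \<and> path_image g \<subseteq> S \<and> rectifiable d g \<and>
            (\<exists>p\<in>P. pathfinish p = pathstart g \<and> p +++ g \<in> Q)}"

definition gromov_product :: "('p \<Rightarrow> 'p \<Rightarrow> real) \<Rightarrow> 'p \<Rightarrow> 'p \<Rightarrow> 'p \<Rightarrow> real" where
  "gromov_product d w x y = (d x w + d y w - d x y) / 2"

definition gromov_hyperbolic :: "'p set \<Rightarrow> ('p \<Rightarrow> 'p \<Rightarrow> real) \<Rightarrow> bool" where
  "gromov_hyperbolic M d \<longleftrightarrow>
     (\<exists>\<delta>\<ge>0. \<forall>w\<in>M. \<forall>x\<in>M. \<forall>y\<in>M. \<forall>z\<in>M.
        gromov_product d w x z \<ge> min (gromov_product d w x y) (gromov_product d w y z) - \<delta>)"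

text \<open>Every component of the universal cover of \<open>X\<close> is the universal cover of the component of some
  base point \<open>x0\<close>; different base points in one component give isometric spaces.\<close>

definition universal_cover_components_hyperbolic ::
    "nat \<Rightarrow> 'v set set \<Rightarrow> ('v \<Rightarrow> nat) \<Rightarrow> 'w set set \<Rightarrow> ('w \<Rightarrow> nat) \<Rightarrow> bool" where
  "universal_cover_components_hyperbolic n A cA B cB \<longleftrightarrow>
     (\<forall>x0 \<in> X_space n A cA B cB.
        gromov_hyperbolic (universal_cover (X_space n A cA B cB) x0)
          (universal_cover_dist (X_dist A B) (X_space n A cA B cB)))"


section \<open>Cellular homology with coefficients in the field with two elements\<close>

text \<open>\<open>K k\<close> is the finite set of \<open>k\<close>-cells of a simplicial or cube complex, each cell being recorded
  by a vertex set so that the face relation is inclusion. A \<open>k\<close>-chain is a function to \<open>bit\<close>, the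
  field of order 2, supported on \<open>K k\<close>. Modulo 2 no orientations are needed: the boundary of a cell
  is the sum of its faces of codimension 1.\<close>

definition z2_chains :: "(nat \<Rightarrow> 'c set set) \<Rightarrow> nat \<Rightarrow> ('c set \<Rightarrow> bit) set" where
  "z2_chains K k = {c. \<forall>e. e \<notin> K k \<longrightarrow> c e = 0}"

definition z2_boundary ::
    "(nat \<Rightarrow> 'c set set) \<Rightarrow> nat \<Rightarrow> ('c set \<Rightarrow> bit) \<Rightarrow> 'c set \<Rightarrow> bit" where
  "z2_boundary K k c f =
     (if k > 0 \<and> f \<in> K (k - 1) then \<Sum>e \<in> {e \<in> K k. f \<subseteq> e}. c e else 0)"

definition z2_cycles :: "(nat \<Rightarrow> 'c set set) \<Rightarrow> nat \<Rightarrow> ('c set \<Rightarrow> bit) set" where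
  "z2_cycles K k = {c \<in> z2_chains K k. z2_boundary K k c = (\<lambda>_. 0)}"

definition z2_boundaries :: "(nat \<Rightarrow> 'c set set) \<Rightarrow> nat \<Rightarrow> ('c set \<Rightarrow> bit) set" where
  "z2_boundaries K k = z2_boundary K (Suc k) ` z2_chains K (Suc k)"

definition z2_cycle_group :: "(nat \<Rightarrow> 'c set set) \<Rightarrow> nat \<Rightarrow> ('c set \<Rightarrow> bit) monoid" where
  "z2_cycle_group K k =
     \<lparr>carrier = z2_cycles K k, mult = (\<lambda>c d e. c e + d e), one = (\<lambda>_. 0)\<rparr>"

definition z2_homology :: "(nat \<Rightarrow> 'c set set) \<Rightarrow> nat \<Rightarrow> ('c set \<Rightarrow> bit) set monoid" where
  "z2_homology K k = z2_cycle_group K k Mod z2_boundaries K k"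

end

theory Submission
  imports Defs "HOL-Real_Asymp.Real_Asymp"
begin

text \<open>Both subdivisions are coloured by the cardinality of a simplex, the second one after a permutation.
  A flat square in a barycentric subdivision alternates between two lower and two upper simplices, so
  its adjacent cardinalities differ by at least two; the permutation makes the resulting colour pairs
  of the two complexes disjoint.

  For hyperbolicity, label an edge of \<open>X\<close> by the pair of its ends in the coordinate that changes.
  Flagness shows that homotopy classes of edge paths embed into the right-angled Coxeter group on these
  labels, where intervals are median. A large grid in an interval would force flat squares with a
  common pair of adjacent colours in both complexes, hence intervals are uniformly thin. Continuous
  paths are compared with edge paths through the cover by open stars of vertices, and the path metric
  of the universal cover is quasi-isometric to the word metric.

  A top-dimensional cycle of \<open>\<Gamma>\<close> induces one of the subdivision, and the product of two such cycles
  is a cycle of 4-cubes, which is not a boundary because there are no 5-cubes.\<close>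

section \<open>Traces and right-angled Coxeter groups\<close>

text \<open>Hyperbolicity does not rest on pairwise 5-largeness as such: the permuted colouring
  gives more, namely that no pair of adjacent colours in a flat square of one complex occurs in a
  flat square of the other. A large grid is excluded as follows. Between two successive crossings of
  the factor of colour \<open>i\<close>, a reduced edge path keeps one end of that factor and is
  forced to meet two non-adjacent vertices on the other side. The ends alternate between the two
  complexes, so three crossings produce non-adjacent pairs in both; with \<open>n\<close> colours,
  more than \<open>2 * n\<close> letters suffice. Two commuting words of that length join such pairs
  to flat squares with the same two adjacent colours in both complexes.

  The edge paths do not fill the Coxeter group: only words that are legal from the base vertex
  occur. These are closed under shuffles, cancellation and prefixes, which is why medians and
  geodesics computed in the group stay in the cover. Curvature of the cube complex is never invoked;
  the path metric enters only through coarse bounds, so lengths may be estimated crudely.\<close>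

locale independence =
  fixes I :: "'e \<Rightarrow> 'e \<Rightarrow> bool"
  assumes I_sym: "I a b \<Longrightarrow> I b a" and I_irrefl: "\<not> I a a"
begin

text \<open>Equality in the free partially commutative monoid, expressed by the projections to pairs
  of dependent letters. The case \<open>a = b\<close> is included, so letter counts are projections
  too. Congruence and cancellation are immediate in this form; generation by swaps of adjacent
  independent letters becomes a theorem, \<open>teq_induct\<close>.\<close>

definition teq :: "'e list \<Rightarrow> 'e list \<Rightarrow> bool" where
  "teq w w' \<longleftrightarrow> (\<forall>a b. \<not> I a b \<longrightarrow>
     filter (\<lambda>x. x = a \<or> x = b) w = filter (\<lambda>x. x = a \<or> x = b) w')"

lemma teq_refl [simp]: "teq w w" by (simp add: teq_def)

lemma teq_sym: "teq w w' \<Longrightarrow> teq w' w" by (simp add: teq_def)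

lemma teq_trans [trans]: "teq u v \<Longrightarrow> teq v w \<Longrightarrow> teq u w" by (simp add: teq_def)

lemma teq_append: "teq u u' \<Longrightarrow> teq v v' \<Longrightarrow> teq (u @ v) (u' @ v')" by (simp add: teq_def)

lemma teq_Cons: "teq v v' \<Longrightarrow> teq (e # v) (e # v')" by (simp add: teq_def)

lemma teq_append_cancel: "teq (u @ v) (u @ v') \<longleftrightarrow> teq v v'" by (simp add: teq_def)

lemma teq_Cons_cancel: "teq (e # v) (e # v') \<longleftrightarrow> teq v v'"
  using teq_append_cancel[of "[e]"] by simp

lemma teq_rev: "teq u v \<Longrightarrow> teq (rev u) (rev v)" by (simp add: teq_def rev_filter[symmetric])

lemma teq_swap: "I a b \<Longrightarrow> teq (a # b # w) (b # a # w)"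
  unfolding teq_def using I_sym I_irrefl by auto

lemma teq_count: "teq w w' \<Longrightarrow> filter (\<lambda>x. x = a) w = filter (\<lambda>x. x = a) w'"
  unfolding teq_def using I_irrefl[of a] by (metis (mono_tags, lifting) filter_cong)

lemma teq_set: "teq w w' \<Longrightarrow> set w = set w'"
proof -
  assume t: "teq w w'"
  have "a \<in> set w \<longleftrightarrow> a \<in> set w'" for a
    using teq_count[OF t, of a] by (metis (mono_tags, lifting) filter_empty_conv)
  then show ?thesis by blast
qed

lemma teq_move: "\<forall>x\<in>set p. I e x \<Longrightarrow> teq (e # p @ q) (p @ e # q)"
proof (induction p)
  case (Cons a p)
  have "teq (e # a # p @ q) (a # e # p @ q)" using Cons.prems by (simp add: teq_swap)
  also have "teq \<dots> (a # p @ e # q)" using Cons by (simp add: teq_Cons)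
  finally show ?case by simp
qed simp

lemma teq_Nil [simp]: "teq [] w \<longleftrightarrow> w = []" "teq w [] \<longleftrightarrow> w = []"
  using teq_set[of "[]" w] teq_set[of w "[]"] by (auto simp: set_empty)

text \<open>Split \<open>w'\<close> at its first \<open>e\<close>. A letter \<open>f\<close> before
  it that depends on \<open>e\<close> would come first in the projection of \<open>w'\<close> to
  \<open>e\<close> and \<open>f\<close>, whereas \<open>e\<close> comes first in that of
  \<open>e # w\<close>.\<close>

lemma teq_ConsD:
  assumes "teq (e # w) w'"
  obtains p q where "w' = p @ e # q" "\<forall>x\<in>set p. I e x" "teq w (p @ q)"
proof -
  have "e \<in> set w'" using teq_set[OF assms] by auto
  then obtain p q where w': "w' = p @ e # q" "e \<notin> set p" by (meson split_list_first)
  have ind: "\<forall>x\<in>set p. I e x"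
  proof (rule ccontr)
    assume "\<not> (\<forall>x\<in>set p. I e x)"
    then obtain p1 f p2 where p: "p = p1 @ f # p2" "\<not> I e f" "\<forall>x\<in>set p1. I e x"
      using split_list_first_prop[of p "\<lambda>x. \<not> I e x"] by auto
    have "filter (\<lambda>x. x = e \<or> x = f) (e # w) = filter (\<lambda>x. x = e \<or> x = f) w'"
      using assms p(2) unfolding teq_def by blast
    moreover have "filter (\<lambda>x. x = e \<or> x = f) p1 = []"
      using p I_irrefl w'(2) by (auto simp: filter_empty_conv)
    moreover have "f \<noteq> e" using p(1) w'(2) by auto
    ultimately show False using p(1) w'(1) by auto
  qed
  have "teq (e # p @ q) w'" using teq_move[OF ind] w' by simp
  then have "teq (e # w) (e # p @ q)" using assms teq_sym teq_trans by blast
  then have "teq w (p @ q)" by (simp add: teq_Cons_cancel)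
  then show ?thesis using that w' ind by blast
qed

lemma teq_length: "teq w w' \<Longrightarrow> length w = length w'"
proof (induction w arbitrary: w')
  case (Cons e w)
  obtain p q where "w' = p @ e # q" "teq w (p @ q)" using teq_ConsD[OF Cons.prems] .
  then show ?case using Cons.IH[of "p @ q"] by simp
qed simp

text \<open>The first letter is moved across the independent prefix found by
  \<open>teq_ConsD\<close>, one swap at a time. The swap rule carries a context on both sides
  because \<open>R\<close> need not be a congruence; for the same reason the induction runs below an
  arbitrary prefix \<open>u\<close>.\<close>

lemma teq_induct [consumes 1, case_names refl trans swap]:
  assumes "teq w w'"
    and r: "\<And>w. R w w" and t: "\<And>u v w. R u v \<Longrightarrow> R v w \<Longrightarrow> R u w"
    and s: "\<And>u a b v. I a b \<Longrightarrow> R (u @ a # b # v) (u @ b # a # v)"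
  shows "R w w'"
proof -
  have "R (u @ w) (u @ w')" for u
    using assms(1)
  proof (induction w arbitrary: u w')
    case Nil
    then show ?case by (simp add: r)
  next
    case (Cons e w)
    obtain p q where w': "w' = p @ e # q" "\<forall>x\<in>set p. I e x" "teq w (p @ q)"
      using teq_ConsD[OF Cons.prems] .
    have "R (u @ e # w) (u @ e # p @ q)" using Cons.IH[OF w'(3), of "u @ [e]"] by simp
    moreover have "R (u @ e # p @ q) (u @ p @ e # q)" for u
      using w'(2)
    proof (induction p arbitrary: u)
      case (Cons a p)
      have "R (u @ e # a # p @ q) (u @ a # e # p @ q)" using Cons.prems by (intro s) auto
      moreover have "R (u @ a # e # p @ q) (u @ a # p @ e # q)"
        using Cons.IH[of "u @ [a]"] Cons.prems by auto
      ultimately show ?case using t by simp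
    qed (simp add: r)
    ultimately show ?case using t w'(1) by blast
  qed
  from this[of "[]"] show ?thesis by simp
qed

text \<open>Levi's lemma for traces: two factorisations have a common refinement by four factors, of
  which the two off-diagonal ones commute letter by letter. By induction on \<open>u\<close>, its
  first letter joins \<open>r\<close> or \<open>s\<close> according to whether its partner on the
  right lies in \<open>v\<close> or in \<open>b\<close>.\<close>

lemma teq_levi:
  assumes "teq (u @ a) (v @ b)"
  obtains r s t q where "teq u (r @ s)" "teq v (r @ t)" "teq a (t @ q)" "teq b (s @ q)"
    "\<forall>x\<in>set s. \<forall>y\<in>set t. I x y"
proof -
  have "\<exists>r s t q. teq u (r @ s) \<and> teq v (r @ t) \<and> teq a (t @ q) \<and> teq b (s @ q) \<and>
     (\<forall>x\<in>set s. \<forall>y\<in>set t. I x y)"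
    using assms
  proof (induction u arbitrary: v b)
    case Nil
    show ?case
      by (rule exI[of _ "[]"], rule exI[of _ "[]"], rule exI[of _ v], rule exI[of _ b])
        (use Nil in simp)
  next
    case (Cons e u)
    obtain p q where pq: "v @ b = p @ e # q" "\<forall>x\<in>set p. I e x" "teq (u @ a) (p @ q)"
      using teq_ConsD[of e "u @ a" "v @ b"] Cons.prems by auto
    from pq(1) consider (inv) v1 where "v = p @ e # v1" "q = v1 @ b"
      | (inb) b1 where "p = v @ b1" "b = b1 @ e # q"
      by (auto simp: append_eq_append_conv2 append_eq_Cons_conv)
    then show ?case
    proof cases
      case inv
      have "teq (u @ a) ((p @ v1) @ b)" using pq(3) inv by simp
      from Cons.IH[OF this] obtain r s t q' where
        h: "teq u (r @ s)" "teq (p @ v1) (r @ t)" "teq a (t @ q')" "teq b (s @ q')"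
        "\<forall>x\<in>set s. \<forall>y\<in>set t. I x y" by blast
      have "teq v (e # p @ v1)" using inv pq(2) teq_move teq_sym by blast
      also have "teq \<dots> (e # r @ t)" using h(2) by (rule teq_Cons)
      finally have "teq v ((e # r) @ t)" by simp
      moreover have "teq (e # u) ((e # r) @ s)" using h(1) by (simp add: teq_Cons)
      ultimately show ?thesis using h by blast
    next
      case inb
      have "teq (u @ a) (v @ (b1 @ q))" using pq(3) inb by simp
      from Cons.IH[OF this] obtain r s t q' where
        h: "teq u (r @ s)" "teq v (r @ t)" "teq a (t @ q')" "teq (b1 @ q) (s @ q')"
        "\<forall>x\<in>set s. \<forall>y\<in>set t. I x y" by blast
      have ev: "\<forall>x\<in>set (r @ t). I e x" using pq(2) inb teq_set[OF h(2)] by auto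
      have "teq (e # u) (e # r @ s)" using h(1) by (rule teq_Cons)
      also have "teq \<dots> (r @ e # s)" using ev by (intro teq_move) auto
      finally have 1: "teq (e # u) (r @ (e # s))" .
      have "teq b (e # b1 @ q)" using inb pq(2) teq_move[of b1 e q] teq_sym by auto
      also have "teq \<dots> (e # s @ q')" using h(4) by (rule teq_Cons)
      finally have 2: "teq b ((e # s) @ q')" by simp
      have "\<forall>x\<in>set (e # s). \<forall>y\<in>set t. I x y" using ev h(5) by auto
      then show ?thesis using 1 2 h(2,3) by blast
    qed
  qed
  then show ?thesis using that by blast
qed

section \<open>Reduced words\<close>

definition reduced :: "'e list \<Rightarrow> bool" where
  "reduced w \<longleftrightarrow> (\<forall>u e v. \<not> teq w (u @ e # e # v))"

definition first :: "'e \<Rightarrow> 'e list \<Rightarrow> bool" where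
  "first e w \<longleftrightarrow> (\<exists>q. teq w (e # q))"

lemma reduced_Nil [simp]: "reduced []" by (auto simp: reduced_def)

lemma reduced_teq: "teq w w' \<Longrightarrow> reduced w \<Longrightarrow> reduced w'"
  unfolding reduced_def using teq_trans by blast

lemma first_teq: "teq w w' \<Longrightarrow> first e w \<Longrightarrow> first e w'"
  unfolding first_def using teq_trans teq_sym by blast

lemma reduced_appendD1: "reduced (u @ v) \<Longrightarrow> reduced u"
  unfolding reduced_def
  by (metis append.assoc append_Cons teq_append teq_refl)

lemma reduced_appendD2: "reduced (u @ v) \<Longrightarrow> reduced v"
  unfolding reduced_def
  by (metis append.assoc teq_append teq_refl)

lemma reduced_ConsD: "reduced (e # v) \<Longrightarrow> reduced v"
  using reduced_appendD2[of "[e]"] by simp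

lemma reduced_rev: "reduced w \<Longrightarrow> reduced (rev w)"
  unfolding reduced_def
proof (intro allI notI)
  fix u e v assume h: "\<forall>u e v. \<not> teq w (u @ e # e # v)" "teq (rev w) (u @ e # e # v)"
  then have "teq (rev (rev w)) (rev (u @ e # e # v))" using teq_rev by blast
  then show False using h(1) by simp
qed

lemma reduced_Cons_not_first: "reduced (e # w) \<Longrightarrow> \<not> first e w"
  unfolding reduced_def first_def
  by (metis append_Nil teq_Cons)

text \<open>Locate the added letter in a rearrangement that contains \<open>f # f\<close>. If it is
  neither of the two, the pair is already visible in \<open>w\<close>; if it is the left one, the
  other can be brought to the front of \<open>w\<close>; if it is the right one, \<open>e\<close>
  would be independent of itself.\<close>

lemma reduced_Cons:
  assumes "reduced w" "\<not> first e w"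
  shows "reduced (e # w)"
  unfolding reduced_def
proof (intro allI notI)
  fix u f v assume "teq (e # w) (u @ f # f # v)"
  then obtain p r where h: "u @ f # f # v = p @ e # r" "\<forall>x\<in>set p. I e x" "teq w (p @ r)"
    using teq_ConsD by metis
  from h(1) consider (a) u' where "u = p @ e # u'" "r = u' @ f # f # v"
    | (b) "p = u" "e = f" "r = f # v" | (c) "p = u @ [f]" "e = f"
    | (d) v' where "p = u @ f # f # v'" "v = v' @ e # r"
    by (auto simp: append_eq_append_conv2 append_eq_Cons_conv Cons_eq_append_conv)
  then show False
  proof cases
    case a
    then show False using h(3) assms(1) by (metis append.assoc reduced_def)
  next
    case b
    have "teq w (e # p @ v)" using h(3) b teq_move[OF h(2), of v] teq_sym teq_trans by blast
    then show False using assms(2) first_def by blast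
  next
    case c
    then show False using h(2) I_irrefl by auto
  next
    case d
    then show False using h(3) assms(1) by (metis append.assoc append_Cons reduced_def)
  qed
qed

lemma first_Cons_indep: "I e f \<Longrightarrow> first e (f # w) \<longleftrightarrow> first e w"
proof
  assume i: "I e f" and "first e (f # w)"
  then obtain q where "teq (f # w) (e # q)" using first_def by blast
  then obtain p r where h: "e # q = p @ f # r" "\<forall>x\<in>set p. I f x" "teq w (p @ r)"
    using teq_ConsD by metis
  from h(1) i I_irrefl obtain p' where "p = e # p'" by (cases p) auto
  then show "first e w" using h(3) first_def by auto
next
  assume i: "I e f" and "first e w"
  then obtain q where "teq w (e # q)" using first_def by blast
  then have "teq (f # w) (f # e # q)" by (rule teq_Cons)
  also have "teq \<dots> (e # f # q)" using i I_sym teq_swap by blast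
  finally show "first e (f # w)" using first_def by blast
qed

lemma first_Cons_dep: "first f (e # w) \<Longrightarrow> f \<noteq> e \<Longrightarrow> I e f \<and> first f w"
proof -
  assume h: "first f (e # w)" "f \<noteq> e"
  then obtain q where "teq (e # w) (f # q)" using first_def by blast
  then obtain p r where h': "f # q = p @ e # r" "\<forall>x\<in>set p. I e x" "teq w (p @ r)"
    using teq_ConsD by metis
  from h'(1) h(2) obtain p' where "p = f # p'" by (cases p) auto
  then show ?thesis using h' first_def by auto
qed

text \<open>Left multiplication by the involution \<open>e\<close> on reduced words: cancel if
  \<open>e\<close> can be brought to the front, otherwise prepend. The choice is harmless up to
  \<open>teq\<close>, because a first letter can be cancelled.\<close>

definition act :: "'e \<Rightarrow> 'e list \<Rightarrow> 'e list" where
  "act e w = (if first e w then SOME q. teq w (e # q) else e # w)"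

lemma act_first: "teq w (e # q) \<Longrightarrow> teq (act e w) q"
proof -
  assume h: "teq w (e # q)"
  then have f: "first e w" using first_def by blast
  have "teq w (e # (SOME q. teq w (e # q)))" using h by (rule someI)
  then have "teq (e # (SOME q. teq w (e # q))) (e # q)" using h teq_sym teq_trans by blast
  then show ?thesis using f by (simp add: act_def teq_Cons_cancel)
qed

lemma act_not_first: "\<not> first e w \<Longrightarrow> act e w = e # w" by (simp add: act_def)

lemma act_teq: "teq w w' \<Longrightarrow> teq (act e w) (act e w')"
proof (cases "first e w")
  case True
  assume t: "teq w w'"
  obtain q where q: "teq w (e # q)" using True first_def by blast
  then have "teq w' (e # q)" using t teq_sym teq_trans by blast
  then show ?thesis using q act_first teq_sym teq_trans by blast
next
  case False
  assume t: "teq w w'"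
  then have "\<not> first e w'" using False first_teq teq_sym by blast
  then show ?thesis using False t by (simp add: act_not_first teq_Cons)
qed

lemma act_reduced: "reduced w \<Longrightarrow> reduced (act e w)"
proof (cases "first e w")
  case True
  assume r: "reduced w"
  obtain q where q: "teq w (e # q)" using True first_def by blast
  then have "reduced q" using r reduced_teq reduced_ConsD by blast
  then show ?thesis using act_first[OF q] reduced_teq teq_sym by blast
qed (simp add: act_not_first reduced_Cons)

lemma act_act: "reduced w \<Longrightarrow> teq (act e (act e w)) w"
proof (cases "first e w")
  case True
  assume r: "reduced w"
  obtain q where q: "teq w (e # q)" using True first_def by blast
  then have "\<not> first e q" using r reduced_teq reduced_Cons_not_first by blast
  moreover have a: "teq (act e w) q" using act_first q by blast
  ultimately have "\<not> first e (act e w)" using first_teq by blast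
  then have "act e (act e w) = e # act e w" by (rule act_not_first)
  also have "teq \<dots> (e # q)" using a by (rule teq_Cons)
  finally show ?thesis using q teq_sym teq_trans by blast
next
  case False
  then show ?thesis using act_first[of "e # w" e w] by (simp add: act_not_first)
qed

text \<open>Prepending or cancelling \<open>f\<close> does not change whether the independent letter
  \<open>e\<close> is first (\<open>first_Cons_indep\<close>), so both orders take the same two
  decisions.\<close>

lemma act_commute:
  assumes "I e f"
  shows "teq (act e (act f w)) (act f (act e w))"
proof -
  have main: "teq (act e (act f w)) (act f (act e w))" if i: "I e f" and f: "first f w" for e f
  proof (cases "first e w")
    case True
    obtain q where q: "teq w (f # q)" using f first_def by blast
    then have "first e q" using True first_teq first_Cons_indep[OF i] by blast
    then obtain r where r: "teq q (e # r)" using first_def by blast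
    have "teq (act f w) (e # r)" using act_first[OF q] r teq_trans by blast
    then have 1: "teq (act e (act f w)) r" by (rule act_first)
    have "teq w (f # e # r)" using q r teq_Cons teq_trans by blast
    also have "teq \<dots> (e # f # r)" using i I_sym teq_swap by blast
    finally have "teq (act e w) (f # r)" by (rule act_first)
    then have "teq (act f (act e w)) r" by (rule act_first)
    then show ?thesis using 1 teq_sym teq_trans by blast
  next
    case False
    obtain q where q: "teq w (f # q)" using f first_def by blast
    then have nq: "\<not> first e q" using False first_teq teq_sym first_Cons_indep[OF i] by blast
    have a: "teq (act f w) q" using act_first q by blast
    then have "\<not> first e (act f w)" using nq first_teq by blast
    then have "act e (act f w) = e # act f w" by (rule act_not_first)
    then have 1: "teq (act e (act f w)) (e # q)" using a by (simp add: teq_Cons)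
    have "teq (e # w) (e # f # q)" using q by (rule teq_Cons)
    also have "teq \<dots> (f # e # q)" using i teq_swap by blast
    finally have "teq (act f (e # w)) (e # q)" by (rule act_first)
    then show ?thesis using 1 False by (metis act_not_first teq_sym teq_trans)
  qed
  show ?thesis
  proof (cases "first f w")
    case True then show ?thesis using main assms by blast
  next
    case nf: False
    show ?thesis
    proof (cases "first e w")
      case True then show ?thesis using main[of f e] assms I_sym teq_sym by blast
    next
      case False
      then show ?thesis using nf assms I_sym first_Cons_indep
        by (metis act_not_first teq_swap)
    qed
  qed
qed

section \<open>Normal forms and equality in the Coxeter group\<close>

abbreviation acts :: "'e list \<Rightarrow> 'e list \<Rightarrow> 'e list" where
  "acts u w \<equiv> foldr act u w"

text \<open>The group is realised through its action on reduced words, and a word is recorded by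
  what it makes of the empty word. The result is determined up to \<open>teq\<close> only, so
  \<open>geq\<close>, equality of group elements, compares normal forms by
  \<open>teq\<close>.\<close>

definition nf :: "'e list \<Rightarrow> 'e list" where "nf w = acts w []"

definition geq :: "'e list \<Rightarrow> 'e list \<Rightarrow> bool" where "geq u v \<longleftrightarrow> teq (nf u) (nf v)"

lemma acts_reduced: "reduced w \<Longrightarrow> reduced (acts u w)"
  by (induction u) (auto intro: act_reduced)

lemma acts_teq: "teq w w' \<Longrightarrow> teq (acts u w) (acts u w')"
  by (induction u) (auto intro: act_teq)

lemma acts_move: "\<forall>x\<in>set p. I e x \<Longrightarrow> teq (acts p (act e w)) (act e (acts p w))"
proof (induction p)
  case (Cons a p)
  then have "teq (acts (a # p) (act e w)) (act a (act e (acts p w)))"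
    by (simp add: act_teq)
  also have "teq \<dots> (act e (acts (a # p) w))" using Cons.prems act_commute I_sym by simp
  finally show ?case .
qed simp

lemma acts_teq_left: "teq u u' \<Longrightarrow> teq (acts u x) (acts u' x)"
proof (induction u arbitrary: u')
  case (Cons e v)
  obtain p q where h: "u' = p @ e # q" "\<forall>x\<in>set p. I e x" "teq v (p @ q)"
    using teq_ConsD[OF Cons.prems] .
  have "teq (acts (e # v) x) (act e (acts (p @ q) x))" using Cons.IH[OF h(3)] by (simp add: act_teq)
  also have "teq \<dots> (acts u' x)" using acts_move[OF h(2)] h(1) teq_sym by simp
  finally show ?case .
qed simp

lemma nf_reduced: "reduced (nf w)" by (simp add: nf_def acts_reduced)

text \<open>The action factors through the group. The only step that is not literal is a
  cancellation, where \<open>act e\<close> is applied twice, and on reduced words this is the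
  identity. It makes \<open>geq\<close> a congruence.\<close>

lemma acts_nf: "reduced x \<Longrightarrow> teq (acts u x) (acts (nf u) x)"
proof (induction u)
  case Nil then show ?case by (simp add: nf_def)
next
  case (Cons e u)
  have 1: "teq (acts (e # u) x) (act e (acts (nf u) x))" using Cons by (simp add: act_teq)
  show ?case
  proof (cases "first e (nf u)")
    case True
    then obtain q where q: "teq (nf u) (e # q)" using first_def by blast
    have "teq (nf (e # u)) q" using act_first[OF q] by (simp add: nf_def)
    then have 2: "teq (acts (nf (e # u)) x) (acts q x)" by (rule acts_teq_left)
    have "teq (acts (nf u) x) (act e (acts q x))" using acts_teq_left[OF q] by simp
    then have "teq (act e (acts (nf u) x)) (act e (act e (acts q x)))" by (rule act_teq)
    also have "teq \<dots> (acts q x)" using Cons.prems by (simp add: act_act acts_reduced)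
    finally show ?thesis using 1 2 teq_sym teq_trans by blast
  next
    case False
    then have "nf (e # u) = e # nf u" by (simp add: nf_def act_not_first)
    then show ?thesis using 1 by simp
  qed
qed

lemma nf_teq: "reduced w \<Longrightarrow> teq (nf w) w"
proof (induction w)
  case Nil then show ?case by (simp add: nf_def)
next
  case (Cons e w)
  then have "teq (nf w) w" using reduced_ConsD by blast
  then have "teq (nf (e # w)) (act e w)" by (simp add: nf_def act_teq)
  moreover have "act e w = e # w" using Cons.prems act_not_first reduced_Cons_not_first by blast
  ultimately show ?case by simp
qed

lemma geq_refl [simp]: "geq w w" by (simp add: geq_def)
lemma set_act: "set (act e w) \<subseteq> insert e (set w)"
proof (cases "first e w")
  case True
  then obtain q where q: "teq w (e # q)" using first_def by blast
  then show ?thesis using teq_set[OF q] teq_set[OF act_first[OF q]] by auto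
qed (simp add: act_not_first)

lemma set_nf: "set (nf w) \<subseteq> set w"
proof (induction w)
  case (Cons e w)
  have "nf (e # w) = act e (nf w)" by (simp add: nf_def)
  then show ?case using set_act[of e "nf w"] Cons by auto
qed (simp add: nf_def)

lemma geq_sym: "geq u v \<Longrightarrow> geq v u" by (simp add: geq_def teq_sym)
lemma geq_trans [trans]: "geq u v \<Longrightarrow> geq v w \<Longrightarrow> geq u w" using teq_trans geq_def by blast

lemma nf_append: "nf (u @ v) = acts u (nf v)" by (simp add: nf_def)

lemma geq_append: "geq u u' \<Longrightarrow> geq v v' \<Longrightarrow> geq (u @ v) (u' @ v')"
proof -
  assume h: "geq u u'" "geq v v'"
  have "teq (acts u (nf v)) (acts (nf u) (nf v))" by (simp add: acts_nf nf_reduced)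
  also have "teq \<dots> (acts (nf u') (nf v))" using h(1) acts_teq_left geq_def by blast
  also have "teq \<dots> (acts u' (nf v))" by (simp add: acts_nf nf_reduced teq_sym)
  also have "teq \<dots> (acts u' (nf v'))" using h(2) acts_teq geq_def by blast
  finally show ?thesis by (simp add: geq_def nf_append)
qed

lemma geq_nf: "geq (nf w) w" by (simp add: geq_def nf_teq nf_reduced)

lemma teq_geq: "teq u v \<Longrightarrow> geq u v" by (simp add: geq_def nf_def acts_teq_left)

lemma geq_reduced: "reduced u \<Longrightarrow> reduced v \<Longrightarrow> geq u v \<Longrightarrow> teq u v"
  unfolding geq_def using teq_trans[OF teq_sym[OF nf_teq] teq_trans[OF _ nf_teq]] by blast

lemma geq_cancel: "geq (e # e # w) w"
  by (simp add: geq_def nf_def act_act acts_reduced)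

text \<open>The letters are involutions, so reversal of a word is inversion in the group.\<close>

lemma geq_rev_right: "geq (w @ rev w) []"
proof (induction w rule: rev_induct)
  case (snoc e w)
  have "geq ((w @ [e, e]) @ rev w) ((w @ []) @ rev w)"
    using geq_cancel[of e "[]"] by (intro geq_append) auto
  then show ?case using snoc geq_trans by fastforce
qed simp

lemma geq_rev_left: "geq (rev w @ w) []" using geq_rev_right[of "rev w"] by simp

lemma geq_rev: "geq u v \<Longrightarrow> geq (rev u) (rev v)"
proof -
  assume h: "geq u v"
  have "geq (rev u) (rev u @ (v @ rev v))"
    using geq_append[OF geq_refl[of "rev u"] geq_rev_right[of v]] geq_sym by auto
  also have "geq (rev u @ (v @ rev v)) (rev u @ (u @ rev v))"
    using h by (intro geq_append) (auto intro: geq_sym)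
  also have "geq (rev u @ (u @ rev v)) ([] @ rev v)"
    using geq_append[OF geq_rev_left[of u] geq_refl[of "rev v"]] by simp
  finally show ?thesis by simp
qed

lemma geq_cancel_left: "geq (rev u @ (u @ v)) v" "geq (u @ (rev u @ v)) v"
  using geq_append[OF geq_rev_left[of u] geq_refl[of v]]
    geq_append[OF geq_rev_right[of u] geq_refl[of v]] by auto

lemma geq_cancel_right: "geq ((v @ u) @ rev u) v" "geq ((v @ rev u) @ u) v"
  using geq_append[OF geq_refl[of v] geq_rev_left[of u]]
    geq_append[OF geq_refl[of v] geq_rev_right[of u]] by auto

section \<open>Word length and word metric\<close>

definition ln :: "'e list \<Rightarrow> nat" where "ln w = length (nf w)"

lemma ln_geq: "geq u v \<Longrightarrow> ln u = ln v" using geq_def ln_def teq_length by force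

lemma ln_reduced: "reduced w \<Longrightarrow> ln w = length w" using nf_teq teq_length ln_def by force

lemma length_act: "length (act e w) \<le> Suc (length w)"
proof (cases "first e w")
  case True
  then obtain q where q: "teq w (e # q)" using first_def by blast
  then show ?thesis using teq_length[OF q] teq_length[OF act_first[OF q]] by simp
qed (simp add: act_not_first)

lemma length_acts: "length (acts u w) \<le> length u + length w"
  by (induction u) (auto intro: order_trans[OF length_act])

lemma ln_append: "ln (u @ v) \<le> ln u + ln v"
proof -
  have "teq (acts u (nf v)) (acts (nf u) (nf v))" by (simp add: acts_nf nf_reduced)
  then have "ln (u @ v) = length (acts (nf u) (nf v))"
    using teq_length by (simp add: ln_def nf_append)
  then show ?thesis using length_acts[of "nf u" "nf v"] by (simp add: ln_def)
qed

lemma ln_le_length: "ln w \<le> length w" using length_acts[of w "[]"] by (simp add: ln_def nf_def)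

lemma ln_rev: "ln (rev w) = ln w"
proof -
  have "geq (rev (nf w)) (rev w)" using geq_nf geq_rev by blast
  then have "ln (rev w) = ln (rev (nf w))" using ln_geq geq_sym by blast
  also have "\<dots> = length (rev (nf w))" using ln_reduced nf_reduced reduced_rev by blast
  finally show ?thesis by (simp add: ln_def)
qed

text \<open>Since \<open>rev u\<close> is the inverse of \<open>u\<close>, this is the
  left-invariant word metric.\<close>

definition wd :: "'e list \<Rightarrow> 'e list \<Rightarrow> nat" where "wd u v = ln (rev u @ v)"

lemma wd_geq: "geq u u' \<Longrightarrow> geq v v' \<Longrightarrow> wd u v = wd u' v'"
  unfolding wd_def by (intro ln_geq geq_append geq_rev)

lemma wd_sym: "wd u v = wd v u" unfolding wd_def using ln_rev[of "rev u @ v"] by simp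

lemma wd_self [simp]: "wd u u = 0"
  unfolding wd_def using ln_geq[OF geq_rev_left[of u]] by (simp add: ln_def nf_def)

lemma wd_translate: "wd (g @ u) (g @ v) = wd u v"
  unfolding wd_def using ln_geq[of "rev u @ (rev g @ (g @ v))" "rev u @ v"]
    geq_append[OF geq_refl geq_cancel_left(1)] by simp

lemma wd_triangle: "wd u w \<le> wd u v + wd v w"
proof -
  have "geq ((rev u @ v) @ (rev v @ w)) (rev u @ w)"
    using geq_append[OF geq_refl[of "rev u"] geq_cancel_left(2)[of v w]] by simp
  then have "ln (rev u @ w) = ln ((rev u @ v) @ (rev v @ w))" using ln_geq geq_sym by blast
  then show ?thesis unfolding wd_def using ln_append[of "rev u @ v" "rev v @ w"] by simp
qed

text \<open>The letters of \<open>u\<close> are transferred one by one to the front of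
  \<open>v\<close>. A common first letter of the new pair differs from the transferred letter, hence
  is independent of it and was already a common first letter of the old pair.\<close>

lemma reduced_rev_append:
  assumes "reduced u" "reduced v" "\<And>e. \<not> (first e u \<and> first e v)"
  shows "reduced (rev u @ v)"
  using assms
proof (induction u arbitrary: v)
  case (Cons e u)
  have "first e (e # u)" using first_def teq_refl by blast
  then have "\<not> first e v" using Cons.prems by blast
  then have r: "reduced (e # v)" using Cons.prems reduced_Cons by blast
  have "\<not> (first f u \<and> first f (e # v))" for f
  proof
    assume h: "first f u \<and> first f (e # v)"
    then have "f \<noteq> e" using Cons.prems(1) reduced_Cons_not_first by blast
    then have "I e f" "first f v" using h first_Cons_dep by blast+
    then have "first f (e # u)" using h first_Cons_indep I_sym by blast
    then show False using Cons.prems(3) \<open>first f v\<close> by blast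
  qed
  then have "reduced (rev u @ (e # v))"
    by (intro Cons.IH r reduced_ConsD[OF Cons.prems(1)])
  then show ?case by simp
qed simp

text \<open>Take \<open>r\<close> as long as possible; a common first letter of the two remainders
  would lengthen it.\<close>

lemma common_prefix:
  obtains r u' v' where "teq u (r @ u')" "teq v (r @ v')" "\<And>e. \<not> (first e u' \<and> first e v')"
proof -
  define P where "P n \<longleftrightarrow> (\<exists>r u' v'. length r = n \<and> teq u (r @ u') \<and> teq v (r @ v'))" for n
  have "P 0" unfolding P_def
    by (rule exI[of _ "[]"], rule exI[of _ u], rule exI[of _ v]) simp
  moreover have "n \<le> length u" if "P n" for n
    using that teq_length[of u] unfolding P_def by auto
  ultimately obtain n where n: "P n" "\<And>m. P m \<Longrightarrow> m \<le> n"
    using GreatestI_nat[of P 0 "length u"] Greatest_le_nat[of P _ "length u"] by blast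
  then obtain r u' v' where h: "length r = n" "teq u (r @ u')" "teq v (r @ v')"
    unfolding P_def by blast
  have "\<not> (first e u' \<and> first e v')" for e
  proof
    assume "first e u' \<and> first e v'"
    then obtain a b where "teq u' (e # a)" "teq v' (e # b)" unfolding first_def by blast
    then have "teq (r @ u') (r @ e # a)" "teq (r @ v') (r @ e # b)"
      by (simp_all add: teq_append_cancel)
    then have "teq u ((r @ [e]) @ a)" "teq v ((r @ [e]) @ b)"
      using teq_trans[OF h(2)] teq_trans[OF h(3)] by simp_all
    moreover have "length (r @ [e]) = Suc n" using h(1) by simp
    ultimately have "P (Suc n)" unfolding P_def by blast
    then show False using n(2)[of "Suc n"] by simp
  qed
  then show ?thesis using that h by blast
qed

text \<open>The median of \<open>1\<close>, \<open>u\<close> and \<open>v\<close> is the greatest common prefix of their reduced words.\<close>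

lemma median:
  assumes "reduced u" "reduced v"
  obtains r u' v' where "teq u (r @ u')" "teq v (r @ v')"
    "wd [] r + wd r u = wd [] u" "wd [] r + wd r v = wd [] v" "wd u r + wd r v = wd u v"
proof -
  obtain r u' v' where h: "teq u (r @ u')" "teq v (r @ v')" "\<And>e. \<not> (first e u' \<and> first e v')"
    by (rule common_prefix[of u v]) blast
  have red: "reduced (r @ u')" "reduced (r @ v')" using h assms reduced_teq by blast+
  then have r: "reduced r" "reduced u'" "reduced v'" using reduced_appendD1 reduced_appendD2 by blast+
  have g: "geq u (r @ u')" "geq v (r @ v')" using h teq_geq by blast+
  have 1: "wd [] r = length r" using r ln_reduced by (simp add: wd_def)
  have 2: "wd r u = length u'" "wd r v = length v'"
    using wd_geq[OF geq_refl[of "r @ []"] g(1)] wd_geq[OF geq_refl[of "r @ []"] g(2)]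
      wd_translate[of r "[]"] r ln_reduced by (simp_all add: wd_def)
  have 3: "wd [] u = length r + length u'" "wd [] v = length r + length v'"
    using ln_reduced[OF assms(1)] ln_reduced[OF assms(2)] teq_length[OF h(1)] teq_length[OF h(2)]
    by (simp_all add: wd_def)
  have "wd u v = wd u' v'" using wd_geq[OF g] wd_translate by simp
  also have "\<dots> = length u' + length v'"
    unfolding wd_def using ln_reduced reduced_rev_append[OF r(2,3)] h(3) by simp
  finally have "wd u v = length u' + length v'" .
  then show ?thesis using that h 1 2 3 wd_sym[of u r] by simp
qed

text \<open>Cancellation along the common prefix of \<open>rev u\<close> and \<open>v\<close> loses
  at least twice its length, so additivity of the lengths leaves this prefix empty.\<close>

lemma reduced_if_geodesic:
  assumes "reduced u" "reduced v" "ln (u @ v) = length u + length v"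
  shows "reduced (u @ v)"
proof -
  obtain r a b where h: "teq (rev u) (r @ a)" "teq v (r @ b)" "\<And>e. \<not> (first e a \<and> first e b)"
    by (rule common_prefix[of "rev u" v]) blast
  have "geq (u @ v) (rev (r @ a) @ (r @ b))"
    using geq_append geq_rev teq_geq h by (metis rev_rev_ident)
  also have "geq \<dots> (rev a @ b)"
    using geq_append[OF geq_refl[of "rev a"] geq_cancel_left(1)[of r b]] by simp
  finally have "ln (u @ v) \<le> length a + length b" using ln_geq ln_le_length[of "rev a @ b"] by fastforce
  moreover have "length u = length r + length a" "length v = length r + length b"
    using teq_length[OF h(1)] teq_length[OF h(2)] by auto
  ultimately have "r = []" using assms(3) by auto
  then have "teq u (rev a)" "teq v b" using h teq_rev[of "rev u"] by auto
  then have "teq (u @ v) (rev a @ b)" using teq_append by blast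
  moreover have "reduced (rev a @ b)"
  proof (rule reduced_rev_append)
    show "reduced a" using \<open>r = []\<close> h(1) assms(1) reduced_rev reduced_teq by force
    show "reduced b" using \<open>teq v b\<close> assms(2) reduced_teq by blast
  qed (use h in blast)
  ultimately show ?thesis using reduced_teq teq_sym by blast
qed

end

section \<open>A hyperbolicity criterion\<close>

lemma sum_lessThan_split:
  fixes w :: "nat \<Rightarrow> real"
  assumes "k \<le> m"
  shows "(\<Sum>i<m. w i) = (\<Sum>i<k. w i) + (\<Sum>i<m - k. w (k + i))"
proof -
  have "(\<Sum>i<k + j. w i) = (\<Sum>i<k. w i) + (\<Sum>i<j. w (k + i))" for j
    by (induction j) auto
  from this[of "m - k"] show ?thesis using assms by simp
qed

text \<open>\<open>e\<close> behaves like the metric of a median graph whose intervals are uniformly thin, and \<open>d\<close> is a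
  path metric quasi-isometric to \<open>e\<close>. Thin intervals make \<open>e\<close>-triangles thin; the usual logarithmic
  bound on the distance from a geodesic to a path then shows that \<open>e\<close>-intervals stay close to
  nearly shortest \<open>d\<close>-chains.\<close>

locale thin_median =
  fixes Y :: "'y set" and d e :: "'y \<Rightarrow> 'y \<Rightarrow> real" and C \<delta> :: real
  assumes C1: "1 \<le> C" and d0: "0 \<le> \<delta>"
    and d_self: "x \<in> Y \<Longrightarrow> d x x = 0"
    and d_nonneg: "x \<in> Y \<Longrightarrow> y \<in> Y \<Longrightarrow> 0 \<le> d x y"
    and d_sym: "x \<in> Y \<Longrightarrow> y \<in> Y \<Longrightarrow> d x y = d y x"
    and d_tri: "x \<in> Y \<Longrightarrow> y \<in> Y \<Longrightarrow> z \<in> Y \<Longrightarrow> d x z \<le> d x y + d y z"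
    and e_self: "x \<in> Y \<Longrightarrow> e x x = 0"
    and e_nonneg: "x \<in> Y \<Longrightarrow> y \<in> Y \<Longrightarrow> 0 \<le> e x y"
    and e_int: "x \<in> Y \<Longrightarrow> y \<in> Y \<Longrightarrow> e x y \<in> \<nat>"
    and e_sym: "x \<in> Y \<Longrightarrow> y \<in> Y \<Longrightarrow> e x y = e y x"
    and e_tri: "x \<in> Y \<Longrightarrow> y \<in> Y \<Longrightarrow> z \<in> Y \<Longrightarrow> e x z \<le> e x y + e y z"
    and median: "x \<in> Y \<Longrightarrow> y \<in> Y \<Longrightarrow> z \<in> Y \<Longrightarrow>
      \<exists>m\<in>Y. e x m + e m y = e x y \<and> e y m + e m z = e y z \<and> e x m + e m z = e x z"
    and thin: "x \<in> Y \<Longrightarrow> y \<in> Y \<Longrightarrow> u \<in> Y \<Longrightarrow> v \<in> Y \<Longrightarrow> e x u + e u y = e x y \<Longrightarrow>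
      e x v + e v y = e x y \<Longrightarrow> e x u = e x v \<Longrightarrow> e u v \<le> \<delta>"
    and geod: "x \<in> Y \<Longrightarrow> y \<in> Y \<Longrightarrow> real k \<le> e x y \<Longrightarrow> \<exists>u\<in>Y. e x u + e u y = e x y \<and> e x u = real k"
    and e_le: "x \<in> Y \<Longrightarrow> y \<in> Y \<Longrightarrow> e x y \<le> C * d x y + C"
    and d_le: "x \<in> Y \<Longrightarrow> y \<in> Y \<Longrightarrow> d x y \<le> C * e x y + C"
    and chain: "x \<in> Y \<Longrightarrow> y \<in> Y \<Longrightarrow> \<exists>m P. P 0 = x \<and> P m = y \<and> (\<forall>i\<le>m. P i \<in> Y) \<and>
      (\<Sum>i<m. d (P i) (P (Suc i))) \<le> d x y + 1 \<and> (\<forall>i<m. e (P i) (P (Suc i)) \<le> C)"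
begin

lemma C0: "0 \<le> C" using C1 by simp

lemma e_nat:
  assumes "x \<in> Y" "y \<in> Y"
  obtains k where "e x y = real k"
  using e_int[OF assms] by (rule Nats_cases)

definition btw :: "'y \<Rightarrow> 'y \<Rightarrow> 'y set" where
  "btw x y = {u\<in>Y. e x u + e u y = e x y}"

lemma btw_sym: "x \<in> Y \<Longrightarrow> y \<in> Y \<Longrightarrow> btw x y = btw y x"
  unfolding btw_def using e_sym by (auto simp: add.commute)

lemma btw_trans: "x \<in> Y \<Longrightarrow> y \<in> Y \<Longrightarrow> m \<in> btw x y \<Longrightarrow> u \<in> btw x m \<Longrightarrow> u \<in> btw x y"
  unfolding btw_def using e_tri[of u m y] e_tri[of x u y] by auto

lemma btw_between:
  assumes "x \<in> Y" "y \<in> Y" "p \<in> btw x y" "u \<in> btw x p" "v \<in> btw p y"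
  shows "p \<in> btw u v"
proof -
  have Y: "p \<in> Y" "u \<in> Y" "v \<in> Y" using assms by (auto simp: btw_def)
  have "e x y \<le> e x u + e u v + e v y"
    using e_tri[OF assms(1) Y(2) assms(2)] e_tri[OF Y(2,3) assms(2)] by simp
  then show ?thesis using assms e_tri[OF Y(2,1,3)] Y by (auto simp: btw_def)
qed

text \<open>The median \<open>m\<close> lies on all three sides. If \<open>p\<close> is no farther
  from a corner \<open>a\<close> than \<open>m\<close> is, it is compared with the point of
  \<open>btw a m\<close> at the same distance from \<open>a\<close>; both lie in one interval that
  starts at \<open>a\<close>, so \<open>thin\<close> applies.\<close>

lemma thin_triangle:
  assumes Y: "x \<in> Y" "y \<in> Y" "z \<in> Y" and p: "p \<in> btw x y"
  obtains q where "q \<in> btw x z \<union> btw z y" "e p q \<le> \<delta>"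
proof -
  obtain m where m: "m \<in> Y" "e x m + e m y = e x y" "e y m + e m z = e y z" "e x m + e m z = e x z"
    using median[OF Y] by blast
  have pY: "p \<in> Y" using p btw_def by auto
  have main: "\<exists>q\<in>btw a z. e p q \<le> \<delta>"
    if a: "a \<in> Y" "b \<in> Y" "p \<in> btw a b" "m \<in> btw a b" "m \<in> btw a z" "e a p \<le> e a m" for a b
  proof -
    obtain k where k: "e a p = real k" by (rule e_nat[OF a(1) pY])
    obtain q where q: "q \<in> Y" "e a q + e q m = e a m" "e a q = real k"
      using geod[OF a(1) m(1), of k] a(6) k by auto
    then have "q \<in> btw a m" by (simp add: btw_def)
    then have "q \<in> btw a b" "q \<in> btw a z" using btw_trans a Y by blast+
    then show ?thesis using thin[OF a(1,2) pY q(1)] a(3) k q by (auto simp: btw_def)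
  qed
  have mm: "m \<in> btw x y" "m \<in> btw x z" "m \<in> btw y z" using m by (auto simp: btw_def)
  show ?thesis
  proof (cases "e x p \<le> e x m")
    case True then show ?thesis using main[OF Y(1,2) p] mm that by blast
  next
    case False
    then have "e y p \<le> e y m"
      using p m e_sym[OF Y(2) pY] e_sym[OF Y(2) m(1)] by (auto simp: btw_def)
    then show ?thesis using main[OF Y(2,1)] mm p that btw_sym Y by blast
  qed
qed

text \<open>The logarithmic bound for thin triangles. A chain is cut at the step where half of the
  permitted length is passed; at most two applications of \<open>thin_triangle\<close> move
  \<open>p\<close> to an interval over one of the halves, at cost at most
  \<open>2 * \<delta>\<close>. When the length is at most 1, the ends are within
  \<open>2 * C\<close> of each other by \<open>e_le\<close>.\<close>

lemma near_chain:
  assumes "\<forall>i\<le>m. P i \<in> Y" "\<forall>i<m. e (P i) (P (Suc i)) \<le> C"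
    "(\<Sum>i<m. d (P i) (P (Suc i))) \<le> 2 ^ n" "p \<in> btw (P 0) (P m)"
  shows "\<exists>i\<le>m. e p (P i) \<le> 2 * \<delta> * n + 2 * C"
  using assms
proof (induction n arbitrary: m P p)
  case 0
  note PY = "0.prems"(1)
  have "d (P 0) (P k) \<le> (\<Sum>i<k. d (P i) (P (Suc i)))" if "k \<le> m" for k
    using that
  proof (induction k)
    case 0 then show ?case using PY by (simp add: d_self)
  next
    case (Suc k)
    have "d (P 0) (P (Suc k)) \<le> d (P 0) (P k) + d (P k) (P (Suc k))"
      using d_tri PY Suc.prems by simp
    then show ?case using Suc by simp
  qed
  then have "d (P 0) (P m) \<le> 1" using 0(3) by fastforce
  then have "e (P 0) (P m) \<le> 2 * C"
    using e_le[of "P 0" "P m"] 0(1) mult_left_mono[OF _ C0, of "d (P 0) (P m)" 1] by simp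
  moreover have "p \<in> Y" "e (P 0) p + e p (P m) = e (P 0) (P m)" using 0(4) by (auto simp: btw_def)
  ultimately have "e p (P 0) \<le> 2 * C"
    using e_sym[of "P 0" p] e_nonneg[of p "P m"] 0(1) by simp
  then show ?case by auto
next
  case (Suc n)
  let ?w = "\<lambda>i. d (P i) (P (Suc i))"
  have w0: "0 \<le> ?w i" if "i < m" for i using d_nonneg that Suc.prems(1) by simp
  have nn: "2 * \<delta> * real n \<le> 2 * \<delta> * real (Suc n)" using d0 by (simp add: algebra_simps)
  show ?case
  proof (cases "(\<Sum>i<m. ?w i) \<le> 2 ^ n")
    case True
    then show ?thesis using Suc.IH[OF Suc.prems(1,2) _ Suc.prems(4)] nn by fastforce
  next
    case False
    \<comment> \<open>The first index whose partial sum exceeds \<open>2 ^ n\<close>. The part up to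
      \<open>k - 1\<close> and the part from \<open>k\<close> on both have length at most
      \<open>2 ^ n\<close>, and the single step between them is short for \<open>e\<close>.\<close>
    define k where "k = (LEAST k. \<not> (\<Sum>i<k. ?w i) \<le> 2 ^ n)"
    have k: "\<not> (\<Sum>i<k. ?w i) \<le> 2 ^ n" "k \<le> m"
      unfolding k_def using False by (rule LeastI, rule Least_le)
    then obtain j where j: "k = Suc j" by (cases k) auto
    have j1: "(\<Sum>i<j. ?w i) \<le> 2 ^ n"
      using not_less_Least[of j "\<lambda>k. \<not> (\<Sum>i<k. ?w i) \<le> 2 ^ n"] j k_def by auto
    have "(\<Sum>i<m. ?w i) = (\<Sum>i<k. ?w i) + (\<Sum>i<m - k. ?w (k + i))"
      using sum_lessThan_split[OF k(2), of ?w] by simp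
    then have j2: "(\<Sum>i<m - k. d (P (k + i)) (P (k + Suc i))) \<le> 2 ^ n" using Suc.prems(3) k(1) by simp
    have Y: "P 0 \<in> Y" "P j \<in> Y" "P k \<in> Y" "P m \<in> Y" "p \<in> Y"
      using Suc.prems k(2) j by (auto simp: btw_def)
    obtain q where q: "q \<in> btw (P 0) (P j) \<union> btw (P j) (P m)" "e p q \<le> \<delta>"
      using thin_triangle[OF Y(1,4,2) Suc.prems(4)] .
    have qY: "q \<in> Y" using q by (auto simp: btw_def)
    show ?thesis
    proof (cases "q \<in> btw (P 0) (P j)")
      case True
      obtain i where i: "i \<le> j" "e q (P i) \<le> 2 * \<delta> * n + 2 * C"
        using Suc.IH[of j P q] Suc.prems(1,2) j1 True j k(2) by auto
      have "e p (P i) \<le> e p q + e q (P i)" using e_tri Y qY Suc.prems(1) i j k(2) by simp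
      then show ?thesis using i q(2) j k(2) d0 by (intro exI[of _ i]) (auto simp: algebra_simps)
    next
      case False
      then obtain r where r: "r \<in> btw (P j) (P k) \<union> btw (P k) (P m)" "e q r \<le> \<delta>"
        using thin_triangle[OF Y(2,4,3), of q] q by blast
      have rY: "r \<in> Y" using r by (auto simp: btw_def)
      have pr: "e p r \<le> 2 * \<delta>" using e_tri[OF Y(5) qY rY] q(2) r(2) by simp
      show ?thesis
      proof (cases "r \<in> btw (P j) (P k)")
        case True
        have "e (P j) (P k) \<le> C" using Suc.prems(2) j k(2) by simp
        then have "e r (P k) \<le> C" using True e_nonneg[OF Y(2) rY] by (auto simp: btw_def)
        then have "e p (P k) \<le> 2 * \<delta> + C" using pr e_tri[OF Y(5) rY Y(3)] by simp
        moreover have "0 \<le> \<delta> * real n" using d0 by simp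
        ultimately show ?thesis using k(2) C1 by (intro exI[of _ k]) (auto simp: algebra_simps)
      next
        case False
        then have "r \<in> btw (P (k + 0)) (P (k + (m - k)))" using r k(2) by auto
        then obtain i where i: "i \<le> m - k" "e r (P (k + i)) \<le> 2 * \<delta> * n + 2 * C"
          using Suc.IH[of "m - k" "\<lambda>i. P (k + i)" r] Suc.prems(1,2) j2 k(2) by auto
        have "e p (P (k + i)) \<le> e p r + e r (P (k + i))" using e_tri Y rY Suc.prems(1) i k(2) by simp
        then show ?thesis using i pr k(2) by (intro exI[of _ "k + i"]) (auto simp: algebra_simps)
      qed
    qed
  qed
qed

text \<open>For the least admissible \<open>n\<close>, \<open>2 ^ n\<close> is at most
  \<open>2 * (a * D + b) + 2\<close> and hence bounded by a linear function of \<open>n\<close>.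
  This bounds \<open>n\<close>, and with it \<open>D\<close>.\<close>

lemma exp_linear_bound:
  fixes a b c f :: real
  assumes "0 \<le> a" "0 \<le> b" "0 \<le> c"
  obtains R where "\<And>D. 0 \<le> D \<Longrightarrow> (\<And>n. a * D + b \<le> 2 ^ n \<Longrightarrow> D \<le> c * n + f) \<Longrightarrow> D \<le> R"
proof -
  have "((\<lambda>n. (2 * (a * (c * real n + f) + b) + 2) / 2 ^ n) \<longlongrightarrow> 0) sequentially"
    by real_asymp
  then have "eventually (\<lambda>n. (2 * (a * (c * real n + f) + b) + 2) / 2 ^ n < 1) sequentially"
    by (rule order_tendstoD) simp
  then obtain N where N: "\<And>n. n \<ge> N \<Longrightarrow> 2 * (a * (c * real n + f) + b) + 2 < 2 ^ n"
    by (auto simp: eventually_sequentially divide_simps)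
  have "D \<le> c * N + \<bar>f\<bar>" if D: "0 \<le> D" "\<And>n. a * D + b \<le> 2 ^ n \<Longrightarrow> D \<le> c * n + f" for D
  proof -
    define n where "n = (LEAST n. a * D + b \<le> 2 ^ n)"
    obtain n0 where "a * D + b < 2 ^ n0" using real_arch_pow[of 2 "a * D + b"] by auto
    then have "a * D + b \<le> 2 ^ n0" by simp
    then have n: "a * D + b \<le> 2 ^ n" unfolding n_def by (rule LeastI)
    have "2 ^ n \<le> 2 * (a * D + b) + 2"
    proof (cases n)
      case 0
      then show ?thesis using assms D(1) by simp
    next
      case (Suc k)
      then have "\<not> a * D + b \<le> 2 ^ k"
        using not_less_Least[of k "\<lambda>n. a * D + b \<le> 2 ^ n"] n_def by auto
      then show ?thesis using Suc by simp
    qed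
    moreover have "a * D \<le> a * (c * n + f)" using D(2)[OF n] assms(1) mult_left_mono by blast
    ultimately have "\<not> 2 * (a * (c * real n + f) + b) + 2 < 2 ^ n" by (simp add: algebra_simps)
    then have "n < N" using N not_le by blast
    then have "c * n \<le> c * N" using assms(3) by (simp add: mult_left_mono)
    then show ?thesis using D(2)[OF n] by simp
  qed
  then show ?thesis using that by blast
qed

text \<open>The stability argument for quasi-geodesics. Let \<open>q\<close> be a point of the
  interval almost as far from the chain as possible, at distance about \<open>D\<close>. A piece of
  the chain bypasses \<open>q\<close>, keeping at distance at least \<open>D\<close>, although its
  length is only linear in \<open>D\<close>; by \<open>near_chain\<close> it must pass at a distance
  logarithmic in \<open>D\<close>, so \<open>D\<close> is bounded.\<close>

lemma btw_near_chain:
  obtains R where "0 \<le> R" "\<And>m P p. \<lbrakk>\<forall>i\<le>m. P i \<in> Y; \<forall>i<m. e (P i) (P (Suc i)) \<le> C;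
    (\<Sum>i<m. d (P i) (P (Suc i))) \<le> d (P 0) (P m) + 1; p \<in> btw (P 0) (P m)\<rbrakk> \<Longrightarrow> \<exists>i\<le>m. e p (P i) \<le> R"
proof -
  have c: "0 \<le> 6 * C" "0 \<le> C + 1" "0 \<le> 2 * \<delta>" using C1 d0 by auto
  \<comment> \<open>\<open>6 * C * D + (C + 1)\<close> bounds the \<open>d\<close>-length of the
    piece that bypasses \<open>q\<close>: its ends are at \<open>e\<close>-distance at most
    \<open>6 * D\<close>, \<open>d_le\<close> turns this into \<open>6 * C * D + C\<close>, and 1 is
    the slack of the chain.\<close>
  obtain R where R: "\<And>D. 0 \<le> D \<Longrightarrow>
      (\<And>n. 6 * C * D + (C + 1) \<le> 2 ^ n \<Longrightarrow> D \<le> 2 * \<delta> * n + (2 * C + 2 * \<delta>)) \<Longrightarrow> D \<le> R"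
    using exp_linear_bound[OF c, of "2 * C + 2 * \<delta>"] by blast
  have "\<exists>i\<le>m. e p (P i) \<le> \<bar>R\<bar>"
    if h: "\<forall>i\<le>m. P i \<in> Y" "\<forall>i<m. e (P i) (P (Suc i)) \<le> C"
      "(\<Sum>i<m. d (P i) (P (Suc i))) \<le> d (P 0) (P m) + 1" "p \<in> btw (P 0) (P m)" for m P p
  proof -
    have Y0: "P 0 \<in> Y" "P m \<in> Y" using h(1) by auto
    define near where "near q k \<longleftrightarrow> (\<exists>i\<le>m. e q (P i) \<le> real k)" for q k
    define bad where "bad k \<longleftrightarrow> (\<exists>q\<in>btw (P 0) (P m). \<not> near q k)" for k
    show ?thesis
    proof (cases "bad 0")
      case False
      then show ?thesis using h(4) unfolding bad_def near_def by force
    next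
      case b0: True
      have fin: "k \<le> nat \<lceil>e (P 0) (P m)\<rceil>" if bk: "bad k" for k
      proof -
        obtain q where q: "q \<in> btw (P 0) (P m)" "\<not> near q k" using bk bad_def by blast
        then have qY: "q \<in> Y" "e (P 0) q + e q (P m) = e (P 0) (P m)" by (auto simp: btw_def)
        have "e q (P 0) > real k" using q(2) unfolding near_def by force
        then have "real k < e (P 0) (P m)" using qY e_sym[OF qY(1) Y0(1)] e_nonneg[OF qY(1) Y0(2)] by simp
        then show ?thesis by linarith
      qed
      \<comment> \<open>Every point of the interval is within \<open>D\<close> of the chain, but not
        every one is within \<open>D - 1\<close>. Distances are integers, so the witness
        \<open>q\<close> is at distance at least \<open>D\<close> from every vertex of the
        chain.\<close>
      define D where "D = Suc (GREATEST k. bad k)"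
      have "bad (D - 1)" unfolding D_def using GreatestI_nat[of bad 0, OF b0 fin] by simp
      then obtain q where q: "q \<in> btw (P 0) (P m)" "\<not> near q (D - 1)" using bad_def by blast
      have near: "near r D" if "r \<in> btw (P 0) (P m)" for r
      proof (rule ccontr)
        assume "\<not> near r D"
        then have "bad D" using that bad_def by blast
        then have "D \<le> (GREATEST k. bad k)" using Greatest_le_nat[of bad D] fin by blast
        then show False by (simp add: D_def)
      qed
      have qY: "q \<in> Y" "e (P 0) q + e q (P m) = e (P 0) (P m)" using q by (auto simp: btw_def)
      have far: "real D \<le> e q (P i)" if "i \<le> m" for i
      proof -
        have "P i \<in> Y" using h(1) that by simp
        then obtain k where k: "e q (P i) = real k" using e_nat[OF qY(1)] by metis
        have "\<not> real k \<le> real (D - 1)" using q(2) that k unfolding near_def by force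
        then show ?thesis using k by simp
      qed
      \<comment> \<open>On either side of \<open>q\<close>, walk \<open>2 * D\<close> towards the
        end of the interval and then at most \<open>D\<close> to a vertex of the chain; the interval
        spanned by this last hop stays at distance at least \<open>D\<close> from \<open>q\<close>.
        If the end of the interval comes earlier, it is itself on the chain and the hop is
        trivial.\<close>
      have side: "\<exists>y i. y \<in> btw a q \<and> i \<le> m \<and> e y (P i) \<le> D \<and> e q y \<le> 2 * real D \<and>
          (\<forall>r\<in>btw y (P i). e q r \<ge> D)"
        if a: "a \<in> Y" "\<exists>j\<le>m. a = P j" "\<And>y. y \<in> btw a q \<Longrightarrow> y \<in> btw (P 0) (P m)" for a
      proof (cases "e a q \<le> 2 * real D")
        case True
        obtain j where j: "j \<le> m" "a = P j" using a(2) by blast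
        have "a \<in> btw a q" using a(1) e_self by (simp add: btw_def)
        moreover have "e a (P j) \<le> D" using j e_self a(1) by simp
        moreover have "e q r \<ge> D" if r: "r \<in> btw a (P j)" for r
        proof -
          have "r \<in> Y" "e a r + e r a = 0" using r j e_self a(1) by (auto simp: btw_def)
          then have "e r a = 0" using e_nonneg a(1) e_sym by force
          then have "e q a \<le> e q r" using e_tri[OF qY(1) \<open>r \<in> Y\<close> a(1)] by simp
          then show ?thesis using far[OF j(1)] j(2) by simp
        qed
        moreover have "e q a \<le> 2 * real D" using True e_sym[OF a(1) qY(1)] by simp
        ultimately show ?thesis using j by blast
      next
        case False
        have "real (2 * D) \<le> e q a" using False e_sym[OF a(1) qY(1)] by simp
        then obtain y where y: "y \<in> Y" "e q y + e y a = e q a" "e q y = real (2 * D)"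
          using geod[OF qY(1) a(1)] by blast
        have yb: "y \<in> btw a q" using y btw_sym[OF a(1) qY(1)] by (auto simp: btw_def)
        then have "near y D" using near a(3) by blast
        then obtain i where i: "i \<le> m" "e y (P i) \<le> D" unfolding near_def by auto
        have "e q r \<ge> D" if r: "r \<in> btw y (P i)" for r
        proof -
          have rY: "r \<in> Y" "e y r + e r (P i) = e y (P i)" using r by (auto simp: btw_def)
          then have "e r y \<le> D" using i e_nonneg[OF rY(1), of "P i"] e_sym[OF rY(1) y(1)] h(1) by simp
          then show ?thesis using e_tri[OF qY(1) rY(1) y(1)] y(3) by simp
        qed
        then show ?thesis using yb i y(3) by (intro exI[of _ y] exI[of _ i]) auto
      qed
      obtain y1 i1 where 1: "y1 \<in> btw (P 0) q" "i1 \<le> m" "e y1 (P i1) \<le> D" "e q y1 \<le> 2 * real D"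
          "\<forall>r\<in>btw y1 (P i1). e q r \<ge> D"
        using side[of "P 0"] Y0 btw_trans[OF Y0 q(1)] by blast
      have "btw (P m) q \<subseteq> btw (P 0) (P m)"
        using btw_trans[OF Y0(2,1)] q(1) btw_sym Y0 by blast
      then obtain y2 i2 where 2: "y2 \<in> btw (P m) q" "i2 \<le> m" "e y2 (P i2) \<le> D" "e q y2 \<le> 2 * real D"
          "\<forall>r\<in>btw y2 (P i2). e q r \<ge> D"
        using side[of "P m"] Y0 by blast
      have Y: "y1 \<in> Y" "y2 \<in> Y" "P i1 \<in> Y" "P i2 \<in> Y" using 1 2 h(1) by (auto simp: btw_def)
      have "q \<in> btw y1 y2"
        using btw_between[OF Y0 q(1) 1(1)] 2(1) btw_sym[OF Y0(2) qY(1)] by blast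
      then obtain s where s: "s \<in> btw y1 (P i1) \<union> btw (P i1) y2" "e q s \<le> \<delta>"
        using thin_triangle[OF Y(1,2,3)] by blast
      have sY: "s \<in> Y" using s by (auto simp: btw_def)
      have "real D \<le> \<bar>R\<bar>"
      proof -
        have "real D \<le> 2 * \<delta> * n + (2 * C + 2 * \<delta>)" if n: "6 * C * real D + (C + 1) \<le> 2 ^ n" for n
        proof (cases "s \<in> btw y1 (P i1)")
          case True
          have "0 \<le> \<delta> * n" using d0 by simp
          moreover have "real D \<le> \<delta>" using 1(5) True s(2) by fastforce
          ultimately show ?thesis using C1 d0 by linarith
        next
          case False
          then obtain t where t: "t \<in> btw (P i1) (P i2) \<union> btw (P i2) y2" "e s t \<le> \<delta>"
            using thin_triangle[OF Y(3,2,4)] s by blast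
          have tY: "t \<in> Y" using t by (auto simp: btw_def)
          have qt: "e q t \<le> 2 * \<delta>" using e_tri[OF qY(1) sY tY] s t by simp
          show ?thesis
          proof (cases "t \<in> btw (P i1) (P i2)")
            case False
            have "0 \<le> \<delta> * n" using d0 by simp
            moreover have "t \<in> btw y2 (P i2)" using False t btw_sym[OF Y(4,2)] by blast
            then have "real D \<le> e q t" using 2(5) by blast
            ultimately show ?thesis using qt C1 by linarith
          next
            case True
            \<comment> \<open>The sum of \<open>D\<close>, \<open>2 * D\<close>,
              \<open>2 * D\<close> and \<open>D\<close> along \<open>P i1\<close>,
              \<open>y1\<close>, \<open>q\<close>, \<open>y2\<close>, \<open>P i2\<close>.\<close>
            have e12: "e (P i1) (P i2) \<le> 6 * real D"
            proof -
              have "e (P i1) (P i2) \<le> e (P i1) y1 + (e y1 q + (e q y2 + e y2 (P i2)))"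
                using e_tri[OF Y(3,1,4)] e_tri[OF Y(1) qY(1) Y(4)] e_tri[OF qY(1) Y(2,4)] by simp
              then show ?thesis using 1 2 e_sym[OF Y(3,1)] e_sym[OF Y(1) qY(1)] by simp
            qed
            \<comment> \<open>A subchain inherits the slack 1, because the two outer parts are at
              least as long as the distances between their ends.\<close>
            have sub: "(\<Sum>k<b - a. d (P (a + k)) (P (a + Suc k))) \<le> d (P a) (P b) + 1"
              if "a \<le> b" "b \<le> m" for a b
            proof -
              have dsum: "d (P u) (P (u + v)) \<le> (\<Sum>k<v. d (P (u + k)) (P (u + Suc k)))" if "u + v \<le> m" for u v
                using that
              proof (induction v)
                case 0 then show ?case using h(1) by (simp add: d_self)
              next
                case (Suc v)
                have "d (P u) (P (u + Suc v)) \<le> d (P u) (P (u + v)) + d (P (u + v)) (P (u + Suc v))"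
                  using d_tri h(1) Suc.prems by simp
                then show ?case using Suc by simp
              qed
              have "(\<Sum>k<m. d (P k) (P (Suc k))) = (\<Sum>k<a. d (P k) (P (Suc k)))
                  + (\<Sum>k<b - a. d (P (a + k)) (P (a + Suc k))) + (\<Sum>k<m - b. d (P (b + k)) (P (b + Suc k)))"
                using sum_lessThan_split[of a m "\<lambda>k. d (P k) (P (Suc k))"]
                  sum_lessThan_split[of "b - a" "m - a" "\<lambda>k. d (P (a + k)) (P (Suc (a + k)))"] that
                by simp
              moreover have "d (P 0) (P a) \<le> (\<Sum>k<a. d (P k) (P (Suc k)))" using dsum[of 0 a] that by simp
              moreover have "d (P b) (P m) \<le> (\<Sum>k<m - b. d (P (b + k)) (P (b + Suc k)))"
                using dsum[of b "m - b"] that by simp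
              moreover have "d (P 0) (P m) \<le> d (P 0) (P a) + (d (P a) (P b) + d (P b) (P m))"
                using d_tri[of "P 0" "P a" "P m"] d_tri[of "P a" "P b" "P m"] h(1) that by simp
              ultimately show ?thesis using h(3) by linarith
            qed
            define a b where "a = min i1 i2" and "b = max i1 i2"
            have ab: "a \<le> b" "b \<le> m" "t \<in> btw (P a) (P b)" "e (P a) (P b) \<le> 6 * real D" "P a \<in> Y" "P b \<in> Y"
              using True 1 2 e12 btw_sym[OF Y(3,4)] e_sym[OF Y(3,4)] Y
              by (auto simp: a_def b_def min_def max_def)
            have "d (P a) (P b) \<le> C * (6 * real D) + C"
              using d_le[OF ab(5,6)] mult_left_mono[OF ab(4) C0] by simp
            then have "(\<Sum>k<b - a. d (P (a + k)) (P (a + Suc k))) \<le> 2 ^ n"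
              using sub[OF ab(1,2)] n by (simp add: algebra_simps)
            then obtain k where k: "k \<le> b - a" "e t (P (a + k)) \<le> 2 * \<delta> * n + 2 * C"
              using near_chain[of "b - a" "\<lambda>k. P (a + k)" n t] ab h(1,2) by auto
            have ak: "a + k \<le> m" using k ab by simp
            have "e q (P (a + k)) \<le> e q t + e t (P (a + k))" using e_tri[OF qY(1) tY] h(1) ak by simp
            then show ?thesis using far[OF ak] qt k by simp
          qed
        qed
        then show ?thesis using R[of "real D"] by fastforce
      qed
      then show ?thesis using near[OF h(4)] unfolding near_def by fastforce
    qed
  qed
  then show ?thesis using that[of "\<bar>R\<bar>"] by simp
qed

text \<open>A point of the interval is within \<open>R\<close> of a nearly shortest chain, along
  which \<open>d\<close> is additive up to 1; each of the two detours to the chain costs at most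
  \<open>C * R + C\<close>.\<close>

lemma near_additive:
  obtains K where "0 \<le> K" "\<And>x y p. x \<in> Y \<Longrightarrow> y \<in> Y \<Longrightarrow> p \<in> btw x y \<Longrightarrow> d x p + d p y \<le> d x y + K"
proof -
  obtain R where R: "0 \<le> R" "\<And>m P p. \<lbrakk>\<forall>i\<le>m. P i \<in> Y; \<forall>i<m. e (P i) (P (Suc i)) \<le> C;
    (\<Sum>i<m. d (P i) (P (Suc i))) \<le> d (P 0) (P m) + 1; p \<in> btw (P 0) (P m)\<rbrakk> \<Longrightarrow> \<exists>i\<le>m. e p (P i) \<le> R"
    by (rule btw_near_chain) blast
  have "d x p + d p y \<le> d x y + (2 * (C * R + C) + 1)" if h: "x \<in> Y" "y \<in> Y" "p \<in> btw x y" for x y p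
  proof -
    obtain m P where P: "P 0 = x" "P m = y" "\<forall>i\<le>m. P i \<in> Y"
      "(\<Sum>i<m. d (P i) (P (Suc i))) \<le> d x y + 1" "\<forall>i<m. e (P i) (P (Suc i)) \<le> C"
      using chain[OF h(1,2)] by blast
    obtain i where i: "i \<le> m" "e p (P i) \<le> R" using R(2)[of m P p] P h by auto
    have Y: "p \<in> Y" "P i \<in> Y" using h P i by (auto simp: btw_def)
    have dp: "d p (P i) \<le> C * R + C" using d_le[OF Y] mult_left_mono[OF i(2) C0] by simp
    have dsum: "d (P u) (P (u + v)) \<le> (\<Sum>k=u..<u+v. d (P k) (P (Suc k)))" if "u + v \<le> m" for u v
      using that
    proof (induction v)
      case 0 then show ?case using P(3) by (simp add: d_self)
    next
      case (Suc v)
      have "d (P u) (P (u + Suc v)) \<le> d (P u) (P (u + v)) + d (P (u + v)) (P (u + Suc v))"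
        using d_tri P(3) Suc.prems by simp
      then show ?case using Suc by simp
    qed
    have "d x (P i) + d (P i) y \<le> d x y + 1"
      using dsum[of 0 i] dsum[of i "m - i"] i P(1,2,4)
        sum.atLeastLessThan_concat[of 0 i m "\<lambda>k. d (P k) (P (Suc k))"]
      by (simp add: lessThan_atLeast0)
    then show ?thesis
      using d_tri[OF h(1) Y(2,1)] d_tri[OF Y(1,2) h(2)] dp d_sym[OF Y] by simp
  qed
  then show ?thesis using that[of "2 * (C * R + C) + 1"] C1 R(1) by simp
qed

text \<open>Up to a constant, the Gromov product of \<open>x\<close> and \<open>y\<close> at
  \<open>w\<close> is the \<open>d\<close>-distance from \<open>w\<close> to the
  \<open>e\<close>-median of the three points. The medians for \<open>x\<close>, \<open>y\<close>
  and for \<open>y\<close>, \<open>z\<close> both lie in \<open>btw w y\<close>, where thinness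
  shifts the one nearer to \<open>w\<close> onto an interval that leads to the other.\<close>

theorem hyperbolic: "gromov_hyperbolic Y d"
proof -
  obtain K where K: "0 \<le> K" "\<And>x y p. x \<in> Y \<Longrightarrow> y \<in> Y \<Longrightarrow> p \<in> btw x y \<Longrightarrow> d x p + d p y \<le> d x y + K"
    by (rule near_additive) blast
  define L where "L = C * \<delta> + C"
  have L0: "0 \<le> L" unfolding L_def using C1 d0 by simp
  have "gromov_product d w x z \<ge> min (gromov_product d w x y) (gromov_product d w y z) - (4 * K + 4 * L)"
    if Y: "w \<in> Y" "x \<in> Y" "y \<in> Y" "z \<in> Y" for w x y z
  proof -
    obtain m where m: "m \<in> btw w x" "m \<in> btw w y" "m \<in> btw x y" "m \<in> Y"
      using median[OF Y(2,1,3)] btw_sym Y unfolding btw_def by blast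
    obtain m' where m': "m' \<in> btw w y" "m' \<in> btw w z" "m' \<in> btw y z" "m' \<in> Y"
      using median[OF Y(3,1,4)] btw_sym Y unfolding btw_def by blast
    have gp: "gromov_product d w a b \<le> d w p + K"
      if "a \<in> Y" "b \<in> Y" "p \<in> btw w a" "p \<in> btw w b" "p \<in> btw a b" "p \<in> Y" for a b p
      using d_tri[of w p a] d_tri[of w p b] K(2)[of a b p] that Y d_sym[of a p] d_sym[of b p]
        d_sym[of a w] d_sym[of b w] d_sym[of w p] K(1)
      unfolding gromov_product_def by (simp add: field_simps)
    \<comment> \<open>\<open>r\<close> is a point of \<open>btw w q\<close> level with
      \<open>p\<close>. It lies in \<open>btw w v\<close> and is within \<open>L\<close> of
      \<open>p\<close>, so nearly shortest ways from \<open>w\<close> to \<open>u\<close> and from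
      \<open>w\<close> to \<open>v\<close> both pass near \<open>p\<close>.\<close>
    have key: "gromov_product d w u v \<ge> d w p - (4 * K + 4 * L) + K"
      if u: "u \<in> Y" "v \<in> Y" "p \<in> btw w u" "p \<in> btw w y" "q \<in> btw w y" "q \<in> btw w v" "e w p \<le> e w q" for u v p q
    proof -
      have pq: "p \<in> Y" "q \<in> Y" using u by (auto simp: btw_def)
      obtain k where k: "e w p = real k" by (rule e_nat[OF Y(1) pq(1)])
      obtain r where r: "r \<in> Y" "e w r + e r q = e w q" "e w r = real k"
        using geod[OF Y(1) pq(2), of k] u k by auto
      then have rq: "r \<in> btw w q" by (simp add: btw_def)
      then have rb: "r \<in> btw w y" "r \<in> btw w v" using btw_trans Y u by blast+
      have "e p r \<le> \<delta>" using thin[OF Y(1,3) pq(1) r(1)] u(4) rb k r by (auto simp: btw_def)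
      then have pr: "d p r \<le> L" unfolding L_def using d_le[OF pq(1) r(1)] mult_left_mono[OF _ C0, of "e p r" \<delta>] by simp
      show ?thesis
        using K(2)[OF Y(1) u(1,3)] K(2)[OF Y(1) u(2) rb(2)] d_tri[OF u(1) pq(1) u(2)] d_tri[OF pq(1) r(1) u(2)]
          d_tri[OF Y(1) r(1) pq(1)] pr d_sym[OF u(1) pq(1)] d_sym[OF u(1) Y(1)] d_sym[OF u(2) Y(1)] d_sym[OF pq(1) r(1)]
          K(1) L0 unfolding gromov_product_def by (simp add: field_simps)
    qed
    show ?thesis
    proof (cases "e w m \<le> e w m'")
      case True
      show ?thesis using key[OF Y(2,4) m(1,2) m'(1,2) True] gp[OF Y(2,3) m] by simp
    next
      case False
      then have "gromov_product d w z x \<ge> d w m' - (4 * K + 4 * L) + K"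
        using key[OF Y(4,2) m'(2,1) m(2,1)] by simp
      moreover have "gromov_product d w z x = gromov_product d w x z"
        unfolding gromov_product_def using d_sym[OF Y(2,4)] by simp
      ultimately show ?thesis using gp[OF Y(3,4) m'] by simp
    qed
  qed
  then show ?thesis unfolding gromov_hyperbolic_def
    by (intro exI[of _ "4 * K + 4 * L"]) (use K(1) L0 in auto)
qed

end

section \<open>Edge paths in the coupled link complex\<close>

text \<open>The complex is described by the join of the two flag complexes, with vertex set \<open>U\<close>: by
  flagness a set is a simplex of the join iff its elements are pairwise \<open>compat\<close>. Cubes are the
  simplices of the join that meet every colour. An edge in direction \<open>i\<close> is labelled by the pair
  of its ends in colour \<open>i\<close>; two labels commute iff they are joined in both factors, so edge
  paths embed the universal cover into a right-angled Coxeter group.\<close>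

locale coupled =
  fixes U :: "'u set" and n :: nat and col :: "'u \<Rightarrow> nat" and side :: "'u \<Rightarrow> bool"
    and compat :: "'u \<Rightarrow> 'u \<Rightarrow> bool"
  assumes finU: "finite U"
    and col_range: "u \<in> U \<Longrightarrow> col u \<in> {1..n}"
    and compat_refl: "compat u u"
    and compat_sym: "compat u v \<Longrightarrow> compat v u"
    and compat_same: "u \<in> U \<Longrightarrow> v \<in> U \<Longrightarrow> u \<noteq> v \<Longrightarrow> side u = side v \<Longrightarrow> compat u v \<Longrightarrow> col u \<noteq> col v"
    and compat_diff: "side u \<noteq> side v \<Longrightarrow> compat u v"
    and no_common_flat: "\<exists>\<sigma>. \<not> (\<exists>c\<in>U. \<exists>c'\<in>U. \<exists>g\<in>U. \<exists>g'\<in>U. side c = \<sigma> \<and> side c' = \<sigma> \<and> side g = \<sigma> \<and> side g' = \<sigma> \<and>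
        col c = i \<and> col g = j \<and> \<not> compat c c' \<and> \<not> compat g g' \<and>
        compat c g \<and> compat c g' \<and> compat c' g \<and> compat c' g')"
begin

text \<open>By flagness, two such edges in succession span a square. The letters range over all
  sets; the clause \<open>e \<noteq> f\<close> secures irreflexivity for \<open>{}\<close> as
  well.\<close>

definition indep :: "'u set \<Rightarrow> 'u set \<Rightarrow> bool" where
  "indep e f \<longleftrightarrow> e \<noteq> f \<and> (\<forall>s\<in>e. \<forall>t\<in>f. col s \<noteq> col t \<and> compat s t)"

sublocale independence indep
proof
  show "indep a b \<Longrightarrow> indep b a" for a b unfolding indep_def using compat_sym by metis
  show "\<not> indep a a" for a by (simp add: indep_def)
qed

definition cell :: "'u set \<Rightarrow> bool" where
  "cell c \<longleftrightarrow> c \<subseteq> U \<and> (\<forall>u\<in>c. \<forall>v\<in>c. compat u v) \<and> (\<forall>i\<in>{1..n}. \<exists>u\<in>c. col u = i)"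

definition vertex :: "'u set \<Rightarrow> bool" where
  "vertex x \<longleftrightarrow> cell x \<and> inj_on col x"

definition edge_at :: "'u set \<Rightarrow> 'u set \<Rightarrow> bool" where
  "edge_at x e \<longleftrightarrow> (\<exists>a b. e = {a, b} \<and> a \<in> x \<and> b \<notin> x \<and> b \<in> U \<and> col a = col b \<and> cell (insert b x))"

text \<open>Crossing an edge is the symmetric difference with its label. Hence it is an involution
  and two moves commute, without any hypothesis of validity.\<close>

definition mv :: "'u set \<Rightarrow> 'u set \<Rightarrow> 'u set" where
  "mv x e = (x - e) \<union> (e - x)"

lemma cell_between: "cell c \<Longrightarrow> cell d \<Longrightarrow> c \<subseteq> e \<Longrightarrow> e \<subseteq> d \<Longrightarrow> cell e"
  unfolding cell_def by (meson subset_iff)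

lemma vertex_cell: "vertex x \<Longrightarrow> cell x" by (simp add: vertex_def)

lemma cell_colour: "cell c \<Longrightarrow> i \<in> {1..n} \<Longrightarrow> \<exists>u\<in>c. col u = i"
  by (auto simp only: cell_def)

lemma cell_compat: "cell c \<Longrightarrow> u \<in> c \<Longrightarrow> v \<in> c \<Longrightarrow> compat u v"
  by (simp add: cell_def)

lemma cell_mono: "cell d \<Longrightarrow> e \<subseteq> d \<Longrightarrow> (\<And>i. i \<in> {1..n} \<Longrightarrow> \<exists>u\<in>e. col u = i) \<Longrightarrow> cell e"
  unfolding cell_def by (meson subset_iff)

lemma vertex_unique: "vertex x \<Longrightarrow> u \<in> x \<Longrightarrow> v \<in> x \<Longrightarrow> col u = col v \<Longrightarrow> u = v"
  by (auto simp: vertex_def inj_on_def)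

lemma vertex_colour: "vertex x \<Longrightarrow> u \<in> U \<Longrightarrow> \<exists>a\<in>x. col a = col u"
  unfolding vertex_def cell_def using col_range by simp

lemma vertex_subset_eq:
  assumes "vertex x" "vertex y" "y \<subseteq> x"
  shows "y = x"
proof -
  have "u \<in> y" if "u \<in> x" for u
  proof -
    have "u \<in> U" using that assms(1) by (auto simp: vertex_def cell_def)
    then obtain v where "v \<in> y" "col v = col u" using vertex_colour assms(2) by blast
    then show ?thesis using vertex_unique[OF assms(1)] assms(3) that by blast
  qed
  then show ?thesis using assms(3) by blast
qed

lemma edge_atE:
  assumes "vertex x" "edge_at x e"
  obtains a b where "e = {a, b}" "a \<in> x" "b \<notin> x" "a \<in> U" "b \<in> U" "a \<noteq> b" "col a = col b" "cell (insert b x)"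
    "side a \<noteq> side b" "mv x e = insert b (x - {a})"
proof -
  obtain a b where h: "e = {a, b}" "a \<in> x" "b \<notin> x" "b \<in> U" "col a = col b" "cell (insert b x)"
    using assms(2) edge_at_def by blast
  have "a \<in> U" "compat a b" "a \<noteq> b" using h by (auto simp: cell_def)
  then have "side a \<noteq> side b" using compat_same h by blast
  moreover have "mv x e = insert b (x - {a})" using h by (auto simp: mv_def)
  ultimately show ?thesis using that h \<open>a \<in> U\<close> \<open>a \<noteq> b\<close> by blast
qed

lemma mv_mv [simp]: "mv (mv x e) e = x" by (auto simp: mv_def)

lemma mv_commute: "mv (mv x e) f = mv (mv x f) e" by (auto simp: mv_def)

lemma edge_step:
  assumes "vertex x" "edge_at x e"
  shows "vertex (mv x e)" "edge_at (mv x e) e" "cell (x \<union> mv x e)"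
proof -
  obtain a b where h: "e = {a, b}" "a \<in> x" "b \<notin> x" "a \<in> U" "b \<in> U" "a \<noteq> b" "col a = col b"
    "cell (insert b x)" "mv x e = insert b (x - {a})"
    using edge_atE[OF assms] by metis
  have *: "insert a (mv x e) = insert b x" "x \<union> mv x e = insert b x" using h by auto
  show "cell (x \<union> mv x e)" using h(8) by (simp only: *(2))
  have "\<exists>u\<in>mv x e. col u = i" if i: "i \<in> {1..n}" for i
  proof -
    obtain u where "u \<in> x" "col u = i" using cell_colour[OF vertex_cell[OF assms(1)] i] by blast
    then show ?thesis using h(7,9) by (cases "u = a") auto
  qed
  moreover have "mv x e \<subseteq> insert b x" using h(9) by auto
  ultimately have "cell (mv x e)" using cell_mono[OF h(8)] by blast
  moreover have "inj_on col (mv x e)"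
    unfolding h(9)
  proof (rule inj_onI)
    fix u v assume uv: "u \<in> insert b (x - {a})" "v \<in> insert b (x - {a})" "col u = col v"
    then show "u = v" using vertex_unique[OF assms(1), of u v] vertex_unique[OF assms(1), of a v]
      vertex_unique[OF assms(1), of u a] h(2,7) by auto
  qed
  ultimately show "vertex (mv x e)" by (simp add: vertex_def)
  have "a \<notin> mv x e" "b \<in> mv x e" using h(6,9) by auto
  then show "edge_at (mv x e) e"
    unfolding edge_at_def using h(1,4,7,8) * by (intro exI[of _ b] exI[of _ a]) auto
qed

text \<open>The two given cells test all pairs in \<open>x \<union> {b, d}\<close> except
  \<open>a\<close> with \<open>d\<close>, and this pair is compatible by independence.\<close>

lemma edge_square:
  assumes "vertex x" "edge_at x e" "edge_at (mv x e) f" "indep e f"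
  shows "edge_at x f" "edge_at (mv x f) e" "cell (x \<union> e \<union> f)"
proof -
  obtain a b where h: "e = {a, b}" "a \<in> x" "b \<notin> x" "a \<in> U" "b \<in> U" "a \<noteq> b" "col a = col b"
    "cell (insert b x)" "mv x e = insert b (x - {a})"
    using edge_atE[OF assms(1,2)] by metis
  obtain c d where k: "f = {c, d}" "c \<in> mv x e" "d \<notin> mv x e" "c \<in> U" "d \<in> U" "c \<noteq> d" "col c = col d"
    "cell (insert d (mv x e))"
    using edge_atE[OF edge_step(1)[OF assms(1,2)] assms(3)] by metis
  have i: "col a \<noteq> col c" "col a \<noteq> col d" "col b \<noteq> col c" "col b \<noteq> col d" "compat a c" "compat a d"
    using assms(4) h k by (auto simp: indep_def)
  have cd: "c \<in> x" "d \<notin> x" "c \<noteq> a" using k(2,3) i(1,2,3) unfolding h(9) by auto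
  have all: "cell (x \<union> {b, d})"
  proof -
    have "compat u v" if "u \<in> x \<union> {b, d}" "v \<in> x \<union> {b, d}" for u v
    proof -
      have 1: "compat u v" if "u \<in> insert b x" "v \<in> insert b x" for u v using cell_compat[OF h(8)] that by blast
      have 2: "compat u v" if "u \<in> insert d (mv x e)" "v \<in> insert d (mv x e)" for u v
        using cell_compat[OF k(8)] that by blast
      have "compat u d" if "u \<in> x \<union> {b}" for u
        using 2[of u d] that h(9) i(6) by (cases "u = a") auto
      then show ?thesis using that 1 compat_sym compat_refl[of d] by auto
    qed
    then show ?thesis using h(8) k(5) unfolding cell_def by blast
  qed
  have eq: "x \<union> e \<union> f = x \<union> {b, d}" using h(1,2) k(1) cd(1) by auto
  then show "cell (x \<union> e \<union> f)" using all by simp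
  have dx: "cell (insert d x)"
    by (rule cell_between[OF vertex_cell[OF assms(1)] all]) auto
  then show xf: "edge_at x f" unfolding edge_at_def using k(1,5,7) cd(1,2) by blast
  have m: "mv x f = insert d (x - {c})" using k(1) cd(1,2) by (auto simp: mv_def)
  have "cell (insert b (mv x f))"
    by (rule cell_between[OF vertex_cell[OF edge_step(1)[OF assms(1) xf]] all]) (auto simp: m)
  then show "edge_at (mv x f) e"
    unfolding edge_at_def using h(1,2,3,5,7) cd(3) i(4) by (intro exI[of _ a] exI[of _ b]) (auto simp: m)
qed

section \<open>Edge paths under shuffles and cancellations\<close>

primrec vpath :: "'u set \<Rightarrow> 'u set list \<Rightarrow> bool" where
  "vpath x [] \<longleftrightarrow> vertex x"
| "vpath x (e # w) \<longleftrightarrow> vertex x \<and> edge_at x e \<and> vpath (mv x e) w"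

abbreviation endp :: "'u set \<Rightarrow> 'u set list \<Rightarrow> 'u set" where
  "endp x w \<equiv> foldl mv x w"

lemma vpath_start: "vpath x w \<Longrightarrow> vertex x" by (cases w) auto

lemma vpath_append: "vpath x (u @ v) \<longleftrightarrow> vpath x u \<and> vpath (endp x u) v"
  by (induction u arbitrary: x) (auto dest: vpath_start)

lemma vpath_end: "vpath x w \<Longrightarrow> vertex (endp x w)"
  by (induction w arbitrary: x) auto

lemma vpath_rev: "vpath x w \<Longrightarrow> vpath (endp x w) (rev w) \<and> endp (endp x w) (rev w) = x"
proof (induction w arbitrary: x)
  case (Cons e w)
  then have "vpath (endp (mv x e) w) (rev w)" "endp (endp (mv x e) w) (rev w) = mv x e"
    "vertex x" "edge_at x e" by auto
  then show ?case using edge_step[of x e] by (simp add: vpath_append)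
qed simp

text \<open>A swap exchanges the two ways around a square, which \<open>edge_square\<close>
  provides.\<close>

lemma vpath_teq: "teq w w' \<Longrightarrow> \<forall>x. vpath x w \<longrightarrow> vpath x w' \<and> endp x w' = endp x w"
proof (induction rule: teq_induct)
  case (swap u a b v)
  show ?case
  proof (intro allI impI)
    fix x assume x: "vpath x (u @ a # b # v)"
    let ?z = "endp x u"
    have z: "vertex ?z" "edge_at ?z a" "edge_at (mv ?z a) b" "vpath (mv (mv ?z a) b) v" "vpath x u"
      using x by (simp_all add: vpath_append)
    note sq = edge_square[OF z(1,2,3) swap]
    have "mv (mv ?z b) a = mv (mv ?z a) b" by (rule mv_commute)
    then show "vpath x (u @ b # a # v) \<and> endp x (u @ b # a # v) = endp x (u @ a # b # v)"
      using z sq edge_step(1)[OF z(1) sq(1)] by (simp add: vpath_append)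
  qed
qed simp_all

lemma vpath_teqD: "teq w w' \<Longrightarrow> vpath x w \<Longrightarrow> vpath x w'" "teq w w' \<Longrightarrow> vpath x w \<Longrightarrow> endp x w' = endp x w"
  using vpath_teq by blast+

text \<open>All intermediate words are valid paths, so \<open>R\<close> need only respect square
  moves at the start of a valid path and the prepending of an edge. The application takes for
  \<open>R\<close> the homotopy of realised paths.\<close>

lemma vpath_teq_induct:
  assumes "teq w w'" "vpath x w"
    and r: "\<And>x w. vpath x w \<Longrightarrow> R x w w"
    and t: "\<And>x u v w. vpath x u \<Longrightarrow> vpath x v \<Longrightarrow> vpath x w \<Longrightarrow> R x u v \<Longrightarrow> R x v w \<Longrightarrow> R x u w"
    and s: "\<And>x a b v. vpath x (a # b # v) \<Longrightarrow> indep a b \<Longrightarrow> R x (a # b # v) (b # a # v)"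
    and k: "\<And>x e u v. vpath x (e # u) \<Longrightarrow> vpath x (e # v) \<Longrightarrow> R (mv x e) u v \<Longrightarrow> R x (e # u) (e # v)"
  shows "R x w w'"
proof -
  have k': "R x (u @ v) (u @ v')" if "vpath x (u @ v)" "vpath x (u @ v')" "R (endp x u) v v'" for x u v v'
    using that by (induction u arbitrary: x) (auto intro!: k)
  have "\<forall>x. vpath x w \<longrightarrow> vpath x w' \<and> R x w w'"
    using assms(1)
  proof (induction rule: teq_induct)
    case (swap u a b v)
    have "vpath x (u @ b # a # v)" if "vpath x (u @ a # b # v)" for x
      using vpath_teqD(1) that teq_append[OF teq_refl teq_swap[OF swap]] by blast
    then show ?case using swap by (auto intro!: k' s simp: vpath_append)
  next
    case (trans u v w) then show ?case using t by blast
  qed (use r in auto)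
  then show ?thesis using assms(2) by blast
qed

text \<open>Normalisation uses only square moves and the removal of backtracking, and both keep the
  path valid with the same end. The trivial \<open>R\<close> gives \<open>vpath_nf\<close>, homotopy
  gives \<open>rp_nf\<close>.\<close>

lemma vpath_nf_induct:
  assumes "vpath x w"
    and r: "\<And>x w. vpath x w \<Longrightarrow> R x w w"
    and t: "\<And>x u v w. vpath x u \<Longrightarrow> vpath x v \<Longrightarrow> vpath x w \<Longrightarrow> R x u v \<Longrightarrow> R x v w \<Longrightarrow> R x u w"
    and s: "\<And>x a b v. vpath x (a # b # v) \<Longrightarrow> indep a b \<Longrightarrow> R x (a # b # v) (b # a # v)"
    and c: "\<And>x e v. vpath x (e # e # v) \<Longrightarrow> R x (e # e # v) v"
    and k: "\<And>x e u v. vpath x (e # u) \<Longrightarrow> vpath x (e # v) \<Longrightarrow> R (mv x e) u v \<Longrightarrow> R x (e # u) (e # v)"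
  shows "vpath x (nf w) \<and> endp x (nf w) = endp x w \<and> R x w (nf w)"
proof -
  have teqR: "R x w w'" if "teq w w'" "vpath x w" for x w w'
    using vpath_teq_induct[where R = R] that r t s k by blast
  show ?thesis using assms(1)
  proof (induction w arbitrary: x)
    case Nil
    then show ?case using r by (simp add: nf_def)
  next
    case (Cons e w)
    then have h: "vpath (mv x e) (nf w)" "endp (mv x e) (nf w) = endp (mv x e) w" "R (mv x e) w (nf w)"
      "vertex x" "edge_at x e" by auto
    have e: "vpath x (e # nf w)" "R x (e # w) (e # nf w)" using h k Cons.prems by auto
    have a: "nf (e # w) = act e (nf w)" by (simp add: nf_def)
    show ?case
    proof (cases "first e (nf w)")
      case False
      then show ?thesis using e h a by (simp add: act_not_first)
    next
      case True
      then obtain q where q: "teq (nf w) (e # q)" using first_def by blast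
      have q': "vpath x q" "endp x q = endp x (e # w)"
        using vpath_teqD[OF q h(1)] h(2) by auto
      have aq: "teq q (act e (nf w))" using act_first[OF q] teq_sym by blast
      have v: "vpath x (e # e # q)" using h q' edge_step[of x e] by simp
      have "R x (e # nf w) (e # e # q)"
        using teqR[OF q h(1)] e(1) v by (intro k) auto
      then have "R x (e # nf w) q" using t[OF e(1) v q'(1)] c[OF v] by blast
      then have "R x (e # w) q" using t[OF Cons.prems e(1) q'(1)] e(2) by blast
      then show ?thesis
        using t[OF Cons.prems q'(1)] vpath_teqD[OF aq q'(1)] teqR[OF aq q'(1)] q' a by simp
    qed
  qed
qed

lemma vpath_nf: "vpath x w \<Longrightarrow> vpath x (nf w)" "vpath x w \<Longrightarrow> endp x (nf w) = endp x w"
  using vpath_nf_induct[of x w "\<lambda>_ _ _. True"] by auto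

section \<open>Edge paths inside one cell\<close>

lemma endp_mem: "u \<notin> \<Union>(set w) \<Longrightarrow> u \<in> endp x w \<longleftrightarrow> u \<in> x"
  by (induction w arbitrary: x) (auto simp: mv_def)

lemma vpath_letter:
  assumes "vpath x w" "e \<in> set w"
  obtains a b where "e = {a, b}" "a \<in> U" "b \<in> U" "a \<noteq> b" "col a = col b" "side a \<noteq> side b"
proof -
  obtain u v where w: "w = u @ e # v" using assms(2) split_list by metis
  then have "vertex (endp x u)" "edge_at (endp x u) e" using assms(1) by (auto simp: vpath_append)
  then show ?thesis using that edge_atE by metis
qed

text \<open>Labels inside one cell are equal or independent, so a reduced word in them repeats no
  letter. Its first label brings in a vertex that no later label contains, since later labels have
  other colours; hence the word returns to \<open>x\<close> only if it is empty.\<close>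

lemma loop_in_cell:
  assumes "vpath x w" "cell c" "\<forall>e\<in>set w. e \<subseteq> c" "endp x w = x"
  shows "geq w []"
proof -
  have "\<forall>e\<in>set (nf w). e \<subseteq> c" using assms(3) set_nf[of w] by blast
  then have v: "vpath x (nf w)" "endp x (nf w) = x" "reduced (nf w)" "\<forall>e\<in>set (nf w). e \<subseteq> c"
    using vpath_nf[OF assms(1)] assms(4) nf_reduced[of w] by simp_all
  have "nf w = []"
  proof (cases "nf w")
    case (Cons e w1)
    have dich: "e = f \<or> indep e f" if f: "f \<in> set (nf w)" for f
    proof -
      obtain a b where e: "e = {a, b}" "a \<in> U" "b \<in> U" "a \<noteq> b" "col a = col b" "side a \<noteq> side b"
        by (rule vpath_letter[OF v(1), of e]) (use Cons in auto)
      obtain p q where f': "f = {p, q}" "p \<in> U" "q \<in> U" "p \<noteq> q" "col p = col q" "side p \<noteq> side q"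
        by (rule vpath_letter[OF v(1) f])
      have "e \<subseteq> c" "f \<subseteq> c" using v(4) f Cons by auto
      then have co: "compat s t" if "s \<in> e" "t \<in> f" for s t
        using that cell_compat[OF assms(2), of s t] by blast
      show ?thesis
      proof (cases "col a = col p")
        case True
        have "s = t" if "s \<in> e" "t \<in> f" "side s = side t" for s t
        proof (rule ccontr)
          assume "s \<noteq> t"
          then show False using compat_same[of s t] co[OF that(1,2)] that e f' True by auto
        qed
        then show ?thesis using e f' by blast
      next
        case False
        then show ?thesis using co e f' unfolding indep_def by auto
      qed
    qed
    have "e \<notin> set w1"
    proof
      assume "e \<in> set w1"
      then obtain p q where w1: "w1 = p @ e # q" "e \<notin> set p" using split_list_first by metis
      then have "\<forall>f\<in>set p. indep e f" using dich Cons by auto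
      then have "teq (nf w) (p @ e # e # q)" using teq_move[of p e "e # q"] Cons w1 by simp
      then show False using v(3) reduced_def by blast
    qed
    then have ind: "\<forall>f\<in>set w1. indep e f" using dich Cons by auto
    have xe: "vertex x" "edge_at x e" using v(1) Cons by auto
    then obtain a b where ab: "e = {a, b}" "b \<notin> x" by (metis edge_atE)
    then have "b \<in> mv x e" by (simp add: mv_def)
    moreover have "b \<notin> \<Union>(set w1)" using ind ab unfolding indep_def by blast
    ultimately have "b \<in> endp x (nf w)" using Cons endp_mem[of b w1 "mv x e"] by simp
    then show ?thesis using v(2) ab by simp
  qed simp
  then show ?thesis using geq_nf geq_sym by metis
qed

lemma paths_in_cell:
  assumes "vpath x w" "vpath x w'" "cell c" "\<forall>e\<in>set w. e \<subseteq> c" "\<forall>e\<in>set w'. e \<subseteq> c" "endp x w = endp x w'"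
  shows "geq w w'"
proof -
  have "vpath x (w @ rev w')" "endp x (w @ rev w') = x"
    using vpath_rev[OF assms(2)] assms(1,6) by (auto simp: vpath_append)
  moreover have "\<forall>e\<in>set (w @ rev w'). e \<subseteq> c" using assms(4,5) by auto
  ultimately have "geq (w @ rev w') []" using loop_in_cell[OF _ assms(3)] by blast
  then have "geq ((w @ rev w') @ w') ([] @ w')" by (intro geq_append) auto
  from geq_trans[OF geq_sym[OF geq_cancel_right(2)[of w w']] this] show ?thesis by simp
qed

text \<open>The coordinates in which \<open>x\<close> and \<open>y\<close> differ are exchanged one
  at a time; there are \<open>card (y - x)\<close> of them, at most one per colour.\<close>

lemma path_in_cell_exists:
  assumes "vertex x" "vertex y" "cell (x \<union> y)"
  shows "\<exists>w. vpath x w \<and> endp x w = y \<and> (\<forall>e\<in>set w. e \<subseteq> x \<union> y) \<and> length w \<le> n"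
proof -
  have fin: "finite y" using assms(2) finU finite_subset by (auto simp: vertex_def cell_def)
  have "\<exists>w. vpath x w \<and> endp x w = y \<and> (\<forall>e\<in>set w. e \<subseteq> x \<union> y) \<and> length w = card (y - x)"
    using assms
  proof (induction "card (y - x)" arbitrary: x)
    case 0
    then have "y \<subseteq> x" using fin by auto
    then have "y = x" using vertex_subset_eq 0 by blast
    then show ?case using 0 by (intro exI[of _ "[]"]) auto
  next
    case (Suc k)
    then obtain b where b: "b \<in> y" "b \<notin> x" by (metis DiffE card.empty ex_in_conv nat.simps(3))
    then have bU: "b \<in> U" using Suc.prems(3) by (auto simp: cell_def)
    then obtain a where a: "a \<in> x" "col a = col b" using vertex_colour Suc.prems(1) by blast
    have ay: "a \<notin> y" using vertex_unique[OF Suc.prems(2), of a b] a b by auto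
    have bx: "cell (insert b x)"
      by (rule cell_between[OF vertex_cell[OF Suc.prems(1)] Suc.prems(3)]) (use b in auto)
    then have e: "edge_at x {a, b}" unfolding edge_at_def using a b bU by blast
    have m: "mv x {a, b} = insert b (x - {a})" using a b by (auto simp: mv_def)
    have v: "vertex (mv x {a, b})" using edge_step e Suc.prems(1) by blast
    have "y - mv x {a, b} = (y - x) - {b}" using m ay by auto
    then have card: "card (y - mv x {a, b}) = k" using Suc.hyps(2) b fin by simp
    have cl: "cell (mv x {a, b} \<union> y)"
      by (rule cell_between[OF vertex_cell[OF Suc.prems(2)] Suc.prems(3)]) (use b m in auto)
    obtain w where w: "vpath (mv x {a, b}) w" "endp (mv x {a, b}) w = y" "\<forall>e\<in>set w. e \<subseteq> mv x {a, b} \<union> y"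
      "length w = k" using Suc.hyps(1)[OF _ v Suc.prems(2) cl] card by auto
    have "mv x {a, b} \<union> y \<subseteq> x \<union> y" using m b by auto
    then have "\<forall>f\<in>set ({a, b} # w). f \<subseteq> x \<union> y" using w(3) a b by fastforce
    then show ?case using w e Suc by (intro exI[of _ "{a, b} # w"]) auto
  qed
  then obtain w where w: "vpath x w" "endp x w = y" "\<forall>e\<in>set w. e \<subseteq> x \<union> y" "length w = card (y - x)" by blast
  have "card (y - x) \<le> card y" using fin by (simp add: card_mono)
  also have "card y = card (col ` y)" using assms(2) by (simp add: vertex_def card_image)
  also have "\<dots> \<le> card {1..n}" using assms(2) col_range by (intro card_mono) (auto simp: vertex_def cell_def)
  finally show ?thesis using w by auto
qed

text \<open>Between the successive crossings \<open>e\<close>, \<open>e'\<close> of colour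
  \<open>i\<close> the vertex \<open>b\<close> is kept. If \<open>e'\<close> leads on to a vertex
  other than \<open>a\<close>, that vertex and \<open>a\<close> share colour and side, hence are not
  compatible. If \<open>e' = e\<close>, reducedness forces a label in between that does not commute
  with \<open>e\<close>; its ends are compatible with \<open>b\<close>, so one of them is not
  compatible with \<open>a\<close>.\<close>

lemma turn:
  assumes "vpath y (e # w @ [e'])" "reduced (e # w @ [e'])" "\<forall>u\<in>e. col u = i" "\<forall>u\<in>e'. col u = i"
    "\<forall>f\<in>set w. \<forall>u\<in>f. col u \<noteq> i"
  obtains a b where "a \<in> e" "b \<in> e" "b \<in> e'" "b \<in> endp y (e # w)" "side b \<noteq> side a"
    "\<exists>c\<in>e \<union> e'. \<exists>c'\<in>\<Union>(set (e # w @ [e'])). \<not> compat c c' \<and> side c = side a \<and> side c' = side a"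
proof -
  have xe: "vertex y" "edge_at y e" using assms(1) by auto
  obtain a b where h: "e = {a, b}" "a \<in> y" "b \<notin> y" "a \<in> U" "b \<in> U" "a \<noteq> b" "col a = col b"
    "cell (insert b y)" "side a \<noteq> side b" "mv y e = insert b (y - {a})"
    using edge_atE[OF xe] by metis
  have state: "b \<in> endp (mv y e) p" if "set p \<subseteq> set w" for p
  proof -
    have "b \<notin> \<Union>(set p)" using assms(3,5) h(1) that by fastforce
    then show ?thesis using endp_mem h(10) by simp
  qed
  have v: "vpath (mv y e) w" "vertex (endp (mv y e) w)" "edge_at (endp (mv y e) w) e'"
    using assms(1) by (auto simp: vpath_append)
  obtain c d where k: "e' = {c, d}" "c \<in> endp (mv y e) w" "d \<in> U" "c \<noteq> d" "col c = col d" "side c \<noteq> side d"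
    using edge_atE[OF v(2,3)] by metis
  have "c = b" using vertex_unique[OF v(2) k(2) state[OF order.refl]] assms(3,4) h k by simp
  have "\<exists>c\<in>e \<union> e'. \<exists>c'\<in>\<Union>(set (e # w @ [e'])). \<not> compat c c' \<and> side c = side a \<and> side c' = side a"
  proof (cases "d = a")
    case False
    have "side d = side a" using h(9) k(6) \<open>c = b\<close> by auto
    moreover have "\<not> compat a d" using compat_same[of a d] h k \<open>c = b\<close> False \<open>side d = side a\<close> by auto
    moreover have "a \<in> e \<union> e'" "d \<in> \<Union>(set (e # w @ [e']))" using h k by auto
    ultimately show ?thesis by blast
  next
    case True
    then have ee: "e' = e" using h k \<open>c = b\<close> by auto
    have "\<not> (\<forall>f\<in>set w. indep e f)"
    proof
      assume "\<forall>f\<in>set w. indep e f"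
      then have "teq (e # w @ [e']) (w @ e # e # [])" using teq_move[of w e "[e]"] ee by simp
      then show False using assms(2) reduced_def by blast
    qed
    then obtain f where f: "f \<in> set w" "\<not> indep e f" by blast
    then have "e \<noteq> f" "\<forall>s\<in>e. \<forall>t\<in>f. col s \<noteq> col t" using assms(3,5) h(1) by fastforce+
    then obtain s t where st: "s \<in> e" "t \<in> f" "\<not> compat s t" using f(2) unfolding indep_def by blast
    have "s \<noteq> b"
    proof
      assume "s = b"
      obtain p q where w: "w = p @ f # q" using f(1) split_list by metis
      then have pv: "vertex (endp (mv y e) p)" "edge_at (endp (mv y e) p) f" using v(1) by (auto simp: vpath_append)
      obtain g j where "f = {g, j}" "g \<in> endp (mv y e) p" "cell (insert j (endp (mv y e) p))"
        using edge_atE[OF pv] by metis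
      moreover have "b \<in> endp (mv y e) p" using state[of p] w by auto
      ultimately have "compat b t" using st(2) by (auto simp: cell_def)
      then show False using st \<open>s = b\<close> by simp
    qed
    then have "s = a" using st h by auto
    then have "side t = side a" using compat_diff st(3) by metis
    then show ?thesis using st f \<open>s = a\<close> by auto
  qed
  moreover have "b \<in> endp y (e # w)" using state[OF order.refl] by simp
  ultimately show ?thesis using that[of a b] h k \<open>c = b\<close> by auto
qed

definition lcol :: "'u set \<Rightarrow> nat" where "lcol e = (THE i. col ` e = {i})"

lemma lcol: "vpath x w \<Longrightarrow> e \<in> set w \<Longrightarrow> \<forall>u\<in>e. col u = lcol e"
proof -
  assume "vpath x w" "e \<in> set w"
  then obtain a b where "e = {a, b}" "col a = col b" using vpath_letter by metis
  then have "col ` e = {col a}" by auto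
  then show ?thesis unfolding lcol_def by auto
qed

lemma lcol_range: "vpath x w \<Longrightarrow> e \<in> set w \<Longrightarrow> lcol e \<in> {1..n}"
proof -
  assume h: "vpath x w" "e \<in> set w"
  then obtain a b where "e = {a, b}" "a \<in> U" using vpath_letter by metis
  then show ?thesis using lcol[OF h] col_range[of a] by auto
qed

text \<open>More than \<open>2 * n\<close> letters contain three of one colour \<open>i\<close>. The
  two turns between them keep vertices of opposite sides, so \<open>turn\<close> yields a
  non-compatible pair in either complex, with a member of colour \<open>i\<close>.\<close>

lemma long_word:
  assumes "vpath y s" "reduced s" "2 * n < length s"
  obtains i where "\<And>\<sigma>. \<exists>c\<in>\<Union>(set s). \<exists>c'\<in>\<Union>(set s). \<not> compat c c' \<and> side c = \<sigma> \<and> side c' = \<sigma> \<and> col c = i"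
proof -
  have "\<exists>i. 3 \<le> length (filter (\<lambda>e. lcol e = i) s)"
  proof (rule ccontr)
    assume "\<not> ?thesis"
    then have le: "length (filter (\<lambda>e. lcol e = i) s) \<le> 2" for i by (metis not_less_eq_eq numeral_3_eq_3 numeral_2_eq_2)
    have "length s = (\<Sum>i\<in>{1..n}. length (filter (\<lambda>e. lcol e = i) s))"
      using lcol_range[OF assms(1)]
    proof (induction s)
      case (Cons e s)
      then have "(\<Sum>i\<in>{1..n}. length (filter (\<lambda>f. lcol f = i) (e # s)))
        = (\<Sum>i\<in>{1..n}. (if lcol e = i then 1 else 0) + length (filter (\<lambda>f. lcol f = i) s))"
        by (intro sum.cong) auto
      also have "\<dots> = 1 + length s" using Cons by (simp add: sum.distrib)
      finally show ?case by simp
    qed simp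
    also have "\<dots> \<le> (\<Sum>i\<in>{1..n}. 2)" using le by (intro sum_mono) auto
    finally show False using assms(3) by simp
  qed
  then obtain i where i: "3 \<le> length (filter (\<lambda>e. lcol e = i) s)" by blast
  have split: "\<exists>u e v. w = u @ e # v \<and> lcol e = i \<and> (\<forall>f\<in>set u. lcol f \<noteq> i) \<and>
      length (filter (\<lambda>e. lcol e = i) w) = Suc (length (filter (\<lambda>e. lcol e = i) v))"
    if "1 \<le> length (filter (\<lambda>e. lcol e = i) w)" for w
  proof -
    have "filter (\<lambda>e. lcol e = i) w \<noteq> []" using that by fastforce
    then have "\<exists>e\<in>set w. lcol e = i" by (auto simp: filter_empty_conv)
    then obtain u e v where w: "w = u @ e # v" "lcol e = i" "\<forall>f\<in>set u. lcol f \<noteq> i"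
      using split_list_first_prop[of w "\<lambda>e. lcol e = i"] by blast
    then have "filter (\<lambda>e. lcol e = i) u = []" by (auto simp: filter_empty_conv)
    then show ?thesis using w by auto
  qed
  define L where "L w = length (filter (\<lambda>e. lcol e = i) w)" for w
  have split: "\<exists>u e v. w = u @ e # v \<and> lcol e = i \<and> (\<forall>f\<in>set u. lcol f \<noteq> i) \<and> L w = Suc (L v)"
    if "1 \<le> L w" for w
    using split[of w] that unfolding L_def .
  have "1 \<le> L s" using i by (simp add: L_def)
  then obtain s0 e1 v1 where 1: "s = s0 @ e1 # v1" "lcol e1 = i" "L s = Suc (L v1)"
    using split[of s] by blast
  have "1 \<le> L v1" using i 1(3) by (simp add: L_def)
  then obtain s1 e2 v2 where 2: "v1 = s1 @ e2 # v2" "lcol e2 = i" "\<forall>f\<in>set s1. lcol f \<noteq> i"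
    "L v1 = Suc (L v2)"
    using split[of v1] by blast
  have "1 \<le> L v2" using i 1(3) 2(4) by (simp add: L_def)
  then obtain s2 e3 v3 where 3: "v2 = s2 @ e3 # v3" "lcol e3 = i" "\<forall>f\<in>set s2. lcol f \<noteq> i"
    using split[of v2] by blast
  have s: "s = s0 @ (e1 # s1 @ [e2]) @ (s2 @ e3 # v3)" "s = (s0 @ e1 # s1) @ (e2 # s2 @ [e3]) @ v3"
    using 1(1) 2(1) 3(1) by simp_all
  have lc: "\<forall>u\<in>f. col u = lcol f" if "f \<in> set s" for f using lcol[OF assms(1) that] .
  have ne: "\<forall>u\<in>f. col u \<noteq> i" if "f \<in> set s1 \<union> set s2" for f
  proof -
    have "f \<in> set s" "lcol f \<noteq> i" using that 2(3) 3(3) by (auto simp: s(1))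
    then show ?thesis using lc[of f] by simp
  qed
  have eq: "\<forall>u\<in>e1. col u = i" "\<forall>u\<in>e2. col u = i" "\<forall>u\<in>e3. col u = i"
    using lc[of e1] lc[of e2] lc[of e3] 1(2) 2(2) 3(2) by (simp_all add: s(1))
  have vp: "vpath (endp y s0) (e1 # s1 @ [e2])" "vpath (endp y (s0 @ e1 # s1)) (e2 # s2 @ [e3])"
    using assms(1)[unfolded s(1)] assms(1)[unfolded s(2)] unfolding vpath_append by blast+
  have red: "reduced (e1 # s1 @ [e2])" "reduced (e2 # s2 @ [e3])"
    using reduced_appendD1[OF reduced_appendD2[OF assms(2)[unfolded s(1)]]]
      reduced_appendD1[OF reduced_appendD2[OF assms(2)[unfolded s(2)]]] by blast+
  obtain a b where ab: "b \<in> e2" "b \<in> endp (endp y s0) (e1 # s1)" "side b \<noteq> side a"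
    "\<exists>c\<in>e1 \<union> e2. \<exists>c'\<in>\<Union>(set (e1 # s1 @ [e2])). \<not> compat c c' \<and> side c = side a \<and> side c' = side a"
  proof (rule turn[OF vp(1) red(1) eq(1,2)])
    show "\<forall>f\<in>set s1. \<forall>u\<in>f. col u \<noteq> i" using ne by blast
  next
    fix a b assume "b \<in> e2" "b \<in> endp (endp y s0) (e1 # s1)" "side b \<noteq> side a"
      "\<exists>c\<in>e1 \<union> e2. \<exists>c'\<in>\<Union>(set (e1 # s1 @ [e2])). \<not> compat c c' \<and> side c = side a \<and> side c' = side a"
    then show thesis by (rule that)
  qed
  obtain p q where pq: "p \<in> e2" "q \<in> e2" "q \<in> endp (endp y (s0 @ e1 # s1)) (e2 # s2)" "side q \<noteq> side p"
    "\<exists>c\<in>e2 \<union> e3. \<exists>c'\<in>\<Union>(set (e2 # s2 @ [e3])). \<not> compat c c' \<and> side c = side p \<and> side c' = side p"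
    "p \<in> endp y (s0 @ e1 # s1)"
  proof (rule turn[OF vp(2) red(2) eq(2,3)])
    show "\<forall>f\<in>set s2. \<forall>u\<in>f. col u \<noteq> i" using ne by blast
  next
    fix p q assume h: "p \<in> e2" "q \<in> e2" "q \<in> e3" "q \<in> endp (endp y (s0 @ e1 # s1)) (e2 # s2)" "side q \<noteq> side p"
      "\<exists>c\<in>e2 \<union> e3. \<exists>c'\<in>\<Union>(set (e2 # s2 @ [e3])). \<not> compat c c' \<and> side c = side p \<and> side c' = side p"
    have z: "vertex (endp y (s0 @ e1 # s1))" "edge_at (endp y (s0 @ e1 # s1)) e2" using vp(2) by auto
    have "q \<notin> \<Union>(set s2)" using ne eq(2) h(2) by fastforce
    then have "q \<in> mv (endp y (s0 @ e1 # s1)) e2" using h(4) endp_mem by auto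
    then have "q \<notin> endp y (s0 @ e1 # s1)" using h(2) by (auto simp: mv_def)
    moreover have "p \<noteq> q" using h by auto
    ultimately have "p \<in> endp y (s0 @ e1 # s1)" using edge_atE[OF z] h(1,2) by (metis insert_iff singletonD)
    then show thesis using h by (intro that) assumption+
  qed
  \<comment> \<open>The vertex of colour \<open>i\<close> present before \<open>e2\<close> is the
    one kept by the first turn, and the second turn keeps the other end of \<open>e2\<close>. Hence
    \<open>side a\<close> and \<open>side p\<close> are the two different sides.\<close>
  have "p = b"
  proof (rule vertex_unique)
    show "vertex (endp y (s0 @ e1 # s1))" using vp(2) by simp
    show "p \<in> endp y (s0 @ e1 # s1)" by (rule pq(6))
    show "b \<in> endp y (s0 @ e1 # s1)" using ab(2) by simp
    show "col p = col b" using eq(2) pq(1) ab(1) by simp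
  qed
  have sub: "\<Union>(set (e1 # s1 @ [e2])) \<subseteq> \<Union>(set s)" "\<Union>(set (e2 # s2 @ [e3])) \<subseteq> \<Union>(set s)"
    by (auto simp: s(1))
  have "\<exists>c\<in>\<Union>(set s). \<exists>c'\<in>\<Union>(set s). \<not> compat c c' \<and> side c = \<sigma> \<and> side c' = \<sigma> \<and> col c = i" for \<sigma>
  proof (cases "\<sigma> = side a")
    case True
    obtain c c' where c: "c \<in> e1 \<union> e2" "c' \<in> \<Union>(set (e1 # s1 @ [e2]))" "\<not> compat c c'" "side c = side a" "side c' = side a"
      using ab(4) by blast
    then have "col c = i" "c \<in> \<Union>(set s)" using eq(1,2) by (auto simp: s(1))
    moreover have "c' \<in> \<Union>(set s)" using c(2) sub(1) by blast
    ultimately show ?thesis using c(3-5) True by blast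
  next
    case False
    then have "\<sigma> = side p" using ab(3) \<open>p = b\<close> by auto
    obtain c c' where c: "c \<in> e2 \<union> e3" "c' \<in> \<Union>(set (e2 # s2 @ [e3]))" "\<not> compat c c'" "side c = side p" "side c' = side p"
      using pq(5) by blast
    then have "col c = i" "c \<in> \<Union>(set s)" using eq(2,3) by (auto simp: s(1))
    moreover have "c' \<in> \<Union>(set s)" using c(2) sub(2) by blast
    ultimately show ?thesis using c(3-5) \<open>\<sigma> = side p\<close> by blast
  qed
  then show ?thesis using that by blast
qed

text \<open>If both words were long, \<open>long_word\<close> would supply colours \<open>i\<close>,
  \<open>j\<close> and non-compatible pairs on each side. Commutation joins these pairs to flat
  squares with adjacent colours \<open>i\<close>, \<open>j\<close> on both sides, against
  \<open>no_common_flat\<close>.\<close>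

lemma thin_words:
  assumes "vpath y s" "vpath z t" "reduced s" "reduced t" "\<forall>a\<in>set s. \<forall>b\<in>set t. indep a b"
  shows "length s \<le> 2 * n \<or> length t \<le> 2 * n"
proof (rule ccontr)
  assume "\<not> ?thesis"
  then have l: "2 * n < length s" "2 * n < length t" by auto
  obtain i where i: "\<And>\<sigma>. \<exists>c\<in>\<Union>(set s). \<exists>c'\<in>\<Union>(set s). \<not> compat c c' \<and> side c = \<sigma> \<and> side c' = \<sigma> \<and> col c = i"
    by (rule long_word[OF assms(1,3) l(1)]) blast
  obtain j where j: "\<And>\<sigma>. \<exists>c\<in>\<Union>(set t). \<exists>c'\<in>\<Union>(set t). \<not> compat c c' \<and> side c = \<sigma> \<and> side c' = \<sigma> \<and> col c = j"
    by (rule long_word[OF assms(2,4) l(2)]) blast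
  have U: "\<Union>(set s) \<subseteq> U" "\<Union>(set t) \<subseteq> U" using vpath_letter[OF assms(1)] vpath_letter[OF assms(2)] by blast+
  have co: "compat c g" if "c \<in> \<Union>(set s)" "g \<in> \<Union>(set t)" for c g
    using assms(5) that unfolding indep_def by blast
  have "\<exists>c\<in>U. \<exists>c'\<in>U. \<exists>g\<in>U. \<exists>g'\<in>U. side c = \<sigma> \<and> side c' = \<sigma> \<and> side g = \<sigma> \<and> side g' = \<sigma> \<and>
        col c = i \<and> col g = j \<and> \<not> compat c c' \<and> \<not> compat g g' \<and>
        compat c g \<and> compat c g' \<and> compat c' g \<and> compat c' g'" for \<sigma>
  proof -
    obtain c c' where "c\<in>\<Union>(set s)" "c'\<in>\<Union>(set s)" "\<not> compat c c'" "side c = \<sigma>" "side c' = \<sigma>" "col c = i"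
      using i[of \<sigma>] by blast
    moreover obtain g g' where "g\<in>\<Union>(set t)" "g'\<in>\<Union>(set t)" "\<not> compat g g'" "side g = \<sigma>" "side g' = \<sigma>" "col g = j"
      using j[of \<sigma>] by blast
    ultimately show ?thesis using co U by blast
  qed
  then show False using no_common_flat[of i j] by blast
qed

lemma vpath_between:
  assumes "vpath x u" "vpath x v"
  shows "vpath (endp x u) (rev u @ v)" "endp (endp x u) (rev u @ v) = endp x v"
  using vpath_rev[OF assms(1)] assms(2) by (auto simp: vpath_append)

text \<open>Two geodesics from \<open>x\<close> to \<open>y\<close> through \<open>u\<close> and \<open>v\<close> span a grid whose sides are two commuting words.\<close>

lemma thin_wd:
  assumes p: "vpath z x" "vpath z y" "vpath z u" "vpath z v"
    and e: "wd x u + wd u y = wd x y" "wd x v + wd v y = wd x y" "wd x u = wd x v"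
  shows "wd u v \<le> 4 * n"
proof -
  let ?u = "nf (rev x @ u)" and ?a = "nf (rev u @ y)" and ?v = "nf (rev x @ v)" and ?b = "nf (rev v @ y)"
  have xu: "geq (nf (rev x @ u) @ nf (rev u @ y)) (rev x @ y)" for u
  proof -
    have "geq (nf (rev x @ u) @ nf (rev u @ y)) ((rev x @ u) @ (rev u @ y))"
      by (intro geq_append geq_nf)
    also have "geq \<dots> (rev x @ y)" using geq_append[OF geq_refl[of "rev x"] geq_cancel_left(2)[of u y]] by simp
    finally show ?thesis .
  qed
  have red: "reduced (?u @ ?a)" "reduced (?v @ ?b)"
    using reduced_if_geodesic[of ?u ?a] reduced_if_geodesic[of ?v ?b] nf_reduced e ln_geq[OF xu[of u]] ln_geq[OF xu[of v]]
    by (simp_all add: wd_def ln_def)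
  have "geq (?u @ ?a) (?v @ ?b)" using geq_trans[OF xu geq_sym[OF xu]] .
  then have "teq (?u @ ?a) (?v @ ?b)" using geq_reduced red by blast
  then obtain r s t q where h: "teq ?u (r @ s)" "teq ?v (r @ t)" "\<forall>x\<in>set s. \<forall>y\<in>set t. indep x y"
    by (rule teq_levi)
  have len: "length s = length t"
    using teq_length[OF h(1)] teq_length[OF h(2)] e(3) by (simp add: wd_def ln_def)
  have vp: "vpath (endp z x) (r @ s)" "vpath (endp z x) (r @ t)"
    using vpath_teqD(1)[OF h(1)] vpath_teqD(1)[OF h(2)] vpath_nf vpath_between p by blast+
  have rd: "reduced (r @ s)" "reduced (r @ t)" using reduced_teq h nf_reduced by blast+
  \<comment> \<open>The two words are equally long because \<open>u\<close> and \<open>v\<close> are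
    equidistant from \<open>x\<close>, so it does not matter which of them is short.\<close>
  have "length s \<le> 2 * n"
    using thin_words[of "endp (endp z x) r" s "endp (endp z x) r" t] vp rd reduced_appendD2 h(3) len
    by (auto simp: vpath_append)
  have g: "geq (rev x @ u) (r @ s)" "geq (rev x @ v) (r @ t)"
    using geq_trans[OF geq_sym[OF geq_nf] teq_geq] h by blast+
  have "wd u v = wd (rev x @ u) (rev x @ v)" by (simp add: wd_translate)
  also have "\<dots> = wd s t" using wd_geq[OF g] wd_translate by simp
  also have "\<dots> \<le> length s + length t" unfolding wd_def using ln_le_length[of "rev s @ t"] by simp
  finally show ?thesis using len \<open>length s \<le> 2 * n\<close> by simp
qed

text \<open>Translation by \<open>x\<close> reduces this to \<open>median\<close>, whose base point
  is the identity. The result is again an edge path from \<open>z\<close>, because \<open>r\<close>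
  is a prefix of a rearrangement of the valid path \<open>?u\<close> that starts at the end of
  \<open>x\<close>.\<close>

lemma median_wd:
  assumes "vpath z x" "vpath z y" "vpath z w"
  obtains m where "vpath z m" "wd x m + wd m y = wd x y" "wd y m + wd m w = wd y w" "wd x m + wd m w = wd x w"
proof -
  let ?u = "nf (rev x @ y)" and ?v = "nf (rev x @ w)"
  obtain r u' v' where h: "teq ?u (r @ u')" "teq ?v (r @ v')"
    "wd [] r + wd r ?u = wd [] ?u" "wd [] r + wd r ?v = wd [] ?v" "wd ?u r + wd r ?v = wd ?u ?v"
    by (rule median[OF nf_reduced[of "rev x @ y"] nf_reduced[of "rev x @ w"]]) blast
  have gy: "geq (x @ ?u) y" "geq (x @ ?v) w"
    using geq_trans[OF geq_append[OF geq_refl geq_nf] geq_cancel_left(2)] by blast+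
  have "vpath (endp z x) (r @ u')" using vpath_teqD(1)[OF h(1)] vpath_nf vpath_between assms by blast
  then have "vpath z (x @ r)" using assms(1) by (simp add: vpath_append)
  moreover have t: "wd (x @ a) (x @ b) = wd a b" for a b by (rule wd_translate)
  have "wd x (x @ r) = wd [] r" "wd (x @ r) y = wd r ?u" "wd (x @ r) w = wd r ?v" "wd y (x @ r) = wd ?u r"
    "wd x y = wd [] ?u" "wd x w = wd [] ?v" "wd y w = wd ?u ?v"
    using t[of "[]" r] t[of r ?u] t[of r ?v] t[of ?u r] t[of "[]" ?u] t[of "[]" ?v] t[of ?u ?v]
      wd_geq[OF geq_refl[of "x @ r"] gy(1)] wd_geq[OF geq_refl[of "x @ r"] gy(2)]
      wd_geq[OF gy(1) geq_refl[of "x @ r"]] wd_geq[OF geq_refl[of x] gy(1)] wd_geq[OF geq_refl[of x] gy(2)]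
      wd_geq[OF gy]
    by simp_all
  ultimately show ?thesis using that[of "x @ r"] h by simp
qed

lemma geodesic_wd:
  assumes "vpath z x" "vpath z y" "k \<le> wd x y"
  obtains u where "vpath z u" "wd x u + wd u y = wd x y" "wd x u = k"
proof -
  let ?w = "nf (rev x @ y)"
  let ?p = "take k ?w" and ?q = "drop k ?w"
  have red: "reduced ?p" "reduced ?q"
    using nf_reduced[of "rev x @ y"] reduced_appendD1[of ?p ?q] reduced_appendD2[of ?p ?q] by auto
  have len: "length ?w = wd x y" by (simp add: wd_def ln_def)
  have g: "geq (x @ ?w) y"
    using geq_trans[OF geq_append[OF geq_refl geq_nf] geq_cancel_left(2)] by blast
  have "vpath (endp z x) (?p @ ?q)" using vpath_nf vpath_between assms by auto
  then have "vpath z (x @ ?p)" using assms(1) by (simp only: vpath_append)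
  moreover have "wd x (x @ ?p) = length ?p"
    using wd_translate[of x "[]" ?p] ln_reduced[OF red(1)] by (simp add: wd_def)
  moreover have "wd (x @ ?p) y = length ?q"
  proof -
    have "wd (x @ ?p) y = wd (x @ ?p) (x @ ?p @ ?q)" using wd_geq[OF geq_refl g] by simp
    also have "\<dots> = wd [] ?q" using wd_translate[of "x @ ?p" "[]" ?q] by simp
    finally show ?thesis using ln_reduced[OF red(2)] by (simp add: wd_def)
  qed
  ultimately show ?thesis using that[of "x @ ?p"] len assms(3) by simp
qed

end

section \<open>Paths and homotopies in the geometric realisation\<close>

definition seg :: "('u \<Rightarrow> real) \<Rightarrow> ('u \<Rightarrow> real) \<Rightarrow> real \<Rightarrow> 'u \<Rightarrow> real" where
  "seg x y t = (\<lambda>v. (1 - t) * x v + t * y v)"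

lemma continuous_on_coord:
  fixes f :: "'a::topological_space \<Rightarrow> 'u \<Rightarrow> real"
  shows "continuous_on A f \<longleftrightarrow> (\<forall>v. continuous_on A (\<lambda>t. f t v))"
  by (intro iffI allI continuous_on_coordinatewise_then_product)
    (auto dest: continuous_on_product_then_coordinatewise)

lemma path_coord: "path p \<longleftrightarrow> (\<forall>v. continuous_on {0..1} (\<lambda>t. p t v :: real))"
  unfolding path_def by (rule continuous_on_coord)

lemma seg_ends [simp]: "seg x y 0 = x" "seg x y 1 = y" "pathstart (seg x y) = x" "pathfinish (seg x y) = y"
  by (auto simp: seg_def pathstart_def pathfinish_def)

lemma path_seg: "path (seg x y)"
  unfolding path_coord seg_def by (intro allI continuous_intros)

definition cst :: "'p \<Rightarrow> real \<Rightarrow> 'p" where "cst x = (\<lambda>_. x)"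

lemma cst_app: "cst x t = x" by (simp add: cst_def)

lemma cst_simps [simp]: "pathstart (cst x) = x" "pathfinish (cst x) = x" "path (cst x)"
    "path_image (cst x) = {x}"
  by (auto simp: cst_def pathstart_def pathfinish_def path_def path_image_def)

text \<open>The two reparametrisations are linearly homotopic inside the unit interval, and
  \<open>p\<close> transports this to any space. Unit, inverse and subdivision laws are instances,
  because the concatenations in them are themselves of the form \<open>p \<circ> f\<close>.\<close>

lemma homotopic_reparam:
  fixes p :: "real \<Rightarrow> 'p::topological_space"
  assumes p: "path p" "path_image p \<subseteq> S"
    and f: "continuous_on {0..1} f" "f ` {0..1} \<subseteq> {0..1}" and g: "continuous_on {0..1} g" "g ` {0..1} \<subseteq> {0..1}"
    and ends: "f 0 = g (0::real)" "f 1 = g (1::real)"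
  shows "homotopic_paths S (p \<circ> f) (p \<circ> g)"
proof -
  have "homotopic_paths {0..1::real} f g"
  proof (rule homotopic_paths_linear)
    show "path f" "path g" "pathstart g = pathstart f" "pathfinish g = pathfinish f"
      using f g ends by (auto simp: path_def pathstart_def pathfinish_def)
    show "closed_segment (f t) (g t) \<subseteq> {0..1}" if "t \<in> {0..1}" for t
    proof (rule closed_segment_subset)
      show "f t \<in> {0..1}" "g t \<in> {0..1}" using f(2) g(2) that by blast+
    qed simp
  qed
  then show ?thesis
    using p by (intro homotopic_paths_continuous_image) (auto simp: path_def path_image_def)
qed

section \<open>Paths with named ends, up to homotopy\<close>

definition pth :: "'p::topological_space set \<Rightarrow> (real \<Rightarrow> 'p) \<Rightarrow> 'p \<Rightarrow> 'p \<Rightarrow> bool" where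
  "pth S p x y \<longleftrightarrow> path p \<and> path_image p \<subseteq> S \<and> pathstart p = x \<and> pathfinish p = y"

lemma pth_join: "pth S p x y \<Longrightarrow> pth S q y z \<Longrightarrow> pth S (p +++ q) x z"
  unfolding pth_def using path_image_join_subset[of p q] by auto

lemma pth_cst: "x \<in> S \<Longrightarrow> pth S (cst x) x x" by (simp add: pth_def)

lemma pth_in: "pth S p x y \<Longrightarrow> t \<in> {0..1} \<Longrightarrow> p t \<in> S" "pth S p x y \<Longrightarrow> x \<in> S" "pth S p x y \<Longrightarrow> y \<in> S"
  unfolding pth_def path_image_def pathstart_def pathfinish_def by fastforce+

lemma pth_ends: "pth S p x y \<Longrightarrow> p 0 = x" "pth S p x y \<Longrightarrow> p 1 = y"
  by (auto simp: pth_def pathstart_def pathfinish_def)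

lemma pth_reverse: "pth S p x y \<Longrightarrow> pth S (reversepath p) y x"
  by (simp add: pth_def)

lemma hp_refl: "pth S p x y \<Longrightarrow> homotopic_paths S p p" by (simp add: pth_def)

lemma hp_join: "homotopic_paths S p p' \<Longrightarrow> homotopic_paths S q q' \<Longrightarrow> pth S p x y \<Longrightarrow> pth S q y z \<Longrightarrow>
    homotopic_paths S (p +++ q) (p' +++ q')"
  by (rule homotopic_paths_join) (auto simp: pth_def)

lemma hp_assoc: "pth S p x y \<Longrightarrow> pth S q y z \<Longrightarrow> pth S r z w \<Longrightarrow>
    homotopic_paths S ((p +++ q) +++ r) (p +++ (q +++ r))"
  unfolding pth_def by (rule homotopic_paths_sym, rule homotopic_paths_assoc) auto

lemma path_join_real: "continuous_on {0..1} f \<Longrightarrow> continuous_on {0..1} g \<Longrightarrow> f 1 = g (0::real) \<Longrightarrow>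
    continuous_on {0..1} (f +++ g :: real \<Rightarrow> real)"
  using path_join_imp[of f g] by (simp add: path_def pathstart_def pathfinish_def)

lemma join_comp: "(p \<circ> f) +++ (p \<circ> g) = p \<circ> (f +++ g)"
  by (auto simp: joinpaths_def fun_eq_iff)

lemma join_unit: "f ` {0..1} \<subseteq> {0..1} \<Longrightarrow> g ` {0..1} \<subseteq> {0..1} \<Longrightarrow> (f +++ g) ` {0..1} \<subseteq> {0..1::real}"
  using path_image_join_subset[of f g] unfolding path_image_def by blast

lemma hp_lid:
  assumes "pth S p x y"
  shows "homotopic_paths S (cst x +++ p) p"
proof -
  have "homotopic_paths S (p \<circ> ((\<lambda>_. 0) +++ id)) (p \<circ> id)"
    using assms unfolding pth_def
    by (intro homotopic_reparam path_join_real join_unit) (auto simp: joinpaths_def)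
  moreover have "cst x = p \<circ> (\<lambda>_. 0)" using assms by (auto simp: pth_def pathstart_def cst_def)
  ultimately show ?thesis using join_comp[of p "\<lambda>_. 0" id] by simp
qed

lemma hp_rid:
  assumes "pth S p x y"
  shows "homotopic_paths S (p +++ cst y) p"
proof -
  have "homotopic_paths S (p \<circ> (id +++ (\<lambda>_. 1))) (p \<circ> id)"
    using assms unfolding pth_def
    by (intro homotopic_reparam path_join_real join_unit) (auto simp: joinpaths_def)
  moreover have "cst y = p \<circ> (\<lambda>_. 1)" using assms by (auto simp: pth_def pathfinish_def cst_def)
  ultimately show ?thesis using join_comp[of p id "\<lambda>_. 1"] by simp
qed

lemma hp_rinv:
  assumes "pth S p x y"
  shows "homotopic_paths S (p +++ reversepath p) (cst x)"
proof -
  have "homotopic_paths S (p \<circ> (id +++ (\<lambda>t. 1 - t))) (p \<circ> (\<lambda>_. 0))"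
    using assms unfolding pth_def
    by (intro homotopic_reparam path_join_real join_unit continuous_intros) (auto simp: joinpaths_def)
  moreover have "cst x = p \<circ> (\<lambda>_. 0)" "reversepath p = p \<circ> (\<lambda>t. 1 - t)"
    using assms by (auto simp: pth_def pathstart_def cst_def reversepath_def)
  ultimately show ?thesis using join_comp[of p id "\<lambda>t. 1 - t"] by simp
qed

definition piece :: "(real \<Rightarrow> 'p) \<Rightarrow> real \<Rightarrow> real \<Rightarrow> real \<Rightarrow> 'p" where
  "piece p s t = p \<circ> (\<lambda>x. (1 - x) * s + x * t)"

lemma piece_arg:
  assumes "0 \<le> s" "s \<le> t" "t \<le> 1" "x \<in> {0..1::real}"
  shows "(1 - x) * s + x * t \<in> {s..t}" "(1 - x) * s + x * t \<in> {0..1}"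
proof -
  have "(1 - x) * s \<le> (1 - x) * t" "x * s \<le> x * t" using assms by (auto intro!: mult_left_mono)
  then show "(1 - x) * s + x * t \<in> {s..t}" by (simp add: algebra_simps)
  then show "(1 - x) * s + x * t \<in> {0..1}" using assms by auto
qed

lemma piece_pth:
  assumes "pth S p x y" "0 \<le> s" "s \<le> t" "t \<le> 1"
  shows "pth S (piece p s t) (p s) (p t)"
proof -
  have "continuous_on {0..1} (p \<circ> (\<lambda>x. (1 - x) * s + x * t))"
  proof (rule continuous_on_compose)
    have "continuous_on {0..1} p" using assms(1) by (simp add: pth_def path_def)
    then show "continuous_on ((\<lambda>x. (1 - x) * s + x * t) ` {0..1}) p"
      using piece_arg[OF assms(2-4)] by (auto elim!: continuous_on_subset)
  qed (intro continuous_intros)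
  then show ?thesis
    using assms(1) piece_arg[OF assms(2-4)]
    by (auto simp: pth_def path_def piece_def path_image_def pathstart_def pathfinish_def)
qed

lemma piece_join:
  assumes "pth S p x y" "0 \<le> s" "s \<le> t" "t \<le> u" "u \<le> 1"
  shows "homotopic_paths S (piece p s u) (piece p s t +++ piece p t u)"
proof -
  have *: "(\<lambda>x. (1 - x) * s + x * u) ` {0..1} \<subseteq> {0..1}" "(\<lambda>x. (1 - x) * s + x * t) ` {0..1} \<subseteq> {0..1}"
    "(\<lambda>x. (1 - x) * t + x * u) ` {0..1} \<subseteq> {0..1}"
    using piece_arg(2)[of s u] piece_arg(2)[of s t] piece_arg(2)[of t u] assms by auto
  show ?thesis unfolding piece_def join_comp
    using assms(1) unfolding pth_def
    by (intro homotopic_reparam path_join_real join_unit * continuous_intros) (auto simp: joinpaths_def)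
qed

lemma piece_full: "piece p 0 1 = p" by (simp add: piece_def fun_eq_iff)

context coupled
begin

text \<open>The realisation without mention of cubes: barycentric coordinates with sum 1 in every
  colour, whose support is a simplex of the join. \<open>X_space_eq\<close> identifies it with
  \<open>X_space\<close>.\<close>

definition S :: "('u \<Rightarrow> real) set" where
  "S = {x. (\<forall>v. 0 \<le> x v) \<and> (\<forall>v. v \<notin> U \<longrightarrow> x v = 0) \<and> (\<forall>i\<in>{1..n}. (\<Sum>v\<in>{v\<in>U. col v = i}. x v) = 1) \<and>
         (\<forall>u v. x u \<noteq> 0 \<longrightarrow> x v \<noteq> 0 \<longrightarrow> compat u v)}"

definition supp :: "('u \<Rightarrow> real) \<Rightarrow> 'u set" where "supp x = {v. x v \<noteq> 0}"

definition pt :: "'u set \<Rightarrow> 'u \<Rightarrow> real" where "pt c = (\<lambda>u. if u \<in> c then 1 else 0)"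

definition star :: "'u set \<Rightarrow> ('u \<Rightarrow> real) set" where "star c = {x\<in>S. \<forall>s\<in>c. 0 < x s}"

text \<open>For points of \<open>S\<close> this says that some closed cube contains both; the
  straight segment between them then stays in \<open>S\<close>.\<close>

definition coc :: "('u \<Rightarrow> real) \<Rightarrow> ('u \<Rightarrow> real) \<Rightarrow> bool" where
  "coc x y \<longleftrightarrow> (\<forall>u\<in>supp x \<union> supp y. \<forall>v\<in>supp x \<union> supp y. compat u v)"

lemma supp_cell:
  assumes "x \<in> S"
  shows "cell (supp x)"
proof -
  have "\<exists>u\<in>supp x. col u = i" if "i \<in> {1..n}" for i
  proof (rule ccontr)
    assume "\<not> ?thesis"
    then have "(\<Sum>v\<in>{v\<in>U. col v = i}. x v) = 0" unfolding supp_def by (intro sum.neutral) auto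
    then show False using assms that by (simp add: S_def)
  qed
  moreover have "supp x \<subseteq> U" "\<forall>u\<in>supp x. \<forall>v\<in>supp x. compat u v" using assms by (auto simp: S_def supp_def)
  ultimately show ?thesis by (simp add: cell_def)
qed

lemma coc_cell: "cell c \<Longrightarrow> supp x \<subseteq> c \<Longrightarrow> supp y \<subseteq> c \<Longrightarrow> coc x y"
  unfolding coc_def using cell_compat by blast

lemma supp_pt [simp]: "supp (pt c) = c" by (auto simp: supp_def pt_def)

lemma supp_seg: "supp (seg x y t) \<subseteq> supp x \<union> supp y" by (auto simp: supp_def seg_def)

lemma seg_S:
  assumes "x \<in> S" "y \<in> S" "coc x y" "t \<in> {0..1}"
  shows "seg x y t \<in> S"
proof -
  have "(\<Sum>v\<in>{v\<in>U. col v = i}. seg x y t v) = 1" if "i \<in> {1..n}" for i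
  proof -
    have "(\<Sum>v\<in>{v\<in>U. col v = i}. x v) = 1" "(\<Sum>v\<in>{v\<in>U. col v = i}. y v) = 1"
      using assms that by (simp_all add: S_def)
    then show ?thesis by (simp add: seg_def sum.distrib flip: sum_distrib_left)
  qed
  moreover have "compat u v" if "seg x y t u \<noteq> 0" "seg x y t v \<noteq> 0" for u v
  proof -
    have "u \<in> supp x \<union> supp y" "v \<in> supp x \<union> supp y" using that supp_seg[of x y t] by (auto simp: supp_def)
    then show ?thesis using assms(3) unfolding coc_def by blast
  qed
  moreover have "0 \<le> seg x y t v" for v using assms by (auto simp: S_def seg_def)
  moreover have "seg x y t v = 0" if "v \<notin> U" for v using assms that by (auto simp: S_def seg_def)
  ultimately show ?thesis by (simp add: S_def)
qed

lemma seg_pth: "x \<in> S \<Longrightarrow> y \<in> S \<Longrightarrow> coc x y \<Longrightarrow> pth S (seg x y) x y"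
  unfolding pth_def path_image_def using path_seg seg_S by auto

lemma hp_linear:
  assumes p: "pth S p x y" and q: "pth S q x y" and c: "\<And>t. t \<in> {0..1} \<Longrightarrow> coc (p t) (q t)"
  shows "homotopic_paths S p q"
  unfolding homotopic_paths
proof (intro exI conjI ballI)
  let ?h = "\<lambda>z. seg (p (snd z)) (q (snd z)) (fst z)"
  have co: "continuous_on ({0..1::real} \<times> {0..1}) (\<lambda>z. f (snd z) v)"
    if "path f" for f :: "real \<Rightarrow> 'u \<Rightarrow> real" and v
  proof -
    have "continuous_on {0..1} (\<lambda>t. f t v)" using that by (simp add: path_coord)
    then have "continuous_on (snd ` ({0..1::real} \<times> {0..1})) (\<lambda>t. f t v)" by (rule continuous_on_subset) auto
    then have "continuous_on ({0..1::real} \<times> {0..1}) ((\<lambda>t. f t v) \<circ> snd)"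
      by (intro continuous_on_compose continuous_intros)
    then show ?thesis unfolding o_def .
  qed
  have pq: "path p" "path q" using p q by (auto simp: pth_def)
  show "continuous_on ({0..1} \<times> {0..1}) ?h"
    unfolding continuous_on_coord seg_def by (intro allI continuous_intros co pq)
  show "?h \<in> {0..1} \<times> {0..1} \<rightarrow> S"
    using pth_in(1)[OF p] pth_in(1)[OF q] c seg_S by auto
  fix t :: real assume "t \<in> {0..1}"
  show "?h (0, t) = p t" "?h (1, t) = q t" by auto
  show "pathstart (?h \<circ> Pair t) = pathstart p" "pathfinish (?h \<circ> Pair t) = pathfinish p"
    using p q by (auto simp: pth_def pathstart_def pathfinish_def seg_def fun_eq_iff algebra_simps)
qed

lemma hp_in_cell:
  assumes "cell c" "pth S p x y" "pth S q x y" "\<And>t. t \<in> {0..1} \<Longrightarrow> supp (p t) \<subseteq> c" "\<And>t. t \<in> {0..1} \<Longrightarrow> supp (q t) \<subseteq> c"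
  shows "homotopic_paths S p q"
  using assms coc_cell by (intro hp_linear) auto

lemma join_range:
  assumes "\<And>t. t \<in> {0..1} \<Longrightarrow> P (p t)" "\<And>t. t \<in> {0..1} \<Longrightarrow> P (q t)" "t \<in> {0..1::real}"
  shows "P ((p +++ q) t)"
  using assms by (auto simp: joinpaths_def cst_app)

lemma join_range2:
  assumes "\<And>t. t \<in> {0..1} \<Longrightarrow> P (p t) (p' t)" "\<And>t. t \<in> {0..1} \<Longrightarrow> P (q t) (q' t)" "t \<in> {0..1::real}"
  shows "P ((p +++ q) t) ((p' +++ q') t)"
  using assms by (auto simp: joinpaths_def)

lemma pt_S:
  assumes "vertex v"
  shows "pt v \<in> S" "pt v \<in> star v"
proof -
  have v: "v \<subseteq> U" "\<forall>u\<in>v. \<forall>w\<in>v. compat u w" using assms by (auto simp: vertex_def cell_def)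
  have "(\<Sum>u\<in>{u\<in>U. col u = i}. pt v u) = 1" if i: "i \<in> {1..n}" for i
  proof -
    obtain a where a: "a \<in> v" "col a = i" using cell_colour[OF vertex_cell[OF assms] i] by blast
    then have "(\<Sum>u\<in>{u\<in>U. col u = i}. pt v u) = (\<Sum>u\<in>{a}. pt v u)"
      using v finU vertex_unique[OF assms] by (intro sum.mono_neutral_right) (auto simp: pt_def)
    then show ?thesis using a by (simp add: pt_def)
  qed
  then show "pt v \<in> S" using v by (auto simp: S_def pt_def)
  then show "pt v \<in> star v" by (simp add: star_def pt_def)
qed

lemma star_S: "x \<in> star v \<Longrightarrow> x \<in> S" by (simp add: star_def)

lemma star_supp: "x \<in> star v \<Longrightarrow> v \<subseteq> supp x" by (auto simp: star_def supp_def)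

lemma star_coc: "x \<in> star v \<Longrightarrow> coc x (pt v)" "x \<in> star v \<Longrightarrow> coc (pt v) x"
  using coc_cell[OF supp_cell] star_S star_supp supp_pt by blast+

lemma star_seg_pth: "vertex v \<Longrightarrow> x \<in> star v \<Longrightarrow> pth S (seg x (pt v)) x (pt v)"
  "vertex v \<Longrightarrow> x \<in> star v \<Longrightarrow> pth S (seg (pt v) x) (pt v) x"
  using seg_pth pt_S star_S star_coc by blast+

lemma hp_star:
  assumes v: "vertex v" and p: "pth S p x y" and st: "\<And>t. t \<in> {0..1} \<Longrightarrow> p t \<in> star v"
  shows "homotopic_paths S p (seg x (pt v) +++ seg (pt v) y)"
proof -
  have xy: "x \<in> star v" "y \<in> star v" using st[of 0] st[of 1] pth_ends[OF p] by auto
  note sg = star_seg_pth(1)[OF v xy(1)] star_seg_pth(2)[OF v xy(2)]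
  have c: "pth S (cst (pt v)) (pt v) (pt v)" "pth S (cst x) x x" "pth S (cst y) y y"
    using pt_S[OF v] xy star_S by (auto intro: pth_cst)
  \<comment> \<open>The constant pieces align the two paths in three stretches, in each of which
    corresponding points share a cube: \<open>x\<close> with its segment to the centre,
    \<open>p\<close> with the centre, and \<open>y\<close> with the segment back.\<close>
  have "homotopic_paths S (cst x +++ (p +++ cst y)) (seg x (pt v) +++ (cst (pt v) +++ seg (pt v) y))"
  proof (rule hp_linear)
    show "pth S (cst x +++ (p +++ cst y)) x y" "pth S (seg x (pt v) +++ (cst (pt v) +++ seg (pt v) y)) x y"
      using c p sg by (blast intro: pth_join)+
    have "coc (cst x t) (seg x (pt v) t)" if "t \<in> {0..1}" for t
      using coc_cell[OF supp_cell[OF star_S[OF xy(1)]], of x "seg x (pt v) t"] supp_seg[of x "pt v" t]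
        star_supp[OF xy(1)] by (auto simp: cst_app)
    moreover have "coc (cst y t) (seg (pt v) y t)" if "t \<in> {0..1}" for t
      using coc_cell[OF supp_cell[OF star_S[OF xy(2)]], of y "seg (pt v) y t"] supp_seg[of "pt v" y t]
        star_supp[OF xy(2)] by (auto simp: cst_app)
    moreover have "coc (p t) (cst (pt v) t)" if "t \<in> {0..1}" for t
      using star_coc(1) st that by (simp add: cst_app)
    ultimately show "coc ((cst x +++ (p +++ cst y)) t) ((seg x (pt v) +++ (cst (pt v) +++ seg (pt v) y)) t)"
      if "t \<in> {0..1}" for t using that by (intro join_range2[where P = coc]) auto
  qed
  moreover have "homotopic_paths S (cst x +++ (p +++ cst y)) p"
    by (rule homotopic_paths_trans[OF hp_lid[OF pth_join[OF p c(3)]] hp_rid[OF p]])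
  moreover have "homotopic_paths S (seg x (pt v) +++ (cst (pt v) +++ seg (pt v) y)) (seg x (pt v) +++ seg (pt v) y)"
    using hp_join[OF hp_refl[OF sg(1)] hp_lid[OF sg(2)] sg(1) pth_join[OF c(1) sg(2)]] .
  ultimately show ?thesis using homotopic_paths_sym homotopic_paths_trans by blast
qed

lemma star_common: "x \<in> star u \<Longrightarrow> x \<in> star v \<Longrightarrow> vertex u \<Longrightarrow> cell (u \<union> v)"
  using cell_between[OF vertex_cell supp_cell[OF star_S]] star_supp by (metis Un_least Un_upper1)

lemma star_common3: "x \<in> star u \<Longrightarrow> x \<in> star v \<Longrightarrow> x \<in> star w \<Longrightarrow> vertex u \<Longrightarrow> cell (u \<union> v \<union> w)"
  using cell_between[OF vertex_cell supp_cell[OF star_S]] star_supp by (metis Un_least Un_upper1 le_supI1)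

section \<open>Realisation of edge paths\<close>

primrec rp :: "'u set \<Rightarrow> 'u set list \<Rightarrow> real \<Rightarrow> 'u \<Rightarrow> real" where
  "rp a [] = cst (pt a)"
| "rp a (e # w) = seg (pt a) (pt (mv a e)) +++ rp (mv a e) w"

lemma edge_seg: "vertex a \<Longrightarrow> edge_at a e \<Longrightarrow> pth S (seg (pt a) (pt (mv a e))) (pt a) (pt (mv a e))"
  using edge_step[of a e] coc_cell[of "a \<union> mv a e"] by (intro seg_pth pt_S) auto

lemma rp_pth: "vpath a w \<Longrightarrow> pth S (rp a w) (pt a) (pt (endp a w))"
proof (induction w arbitrary: a)
  case Nil then show ?case by (simp add: pth_cst pt_S)
next
  case (Cons e w) then show ?case using edge_seg[of a e] pth_join by fastforce
qed

lemma rp_append: "vpath a (u @ v) \<Longrightarrow> homotopic_paths S (rp a (u @ v)) (rp a u +++ rp (endp a u) v)"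
proof (induction u arbitrary: a)
  case Nil
  then show ?case using homotopic_paths_sym[OF hp_lid[OF rp_pth[of a v]]] by simp
next
  case (Cons e u)
  then have v: "vpath (mv a e) (u @ v)" "vertex a" "edge_at a e" by auto
  then have v': "vpath (mv a e) u" "vpath (endp (mv a e) u) v" by (auto simp: vpath_append)
  note s = edge_seg[OF v(2,3)]
  have "homotopic_paths S (rp a ((e # u) @ v)) (seg (pt a) (pt (mv a e)) +++ (rp (mv a e) u +++ rp (endp (mv a e) u) v))"
    using hp_join[OF hp_refl[OF s] Cons.IH[OF v(1)] s rp_pth[OF v(1)]] by simp
  from homotopic_paths_trans[OF this homotopic_paths_sym[OF hp_assoc[OF s rp_pth[OF v'(1)] rp_pth[OF v'(2)]]]]
  show ?case by simp
qed

lemma rp_in_cell: "vpath a w \<Longrightarrow> a \<subseteq> c \<Longrightarrow> \<forall>e\<in>set w. e \<subseteq> c \<Longrightarrow> t \<in> {0..1} \<Longrightarrow> supp (rp a w t) \<subseteq> c"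
proof (induction w arbitrary: a t)
  case (Cons e w)
  have m: "mv a e \<subseteq> c" using Cons.prems by (auto simp: mv_def)
  have "supp (seg (pt a) (pt (mv a e)) t) \<subseteq> c" for t
    using supp_seg[of "pt a" "pt (mv a e)" t] Cons.prems(2) m by auto
  then show ?case using join_range[where P = "\<lambda>x. supp x \<subseteq> c"] Cons m by auto
qed (simp add: cst_app)

lemma rp_cong_Cons: "vpath a (e # u) \<Longrightarrow> homotopic_paths S (rp (mv a e) u) (rp (mv a e) v) \<Longrightarrow>
    homotopic_paths S (rp a (e # u)) (rp a (e # v))"
  using hp_join[OF hp_refl[OF edge_seg] _ edge_seg rp_pth] by simp

text \<open>A cell is convex, so two initial segments inside one cell with the same end are
  homotopic. A square and a backtracking are the instances needed.\<close>

lemma rp_short: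
  assumes "vpath a (u @ w)" "vpath a (v @ w)" "cell c" "a \<subseteq> c" "\<forall>e\<in>set u. e \<subseteq> c" "\<forall>e\<in>set v. e \<subseteq> c" "endp a u = endp a v"
  shows "homotopic_paths S (rp a (u @ w)) (rp a (v @ w))"
proof -
  have v: "vpath a u" "vpath a v" "vpath (endp a u) w" using assms(1,2) by (auto simp: vpath_append)
  have "homotopic_paths S (rp a u) (rp a v)"
  proof (rule hp_in_cell[OF assms(3) rp_pth[OF v(1)]])
    show "pth S (rp a v) (pt a) (pt (endp a u))" using rp_pth[OF v(2)] assms(7) by simp
  qed (use rp_in_cell[OF v(1) assms(4,5)] rp_in_cell[OF v(2) assms(4,6)] in auto)
  then have "homotopic_paths S (rp a u +++ rp (endp a u) w) (rp a v +++ rp (endp a v) w)"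
    using hp_join[OF _ hp_refl[OF rp_pth[OF v(3)]] rp_pth[OF v(1)] rp_pth[OF v(3)]] assms(7) by simp
  from homotopic_paths_trans[OF homotopic_paths_trans[OF rp_append[OF assms(1)] this]
      homotopic_paths_sym[OF rp_append[OF assms(2)]]]
  show ?thesis .
qed

lemma rp_swap:
  assumes "vpath x (a # b # v)" "indep a b"
  shows "homotopic_paths S (rp x (a # b # v)) (rp x (b # a # v))"
proof -
  have p: "vpath x (b # a # v)" using vpath_teqD(1)[OF teq_swap[OF assms(2)] assms(1)] .
  have "cell (x \<union> a \<union> b)" using edge_square[of x a b] assms by auto
  then show ?thesis using rp_short[of x "[a, b]" v "[b, a]" "x \<union> a \<union> b"] assms(1) p mv_commute[of x a b] by auto
qed

lemma rp_cancel:
  assumes "vpath x (e # e # v)"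
  shows "homotopic_paths S (rp x (e # e # v)) (rp x v)"
proof -
  have h: "vertex x" "edge_at x e" "vpath x v" using assms by auto
  have "e \<subseteq> x \<union> mv x e" by (auto simp: mv_def)
  then show ?thesis using rp_short[of x "[e, e]" v "[]" "x \<union> mv x e"] assms h edge_step[of x e] by auto
qed

lemma rp_refl: "vpath a w \<Longrightarrow> homotopic_paths S (rp a w) (rp a w)"
  by (rule hp_refl[OF rp_pth])

lemma rp_nf: "vpath a w \<Longrightarrow> homotopic_paths S (rp a w) (rp a (nf w))"
proof -
  assume v: "vpath a w"
  have "vpath a (nf w) \<and> endp a (nf w) = endp a w \<and> homotopic_paths S (rp a w) (rp a (nf w))"
    by (rule vpath_nf_induct[where R = "\<lambda>a u v. homotopic_paths S (rp a u) (rp a v)", OF v])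
      (rule rp_refl rp_swap rp_cancel rp_cong_Cons homotopic_paths_trans, assumption+)+
  then show ?thesis by blast
qed

lemma rp_teq: "teq w w' \<Longrightarrow> vpath a w \<Longrightarrow> homotopic_paths S (rp a w) (rp a w')"
  by (rule vpath_teq_induct[where R = "\<lambda>a u v. homotopic_paths S (rp a u) (rp a v)"], assumption, assumption)
    (rule rp_refl rp_swap rp_cong_Cons homotopic_paths_trans, assumption+)+

text \<open>Equality in the Coxeter group implies homotopy. The converse comes from reading off
  words, by \<open>Rep_rp\<close>, \<open>Rep_homotopic\<close> and
  \<open>Rep_unique\<close>.\<close>

lemma rp_geq:
  assumes "vpath a w" "vpath a w'" "geq w w'"
  shows "homotopic_paths S (rp a w) (rp a w')"
proof -
  have "homotopic_paths S (rp a (nf w)) (rp a (nf w'))"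
    using rp_teq vpath_nf(1)[OF assms(1)] assms(3) unfolding geq_def by blast
  from homotopic_paths_trans[OF homotopic_paths_trans[OF rp_nf[OF assms(1)] this]
      homotopic_paths_sym[OF rp_nf[OF assms(2)]]]
  show ?thesis .
qed

end

section \<open>The word of a path\<close>

context coupled
begin

section \<open>A nearby vertex for each point, and transition words\<close>

definition near_vertex :: "('u \<Rightarrow> real) \<Rightarrow> 'u set \<Rightarrow> bool" where
  "near_vertex x v \<longleftrightarrow> vertex v \<and> (\<forall>s\<in>v. 1 / 2 \<le> x s)"

lemma sum_single_less:
  fixes f :: "'b \<Rightarrow> real"
  assumes "finite G" "\<And>p q. p \<in> G \<Longrightarrow> q \<in> G \<Longrightarrow> f p \<noteq> 0 \<Longrightarrow> f q \<noteq> 0 \<Longrightarrow> p = q" "\<And>p. p \<in> G \<Longrightarrow> f p < e" "0 < e"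
  shows "sum f G < e"
proof (cases "\<exists>p\<in>G. f p \<noteq> 0")
  case True
  then obtain p where p: "p \<in> G" "f p \<noteq> 0" by blast
  then have "sum f G = sum f {p}" using assms(1,2) by (intro sum.mono_neutral_right) auto
  then show ?thesis using assms(3) p by simp
next
  case False
  then show ?thesis using assms(4) by (simp add: sum.neutral)
qed

text \<open>In each colour a point has at most two non-zero coordinates, one per side, with sum 1;
  one of them is therefore at least \<open>1 / 2\<close>.\<close>

lemma near_vertex_ex:
  assumes "x \<in> S"
  shows "\<exists>v. near_vertex x v"
proof -
  have "\<exists>s\<in>U. col s = i \<and> 1 / 2 \<le> x s" if i: "i \<in> {1..n}" for i
  proof (rule ccontr)
    assume "\<not> ?thesis"
    then have lt: "x s < 1 / 2" if "s \<in> U" "col s = i" for s using that by force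
    define F where "F b = {s\<in>U. col s = i \<and> side s = b}" for b
    have "sum x (F b) < 1 / 2" for b
    proof (rule sum_single_less)
      show "finite (F b)" using finU by (simp add: F_def)
      fix p q assume h: "p \<in> F b" "q \<in> F b" "x p \<noteq> 0" "x q \<noteq> 0"
      then have "compat p q" using assms by (simp add: S_def)
      then show "p = q" using compat_same[of p q] h by (auto simp: F_def)
    qed (use lt F_def in auto)
    then have "sum x (F True) + sum x (F False) < 1" by (smt (verit) field_sum_of_halves)
    moreover have "{s\<in>U. col s = i} = F True \<union> F False" "F True \<inter> F False = {}" by (auto simp: F_def)
    moreover have "(\<Sum>s\<in>{s\<in>U. col s = i}. x s) = 1" using assms i by (simp add: S_def)
    moreover have "finite (F True)" "finite (F False)" using finU by (simp_all add: F_def)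
    ultimately show False by (simp add: sum.union_disjoint)
  qed
  then obtain g where g: "\<And>i. i \<in> {1..n} \<Longrightarrow> g i \<in> U \<and> col (g i) = i \<and> 1 / 2 \<le> x (g i)" by metis
  have pos: "1 / 2 \<le> x s" if "s \<in> g ` {1..n}" for s using g that by blast
  then have "g ` {1..n} \<subseteq> supp x" unfolding supp_def by fastforce
  then have "cell (g ` {1..n})" by (rule cell_mono[OF supp_cell[OF assms]]) (use g in blast)
  moreover have "inj_on col (g ` {1..n})" using g by (auto simp: inj_on_def)
  ultimately show ?thesis using pos unfolding near_vertex_def vertex_def by blast
qed

definition nv :: "('u \<Rightarrow> real) \<Rightarrow> 'u set" where "nv x = (SOME v. near_vertex x v)"

lemma nv: "x \<in> S \<Longrightarrow> near_vertex x (nv x)"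
  unfolding nv_def by (rule someI_ex[OF near_vertex_ex])

lemma nv_vertex: "x \<in> S \<Longrightarrow> vertex (nv x)" using nv near_vertex_def by blast

text \<open>The threshold \<open>1 / 2\<close> plays the part of a Lebesgue number for the cover by
  stars.\<close>

lemma nv_near:
  assumes "x \<in> S" "y \<in> S" "\<And>s. s \<in> U \<Longrightarrow> \<bar>x s - y s\<bar> < 1 / 2"
  shows "y \<in> star (nv x)"
proof -
  have "0 < y s" if "s \<in> nv x" for s
  proof -
    have "s \<in> U" using nv_vertex[OF assms(1)] that by (auto simp: vertex_def cell_def)
    moreover have "1 / 2 \<le> x s" using nv[OF assms(1)] that by (auto simp: near_vertex_def)
    ultimately show ?thesis using assms(3)[of s] by linarith
  qed
  then show ?thesis using assms(2) by (simp add: star_def)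
qed

lemma nv_star: "x \<in> S \<Longrightarrow> x \<in> star (nv x)" using nv_near[of x x] by simp

lemma star_pt: "vertex u \<Longrightarrow> vertex v \<Longrightarrow> pt u \<in> star v \<Longrightarrow> v = u"
  using star_supp[of "pt u" v] vertex_subset_eq[of u v] by simp

text \<open>A transition word for vertices of a common cell, arbitrary in other cases. Up to
  \<open>geq\<close> the choice does not matter, by \<open>paths_in_cell\<close>.\<close>

definition tau :: "'u set \<Rightarrow> 'u set \<Rightarrow> 'u set list" where
  "tau u v = (SOME w. vpath u w \<and> endp u w = v \<and> (\<forall>e\<in>set w. e \<subseteq> u \<union> v) \<and> length w \<le> n)"

lemma tau:
  assumes "vertex u" "vertex v" "cell (u \<union> v)"
  shows "vpath u (tau u v)" "endp u (tau u v) = v" "e \<in> set (tau u v) \<Longrightarrow> e \<subseteq> u \<union> v" "length (tau u v) \<le> n"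
  using someI_ex[OF path_in_cell_exists[OF assms]] unfolding tau_def[symmetric] by blast+

lemma tau_comp:
  assumes "vertex u" "vertex v" "vertex w" "cell (u \<union> v \<union> w)"
  shows "geq (tau u v @ tau v w) (tau u w)"
proof (rule paths_in_cell[OF _ _ assms(4)])
  have c: "cell (u \<union> v)" "cell (v \<union> w)" "cell (u \<union> w)"
    using cell_between[OF vertex_cell assms(4)] assms(1-3) by blast+
  note t = tau[OF assms(1,2) c(1)] tau[OF assms(2,3) c(2)] tau[OF assms(1,3) c(3)]
  show "vpath u (tau u v @ tau v w)" "vpath u (tau u w)" "endp u (tau u v @ tau v w) = endp u (tau u w)"
    using t by (simp_all add: vpath_append)
  show "\<forall>e\<in>set (tau u v @ tau v w). e \<subseteq> u \<union> v \<union> w" "\<forall>e\<in>set (tau u w). e \<subseteq> u \<union> v \<union> w"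
    using t(3,7,11) by fastforce+
qed

lemma tau_self: "vertex u \<Longrightarrow> geq (tau u u) []"
  using loop_in_cell[of u "tau u u" u] tau[of u u] vertex_cell by auto

primrec prodw :: "(nat \<Rightarrow> 'u set) \<Rightarrow> nat \<Rightarrow> 'u set list" where
  "prodw v 0 = []"
| "prodw v (Suc k) = prodw v k @ tau (v k) (v (Suc k))"

lemma prodw_vpath:
  assumes "\<And>i. i \<le> k \<Longrightarrow> vertex (v i)" "\<And>i. i < k \<Longrightarrow> cell (v i \<union> v (Suc i))"
  shows "vpath (v 0) (prodw v k) \<and> endp (v 0) (prodw v k) = v k"
  using assms by (induction k) (auto simp: vpath_append tau)

text \<open>Each square of the ladder lies in one cell, where \<open>tau_comp\<close> permits either
  way around.\<close>

lemma ladder: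
  assumes "\<And>i. i \<le> k \<Longrightarrow> vertex (v i) \<and> vertex (v' i)"
    "\<And>i. i < k \<Longrightarrow> \<exists>c. cell c \<and> v i \<subseteq> c \<and> v (Suc i) \<subseteq> c \<and> v' i \<subseteq> c \<and> v' (Suc i) \<subseteq> c"
  shows "geq (prodw v k @ tau (v k) (v' k)) (tau (v 0) (v' 0) @ prodw v' k)"
  using assms
proof (induction k)
  case (Suc k)
  obtain c where c: "cell c" "v k \<subseteq> c" "v (Suc k) \<subseteq> c" "v' k \<subseteq> c" "v' (Suc k) \<subseteq> c"
    using Suc.prems(2)[of k] by auto
  have vx: "vertex (v k)" "vertex (v (Suc k))" "vertex (v' k)" "vertex (v' (Suc k))" using Suc.prems(1) by simp_all
  have cc: "cell (a \<union> b \<union> d)" if "vertex a" "a \<subseteq> c" "b \<subseteq> c" "d \<subseteq> c" for a b d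
    by (rule cell_between[OF vertex_cell[OF that(1)] c(1)]) (use that in auto)
  have "geq (tau (v k) (v (Suc k)) @ tau (v (Suc k)) (v' (Suc k))) (tau (v k) (v' (Suc k)))"
    by (rule tau_comp[OF vx(1,2,4) cc[OF vx(1) c(2,3,5)]])
  also have "geq \<dots> (tau (v k) (v' k) @ tau (v' k) (v' (Suc k)))"
    by (rule geq_sym[OF tau_comp[OF vx(1,3,4) cc[OF vx(1) c(2,4,5)]]])
  finally have "geq (prodw v (Suc k) @ tau (v (Suc k)) (v' (Suc k))) (prodw v k @ (tau (v k) (v' k) @ tau (v' k) (v' (Suc k))))"
    using geq_append[OF geq_refl] by simp
  also have "geq \<dots> ((tau (v 0) (v' 0) @ prodw v' k) @ tau (v' k) (v' (Suc k)))"
    using geq_append[OF Suc.IH geq_refl] Suc.prems by simp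
  finally show ?case by simp
qed simp

text \<open>The \<open>i\<close>-th of \<open>2\<^sup>m\<close> pieces is covered by the star of \<open>v (Suc i)\<close>; the indices \<open>0\<close> and
  \<open>Suc (2\<^sup>m)\<close> carry prescribed vertices for the end points. Dyadic subdivisions make refinement and
  concatenation of paths easy to index.\<close>

definition Sub :: "nat \<Rightarrow> (real \<Rightarrow> 'u \<Rightarrow> real) \<Rightarrow> (nat \<Rightarrow> 'u set) \<Rightarrow> bool" where
  "Sub m p v \<longleftrightarrow> (\<forall>i\<le>Suc (2 ^ m). vertex (v i)) \<and> p 0 \<in> star (v 0) \<and> p 1 \<in> star (v (Suc (2 ^ m))) \<and>
     (\<forall>i<2 ^ m. \<forall>t. real i / 2 ^ m \<le> t \<and> t \<le> real (Suc i) / 2 ^ m \<longrightarrow> p t \<in> star (v (Suc i)))"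

abbreviation pw :: "nat \<Rightarrow> (nat \<Rightarrow> 'u set) \<Rightarrow> 'u set list" where "pw m v \<equiv> prodw v (Suc (2 ^ m))"

lemma Sub_common:
  assumes "Sub m p v" "i \<le> 2 ^ m"
  shows "p (real i / 2 ^ m) \<in> star (v i)" "p (real i / 2 ^ m) \<in> star (v (Suc i))"
proof -
  show "p (real i / 2 ^ m) \<in> star (v i)"
  proof (cases i)
    case (Suc j)
    then show ?thesis using assms unfolding Sub_def by (auto simp: divide_right_mono)
  qed (use assms in \<open>simp add: Sub_def\<close>)
  show "p (real i / 2 ^ m) \<in> star (v (Suc i))"
  proof (cases "i = 2 ^ m")
    case False
    then show ?thesis using assms unfolding Sub_def by (auto simp: divide_right_mono)
  qed (use assms in \<open>simp add: Sub_def\<close>)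
qed

lemma Sub_valid:
  assumes "Sub m p v"
  shows "vpath (v 0) (pw m v) \<and> endp (v 0) (pw m v) = v (Suc (2 ^ m))"
proof (rule prodw_vpath)
  show "vertex (v i)" if "i \<le> Suc (2 ^ m)" for i using assms that by (simp add: Sub_def)
  then show "cell (v i \<union> v (Suc i))" if "i < Suc (2 ^ m)" for i
    using star_common[OF Sub_common(1)[OF assms, of i] Sub_common(2)[OF assms, of i]] that by simp
qed

lemma Sub_unique:
  assumes "Sub m p v" "Sub m p v'" "v 0 = v' 0" "v (Suc (2 ^ m)) = v' (Suc (2 ^ m))"
  shows "geq (pw m v) (pw m v')"
proof -
  let ?k = "Suc (2 ^ m)"
  have vx: "vertex (v i) \<and> vertex (v' i)" if "i \<le> ?k" for i using assms that by (simp add: Sub_def)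
  have "geq (prodw v ?k @ tau (v ?k) (v' ?k)) (tau (v 0) (v' 0) @ prodw v' ?k)"
  proof (rule ladder[OF vx])
    fix i :: nat assume "i < ?k"
    then have i: "i \<le> 2 ^ m" by simp
    \<comment> \<open>The \<open>i\<close>-th division point lies in all four stars, so its support
      is a cell that contains the \<open>i\<close>-th square of the ladder.\<close>
    let ?x = "p (real i / 2 ^ m)"
    have "cell (supp ?x)" using supp_cell star_S Sub_common(1)[OF assms(1) i] by blast
    then show "\<exists>c. cell c \<and> v i \<subseteq> c \<and> v (Suc i) \<subseteq> c \<and> v' i \<subseteq> c \<and> v' (Suc i) \<subseteq> c"
      using star_supp Sub_common[OF assms(1) i] Sub_common[OF assms(2) i] by blast
  qed
  moreover have "geq (prodw v ?k @ tau (v ?k) (v' ?k)) (prodw v ?k)" "geq (tau (v 0) (v' 0) @ prodw v' ?k) (prodw v' ?k)"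
    using geq_append[OF geq_refl tau_self, of "v' ?k" "prodw v ?k"] geq_append[OF tau_self geq_refl, of "v' 0" "prodw v' ?k"]
      vx[of 0] vx[of ?k] assms(3,4) by simp_all
  ultimately show ?thesis by (meson geq_sym geq_trans)
qed

lemma Sub_refine:
  assumes "Sub m p v"
  obtains v' where "Sub (Suc m) p v'" "v' 0 = v 0" "v' (Suc (2 ^ Suc m)) = v (Suc (2 ^ m))"
    "geq (pw (Suc m) v') (pw m v)"
proof -
  \<comment> \<open>Index 0 is reserved for the start, hence the shift by 1: both halves of an old
    piece inherit its vertex. The doubled vertices only add words \<open>tau (v i) (v i)\<close>,
    which are trivial.\<close>
  define v' where "v' j = (if j = 0 then v 0 else v (Suc ((j - 1) div 2)))" for j
  have odd: "v' (Suc (2 * i)) = v (Suc i)" for i by (simp add: v'_def)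
  have ev: "v' (Suc (Suc (2 * i))) = v (Suc i)" for i by (simp add: v'_def)
  have vx: "vertex (v i)" if "i \<le> Suc (2 ^ m)" for i using assms that by (simp add: Sub_def)
  have vx': "vertex (v' i)" if "i \<le> Suc (2 ^ Suc m)" for i
    using that by (auto simp: v'_def intro!: vx)
  have S': "Sub (Suc m) p v'"
    unfolding Sub_def
  proof (intro conjI allI impI)
    show "p 0 \<in> star (v' 0)" "p 1 \<in> star (v' (Suc (2 ^ Suc m)))" using assms odd[of "2 ^ m"] by (simp_all add: Sub_def v'_def)
    fix i :: nat and t :: real assume i: "i < 2 ^ Suc m" and t: "real i / 2 ^ Suc m \<le> t \<and> t \<le> real (Suc i) / 2 ^ Suc m"
    let ?j = "i div 2"
    have j: "?j < 2 ^ m" using i by auto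
    have half: "2 * x / 2 ^ Suc m = x / 2 ^ m" for x :: real by simp
    have "2 * ?j \<le> i" "Suc i \<le> 2 * Suc ?j" by auto
    then have "2 * real ?j \<le> real i" "real (Suc i) \<le> 2 * real (Suc ?j)" by linarith+
    then have "2 * real ?j / 2 ^ Suc m \<le> real i / 2 ^ Suc m" "real (Suc i) / 2 ^ Suc m \<le> 2 * real (Suc ?j) / 2 ^ Suc m"
      by (intro divide_right_mono; simp)+
    then have "real ?j / 2 ^ m \<le> real i / 2 ^ Suc m" "real (Suc i) / 2 ^ Suc m \<le> real (Suc ?j) / 2 ^ m"
      by (simp_all only: half)
    then show "p t \<in> star (v' (Suc i))" using assms t j unfolding Sub_def v'_def by fastforce
  qed (use vx' in auto)
  have "geq (prodw v' (Suc (2 * i))) (prodw v (Suc i))" if "i \<le> 2 ^ m" for i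
    using that
  proof (induction i)
    case 0 then show ?case by (simp add: v'_def)
  next
    case (Suc i)
    have "geq (prodw v' (Suc (2 * i)) @ tau (v (Suc i)) (v (Suc i))) (prodw v (Suc i) @ [])"
      using Suc tau_self vx by (intro geq_append) auto
    then have "geq ((prodw v' (Suc (2 * i)) @ tau (v (Suc i)) (v (Suc i))) @ tau (v (Suc i)) (v (Suc (Suc i))))
        (prodw v (Suc i) @ tau (v (Suc i)) (v (Suc (Suc i))))"
      by (intro geq_append) auto
    moreover have "prodw v' (Suc (2 * Suc i)) = (prodw v' (Suc (2 * i)) @ tau (v (Suc i)) (v (Suc i))) @ tau (v (Suc i)) (v (Suc (Suc i)))"
      using odd[of i] ev[of i] odd[of "Suc i"] by simp
    ultimately show ?case by simp
  qed
  from this[of "2 ^ m"] have "geq (pw (Suc m) v') (pw m v)" by simp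
  then show ?thesis using that[OF S'] odd[of "2 ^ m"] by (simp add: v'_def)
qed

text \<open>The word is relative to vertices \<open>a\<close>, \<open>b\<close> whose stars contain
  the ends of \<open>p\<close>. Leaving them free lets the words of consecutive paths be
  concatenated without correction. The word itself need not be a valid edge path, only equal to one
  in the group.\<close>

definition Rep :: "(real \<Rightarrow> 'u \<Rightarrow> real) \<Rightarrow> 'u set \<Rightarrow> 'u set list \<Rightarrow> 'u set \<Rightarrow> bool" where
  "Rep p a w b \<longleftrightarrow> (\<exists>m v. Sub m p v \<and> v 0 = a \<and> v (Suc (2 ^ m)) = b \<and> geq w (pw m v))"

lemma Rep_geq: "Rep p a w b \<Longrightarrow> geq w w' \<Longrightarrow> Rep p a w' b"
proof -
  assume r: "Rep p a w b" and g: "geq w w'"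
  obtain m v where v: "Sub m p v" "v 0 = a" "v (Suc (2 ^ m)) = b" "geq w (pw m v)"
    using r unfolding Rep_def by (elim exE conjE) (rule that)
  show ?thesis unfolding Rep_def
    by (intro exI[of _ m] exI[of _ v] conjI v(1-3) geq_trans[OF geq_sym[OF g] v(4)])
qed

lemma Rep_level:
  assumes "Rep p a w b"
  obtains m where "\<And>k. \<exists>v. Sub (m + k) p v \<and> v 0 = a \<and> v (Suc (2 ^ (m + k))) = b \<and> geq w (pw (m + k) v)"
proof -
  obtain m v where v: "Sub m p v" "v 0 = a" "v (Suc (2 ^ m)) = b" "geq w (pw m v)"
    using assms unfolding Rep_def by (elim exE conjE) (rule that)
  have "\<exists>v. Sub (m + k) p v \<and> v 0 = a \<and> v (Suc (2 ^ (m + k))) = b \<and> geq w (pw (m + k) v)" for k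
  proof (induction k)
    case 0 show ?case by (rule exI[of _ v]) (use v in simp)
  next
    case (Suc k)
    then obtain v where v: "Sub (m + k) p v" "v 0 = a" "v (Suc (2 ^ (m + k))) = b" "geq w (pw (m + k) v)"
      by (elim exE conjE) (rule that)
    obtain v' where v': "Sub (Suc (m + k)) p v'" "v' 0 = v 0" "v' (Suc (2 ^ Suc (m + k))) = v (Suc (2 ^ (m + k)))"
      "geq (pw (Suc (m + k)) v') (pw (m + k) v)" by (rule Sub_refine[OF v(1)])
    show ?case unfolding add_Suc_right
      by (rule exI[of _ v'], intro conjI v'(1) geq_trans[OF v(4) geq_sym[OF v'(4)]])
        (simp_all only: v' v)
  qed
  then show ?thesis by (rule that)
qed

lemma Rep_common_level:
  assumes "Rep p a w b" "Rep p' a' w' b'"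
  obtains m v v' where "Sub m p v" "v 0 = a" "v (Suc (2 ^ m)) = b" "geq w (pw m v)"
    "Sub m p' v'" "v' 0 = a'" "v' (Suc (2 ^ m)) = b'" "geq w' (pw m v')"
proof -
  obtain m where m: "\<And>k. \<exists>v. Sub (m + k) p v \<and> v 0 = a \<and> v (Suc (2 ^ (m + k))) = b \<and> geq w (pw (m + k) v)"
  proof (rule Rep_level[OF assms(1)])
    fix m assume "\<And>k. \<exists>v. Sub (m + k) p v \<and> v 0 = a \<and> v (Suc (2 ^ (m + k))) = b \<and> geq w (pw (m + k) v)"
    then show thesis by (rule that)
  qed
  obtain m' where m': "\<And>k. \<exists>v. Sub (m' + k) p' v \<and> v 0 = a' \<and> v (Suc (2 ^ (m' + k))) = b' \<and> geq w' (pw (m' + k) v)"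
  proof (rule Rep_level[OF assms(2)])
    fix m assume "\<And>k. \<exists>v. Sub (m + k) p' v \<and> v 0 = a' \<and> v (Suc (2 ^ (m + k))) = b' \<and> geq w' (pw (m + k) v)"
    then show thesis by (rule that)
  qed
  obtain v where v: "Sub (m + m') p v" "v 0 = a" "v (Suc (2 ^ (m + m'))) = b" "geq w (pw (m + m') v)"
    using m[of m'] by (elim exE conjE) (rule that)
  obtain v' where v': "Sub (m + m') p' v'" "v' 0 = a'" "v' (Suc (2 ^ (m + m'))) = b'" "geq w' (pw (m + m') v')"
    using m'[of m] unfolding add.commute[of m' m] by (elim exE conjE) (rule that)
  show ?thesis by (rule that[OF v v'])
qed

lemma Rep_unique: "Rep p a w b \<Longrightarrow> Rep p a w' b \<Longrightarrow> geq w w'"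
proof -
  assume "Rep p a w b" "Rep p a w' b"
  then obtain m v v' where h: "Sub m p v" "v 0 = a" "v (Suc (2 ^ m)) = b" "geq w (pw m v)"
    "Sub m p v'" "v' 0 = a" "v' (Suc (2 ^ m)) = b" "geq w' (pw m v')" by (rule Rep_common_level)
  have "geq (pw m v) (pw m v')" by (rule Sub_unique[OF h(1,5)]) (simp_all only: h)
  then show ?thesis by (rule geq_trans[OF geq_trans[OF h(4)] geq_sym[OF h(8)]])
qed

text \<open>Uniform continuity in each coordinate; as \<open>U\<close> is finite, one
  \<open>d\<close> serves all.\<close>

lemma dyadic_fine:
  fixes f :: "'b::metric_space \<Rightarrow> 'u \<Rightarrow> real"
  assumes "compact A" "continuous_on A f" "0 < e"
  obtains d where "0 < d" "\<And>s t v. s \<in> A \<Longrightarrow> t \<in> A \<Longrightarrow> dist s t < d \<Longrightarrow> v \<in> U \<Longrightarrow> \<bar>f s v - f t v\<bar> < e"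
proof -
  have "\<exists>d>0. \<forall>s\<in>A. \<forall>t\<in>A. dist s t < d \<longrightarrow> \<bar>f s v - f t v\<bar> < e" for v
  proof -
    have "continuous_on A (\<lambda>t. f t v)" using assms(2) by (simp add: continuous_on_coord)
    then have "uniformly_continuous_on A (\<lambda>t. f t v)" using assms(1) by (rule compact_uniformly_continuous)
    then show ?thesis using assms(3) unfolding uniformly_continuous_on_def dist_real_def
      by (metis dist_commute abs_minus_commute)
  qed
  then obtain d where d: "\<And>v. d v > 0" "\<And>v s t. s \<in> A \<Longrightarrow> t \<in> A \<Longrightarrow> dist s t < d v \<Longrightarrow> \<bar>f s v - f t v\<bar> < e" by metis
  define D where "D = Min (insert 1 (d ` U))"
  have "D > 0" "\<And>v. v \<in> U \<Longrightarrow> D \<le> d v" using finU d(1) by (auto simp: D_def)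
  then show ?thesis using that[of D] d(2) by (meson less_le_trans)
qed

lemma dyadic_below: "0 < (d::real) \<Longrightarrow> \<exists>m. 1 / 2 ^ m < d"
  using real_arch_pow_inv[of d "1 / 2"] by (simp add: power_one_over)

lemma dyadic_unit: "i < 2 ^ m \<Longrightarrow> real i / 2 ^ m \<le> t \<Longrightarrow> t \<le> real (Suc i) / 2 ^ m \<Longrightarrow> t \<in> {0..1}"
proof -
  assume h: "i < 2 ^ m" "real i / 2 ^ m \<le> t" "t \<le> real (Suc i) / 2 ^ m"
  then have "real (Suc i) \<le> 2 ^ m" by (metis Suc_leI of_nat_le_iff of_nat_numeral of_nat_power)
  then have "real (Suc i) / 2 ^ m \<le> 1" by simp
  moreover have "0 \<le> real i / 2 ^ m" by simp
  ultimately show ?thesis using h by (metis atLeastAtMost_iff order_trans)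
qed

lemma Sub_from_fine:
  assumes p: "pth S p x y" and a: "vertex a" "x \<in> star a" "vertex b" "y \<in> star b"
    and v: "\<And>i. i < 2 ^ m \<Longrightarrow> vertex (v i)"
    and st: "\<And>i t. i < 2 ^ m \<Longrightarrow> real i / 2 ^ m \<le> t \<Longrightarrow> t \<le> real (Suc i) / 2 ^ m \<Longrightarrow> p t \<in> star (v i)"
  shows "Sub m p (\<lambda>j. if j = 0 then a else if j = Suc (2 ^ m) then b else v (j - 1))"
  unfolding Sub_def using a v st pth_ends[OF p] by auto

lemma Rep_exists:
  assumes p: "pth S p x y" and a: "vertex a" "x \<in> star a" "vertex b" "y \<in> star b"
  obtains w where "Rep p a w b" "vpath a w" "endp a w = b"
proof -
  have "continuous_on {0..1} p" using p by (simp add: pth_def path_def)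
  then obtain d where d: "0 < d" "\<And>s t v. s \<in> {0..1} \<Longrightarrow> t \<in> {0..1} \<Longrightarrow> dist s t < d \<Longrightarrow> v \<in> U \<Longrightarrow> \<bar>p s v - p t v\<bar> < 1 / 2"
    using dyadic_fine[OF compact_Icc, of 0 1 p "1 / 2"] by auto
  obtain m where m: "1 / 2 ^ m < d" using dyadic_below d(1) by blast
  let ?v = "\<lambda>i. nv (p (real i / 2 ^ m))"
  have i0: "real i / 2 ^ m \<in> {0..1}" if "i < 2 ^ m" for i :: nat
    using that dyadic_unit[of i m "real i / 2 ^ m"] by (simp add: divide_right_mono)
  define V where "V j = (if j = 0 then a else if j = Suc (2 ^ m) then b else ?v (j - 1))" for j
  have sub: "Sub m p V"
    unfolding V_def
  proof (rule Sub_from_fine[OF p a])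
    fix i :: nat assume i: "i < 2 ^ m"
    show "vertex (?v i)" using nv_vertex pth_in(1)[OF p] i0[OF i] by blast
    fix t assume t: "real i / 2 ^ m \<le> t" "t \<le> real (Suc i) / 2 ^ m"
    have t1: "t \<in> {0..1}" using dyadic_unit[OF i t] .
    have "t - real i / 2 ^ m \<le> 1 / 2 ^ m" using t(2) by (simp add: add_divide_distrib)
    then have "dist (real i / 2 ^ m) t < d" using t m by (simp add: dist_real_def)
    then show "p t \<in> star (?v i)"
      by (intro nv_near pth_in(1)[OF p] i0[OF i] t1 d(2)[OF i0[OF i] t1])
  qed
  have V: "V 0 = a" "V (Suc (2 ^ m)) = b" by (simp_all add: V_def)
  show ?thesis
  proof (rule that)
    show "Rep p a (pw m V) b" unfolding Rep_def
      by (intro exI[of _ m] exI[of _ V] conjI sub V geq_refl)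
    show "vpath a (pw m V)" "endp a (pw m V) = b" using Sub_valid[OF sub] by (simp_all only: V)
  qed
qed

lemma Rep_cong:
  assumes eq: "\<And>t. t \<in> {0..1} \<Longrightarrow> p t = q t" and r: "Rep p a w b"
  shows "Rep q a w b"
proof -
  obtain k u where s: "Sub k p u" and u: "u 0 = a" "u (Suc (2 ^ k)) = b" "geq w (pw k u)"
    using r unfolding Rep_def by (elim exE conjE) (rule that)
  have "Sub k q u"
    unfolding Sub_def
  proof (intro conjI allI impI)
    show "q 0 \<in> star (u 0)" "q 1 \<in> star (u (Suc (2 ^ k)))" using s eq[of 0] eq[of 1] by (simp_all add: Sub_def)
    fix i t assume "i < 2 ^ k" "real i / 2 ^ k \<le> t \<and> t \<le> real (Suc i) / 2 ^ k"
    then show "q t \<in> star (u (Suc i))" using s eq[of t] dyadic_unit[of i k t] unfolding Sub_def by metis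
  qed (use s in \<open>simp add: Sub_def\<close>)
  then show ?thesis unfolding Rep_def by (intro exI[of _ k] exI[of _ u] conjI u)
qed

text \<open>The homotopy square is cut into small dyadic squares. One sequence of stars
  \<open>V j\<close> covers both edges of the \<open>j\<close>-th strip, so neighbouring rows have
  the same word; \<open>a\<close> and \<open>b\<close> persist because the ends are fixed.\<close>

lemma Rep_homotopic:
  assumes h: "homotopic_paths S p q" and r: "Rep p a w b"
  shows "Rep q a w b"
proof -
  obtain m0 v0 where v0: "Sub m0 p v0" "v0 0 = a" "v0 (Suc (2 ^ m0)) = b"
    using r unfolding Rep_def by (elim exE conjE) (rule that)
  then have ab: "vertex a" "vertex b" "p 0 \<in> star a" "p 1 \<in> star b" by (auto simp: Sub_def)
  obtain H where H: "continuous_on ({0..1} \<times> {0..1}) H" "H \<in> ({0..1} \<times> {0..1}) \<rightarrow> S"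
     "\<forall>x \<in> {0..1}. H (0, x) = p x" "\<forall>x \<in> {0..1}. H (1, x) = q x"
     "\<forall>t \<in> {0..1::real}. pathstart (H \<circ> Pair t) = pathstart p \<and> pathfinish (H \<circ> Pair t) = pathfinish p"
    using h unfolding homotopic_paths by metis
  obtain d where d: "0 < d" "\<And>s t v. s \<in> {0..1} \<times> {0..1} \<Longrightarrow> t \<in> {0..1} \<times> {0..1} \<Longrightarrow> dist s t < d \<Longrightarrow> v \<in> U \<Longrightarrow> \<bar>H s v - H t v\<bar> < 1 / 2"
    using dyadic_fine[OF compact_Times[OF compact_Icc compact_Icc] H(1), of "1 / 2"] by auto
  \<comment> \<open>Half of \<open>d\<close>, since a small square allows a displacement of
    \<open>1 / 2 ^ m\<close> in each of its two directions.\<close>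
  obtain m where m: "1 / 2 ^ m < d / 2" using dyadic_below d(1) half_gt_zero by blast
  define v where "v j i = nv (H (real j / 2 ^ m, real i / 2 ^ m))" for j i :: nat
  define q' where "q' j t = H (real j / 2 ^ m, t)" for j :: nat and t
  define V where "V j = (\<lambda>i. if i = 0 then a else if i = Suc (2 ^ m) then b else v j (i - 1))" for j
  have i0: "real i / 2 ^ m \<in> {0..1}" if "i \<le> 2 ^ m" for i :: nat using that by simp
  have HS: "H z \<in> S" if "z \<in> {0..1} \<times> {0..1}" for z using H(2) that by blast
  have qp: "pth S (q' j) (p 0) (p 1)" if "j \<le> 2 ^ m" for j
  proof -
    have j: "real j / 2 ^ m \<in> {0..1}" using i0 that by blast
    have "continuous_on {0..1} (H \<circ> Pair (real j / 2 ^ m))"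
      by (intro continuous_on_compose continuous_intros continuous_on_subset[OF H(1)]) (use j in auto)
    then have "path (q' j)" unfolding path_def q'_def o_def .
    moreover have "path_image (q' j) \<subseteq> S" unfolding path_image_def q'_def using HS j by auto
    ultimately show ?thesis using H(5) j unfolding pth_def q'_def by (simp add: pathstart_def pathfinish_def)
  qed
  have near: "Sub m (q' k) (V j)" if "k = j \<or> k = Suc j" "j < 2 ^ m" for j k
  proof -
    have k: "k \<le> 2 ^ m" using that by auto
    show ?thesis unfolding V_def
    proof (rule Sub_from_fine[OF qp[OF k] ab(1,3,2,4)])
      fix i :: nat assume i: "i < 2 ^ m"
      have ji: "(real j / 2 ^ m, real i / 2 ^ m) \<in> {0..1} \<times> {0..1}" using i0[of j] i0[of i] that i by simp
      show "vertex (v j i)" unfolding v_def using nv_vertex HS ji by blast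
      fix t assume t: "real i / 2 ^ m \<le> t" "t \<le> real (Suc i) / 2 ^ m"
      have kt: "(real k / 2 ^ m, t) \<in> {0..1} \<times> {0..1}" using i0[OF k] dyadic_unit[OF i t] by simp
      have "dist (real i / 2 ^ m) t \<le> 1 / 2 ^ m" using t by (simp add: dist_real_def add_divide_distrib)
      moreover have "dist (real j / 2 ^ m) (real k / 2 ^ m) \<le> 1 / 2 ^ m"
        using that(1) by (auto simp: dist_real_def add_divide_distrib)
      ultimately have "dist (real j / 2 ^ m, real i / 2 ^ m) (real k / 2 ^ m, t) < d"
        using m sqrt_sum_squares_le_sum[of "dist (real j / 2 ^ m) (real k / 2 ^ m)" "dist (real i / 2 ^ m) t"]
        by (simp add: dist_Pair_Pair)
      then have "H (real k / 2 ^ m, t) \<in> star (nv (H (real j / 2 ^ m, real i / 2 ^ m)))"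
        by (intro nv_near HS ji kt d(2)[OF ji kt])
      then show "q' k t \<in> star (v j i)" unfolding q'_def v_def .
    qed
  qed
  have V: "V j 0 = a" "V j (Suc (2 ^ m)) = b" for j by (simp_all add: V_def)
  have row: "Rep (q' j) a w b" if "j \<le> 2 ^ m" for j
    using that
  proof (induction j)
    case 0
    obtain w' where w': "Rep (q' 0) a w' b" using Rep_exists[OF qp[OF 0] ab(1,3,2,4)] by blast
    have eqp: "q' 0 t = p t" if "t \<in> {0..1}" for t using H(3) that by (simp add: q'_def)
    have "Rep p a w' b" by (rule Rep_cong[OF eqp w'])
    then show ?case by (rule Rep_geq[OF w' Rep_unique[OF _ r]])
  next
    case (Suc j)
    then have j: "j < 2 ^ m" by simp
    have 1: "Rep (q' j) a (pw m (V j)) b" "Rep (q' (Suc j)) a (pw m (V j)) b"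
      unfolding Rep_def
      by (intro exI[of _ m] exI[of _ "V j"] conjI near[OF _ j] V geq_refl; simp)+
    have "Rep (q' j) a w b" using Suc by simp
    then show ?case by (rule Rep_geq[OF 1(2) Rep_unique[OF 1(1)]])
  qed
  have eqq: "q' (2 ^ m) t = q t" if "t \<in> {0..1}" for t using H(4) that by (simp add: q'_def)
  show ?thesis by (rule Rep_cong[OF eqq row]) auto
qed

lemma Rep_join:
  assumes p: "Rep p a w b" and q: "Rep q b w' c" and e: "p 1 = q 0"
  shows "Rep (p +++ q) a (w @ w') c"
proof -
  obtain m v v' where v: "Sub m p v" "v 0 = a" "v (Suc (2 ^ m)) = b" "geq w (pw m v)"
    and v': "Sub m q v'" "v' 0 = b" "v' (Suc (2 ^ m)) = c" "geq w' (pw m v')"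
    by (rule Rep_common_level[OF p q])
  let ?N = "2 ^ m :: nat"
  define u where "u j = (if j \<le> ?N then v j else v' (j - ?N))" for j
  have lo: "u j = v j" if "j \<le> ?N" for j using that by (simp add: u_def)
  have hi: "u (?N + Suc j) = v' (Suc j)" for j by (simp add: u_def)
  have vx: "vertex (v i)" "vertex (v' i)" if "i \<le> Suc ?N" for i using v(1) v'(1) that by (simp_all add: Sub_def)
  have S': "Sub (Suc m) (p +++ q) u"
    unfolding Sub_def
  proof (intro conjI allI impI)
    show "vertex (u i)" if "i \<le> Suc (2 ^ Suc m)" for i
      using that vx(1)[of i] vx(2)[of "i - ?N"] by (auto simp: u_def)
    show "(p +++ q) 0 \<in> star (u 0)" using v(1) by (simp add: u_def Sub_def joinpaths_def)
    have "u (Suc (2 ^ Suc m)) = v' (Suc ?N)" using hi[of ?N] by (simp add: mult_2)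
    then show "(p +++ q) 1 \<in> star (u (Suc (2 ^ Suc m)))" using v'(1) by (simp add: Sub_def joinpaths_def)
    fix i :: nat and t :: real assume i: "i < 2 ^ Suc m" and t: "real i / 2 ^ Suc m \<le> t \<and> t \<le> real (Suc i) / 2 ^ Suc m"
    have half: "2 * (x / 2 ^ Suc m) = x / 2 ^ m" for x :: real by simp
    have t2: "real i / 2 ^ m \<le> 2 * t" "2 * t \<le> real (Suc i) / 2 ^ m"
      using t half[of "real i"] half[of "real (Suc i)"] by linarith+
    show "(p +++ q) t \<in> star (u (Suc i))"
    proof (cases "i < ?N")
      case True
      have "2 * t \<in> {0..1}" using dyadic_unit[OF True t2] .
      then have "(p +++ q) t = p (2 * t)" by (simp add: joinpaths_def)
      moreover have "p (2 * t) \<in> star (v (Suc i))" using v(1) True t2 unfolding Sub_def by blast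
      ultimately show ?thesis using lo[of "Suc i"] True by simp
    next
      case False
      then obtain j where j: "i = ?N + j" by (metis add_diff_inverse_nat)
      then have jN: "j < ?N" using i by simp
      have sh: "real (?N + k) / 2 ^ m = 1 + real k / 2 ^ m" for k by (simp add: add_divide_distrib)
      have t3: "real j / 2 ^ m \<le> 2 * t - 1" "2 * t - 1 \<le> real (Suc j) / 2 ^ m"
        using t2 sh[of j] sh[of "Suc j"] j by simp_all
      have t4: "2 * t - 1 \<in> {0..1}" using dyadic_unit[OF jN t3] .
      have "(p +++ q) t = q (2 * t - 1)"
      proof (cases "t \<le> 1 / 2")
        case True
        then have "2 * t = 1" using t4 by simp
        then show ?thesis using e True by (simp add: joinpaths_def)
      qed (simp add: joinpaths_def)
      moreover have "q (2 * t - 1) \<in> star (v' (Suc j))" using v'(1) jN t3 unfolding Sub_def by blast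
      ultimately show ?thesis using hi[of j] j by simp
    qed
  qed
  have low: "prodw u k = prodw v k" if "k \<le> ?N" for k
    using that by (induction k) (simp_all add: lo)
  \<comment> \<open>The subdivision \<open>u\<close> of the concatenation omits the vertex
    \<open>b\<close> at the junction. The point \<open>p 1\<close> lies in the star of
    \<open>b\<close> and in those of both neighbours, so the direct transition equals the one
    through \<open>b\<close>.\<close>
  have mid: "geq (tau (v ?N) (v' (Suc 0))) (tau (v ?N) (v (Suc ?N)) @ tau (v' 0) (v' (Suc 0)))"
  proof -
    have "p 1 \<in> star (v ?N)" using Sub_common(1)[OF v(1), of ?N] by simp
    moreover have "p 1 \<in> star (v (Suc ?N))" using v(1) by (simp add: Sub_def)
    moreover have "p 1 \<in> star (v' (Suc 0))" using Sub_common(2)[OF v'(1), of 0] e by simp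
    ultimately have "cell (v ?N \<union> v (Suc ?N) \<union> v' (Suc 0))"
      by (rule star_common3) (simp add: vx)
    then have "geq (tau (v ?N) (v (Suc ?N)) @ tau (v (Suc ?N)) (v' (Suc 0))) (tau (v ?N) (v' (Suc 0)))"
      by (intro tau_comp vx) simp_all
    then show ?thesis using geq_sym v(3) v'(2) by simp
  qed
  have high: "geq (prodw u (?N + Suc k)) (pw m v @ prodw v' (Suc k))" if "k \<le> ?N" for k
    using that
  proof (induction k)
    case 0
    have "prodw u (?N + Suc 0) = prodw v ?N @ tau (v ?N) (v' (Suc 0))"
      using low[of ?N] lo[of ?N] hi[of 0] by simp
    then show ?case using geq_append[OF geq_refl mid, of "prodw v ?N"] by simp
  next
    case (Suc k)
    have "prodw u (?N + Suc (Suc k)) = prodw u (?N + Suc k) @ tau (v' (Suc k)) (v' (Suc (Suc k)))"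
      using hi[of k] hi[of "Suc k"] by simp
    then show ?case using geq_append[OF Suc.IH geq_refl, of "tau (v' (Suc k)) (v' (Suc (Suc k)))"] Suc.prems by simp
  qed
  have eqN: "?N + Suc ?N = Suc (2 ^ Suc m)" by simp
  have "geq (pw (Suc m) u) (pw m v @ pw m v')"
    using high[of ?N] unfolding eqN by simp
  then have "geq (w @ w') (pw (Suc m) u)"
    using geq_trans[OF geq_append[OF v(4) v'(4)] geq_sym] by blast
  moreover have "u 0 = a" using v(2) lo[of 0] by simp
  moreover have "u (Suc (2 ^ Suc m)) = c" using hi[of ?N] v'(3) unfolding eqN by (simp only:)
  ultimately show ?thesis unfolding Rep_def using S' by blast
qed

lemma Rep_cst: "vertex a \<Longrightarrow> x \<in> star a \<Longrightarrow> Rep (cst x) a [] a"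
proof -
  assume a: "vertex a" "x \<in> star a"
  have "Sub 0 (cst x) (\<lambda>_. a)" using a by (simp add: Sub_def cst_app)
  moreover have "geq [] (pw 0 (\<lambda>_. a))"
    using geq_append[OF tau_self[OF a(1)] tau_self[OF a(1)]] geq_sym by simp
  ultimately show ?thesis unfolding Rep_def by (intro exI[of _ 0] exI[of _ "\<lambda>_. a"]) simp
qed

lemma Rep_in_star:
  assumes "vertex v" "vertex a" "vertex b" "p 0 \<in> star a" "p 1 \<in> star b" "\<And>t. t \<in> {0..1} \<Longrightarrow> p t \<in> star v"
  shows "Rep p a (tau a v @ tau v b) b"
proof -
  define u where "u i = (if i = 0 then a else if i = Suc 0 then v else b)" for i :: nat
  have "Sub 0 p u" using assms by (auto simp: Sub_def u_def)
  moreover have "pw 0 u = tau a v @ tau v b" by (simp add: u_def)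
  ultimately show ?thesis unfolding Rep_def by (intro exI[of _ 0] exI[of _ u]) (simp add: u_def)
qed

text \<open>Level 1 suffices: the first half of the segment lies in the star of \<open>a\<close>,
  the second in that of \<open>b\<close>.\<close>

lemma Rep_edge:
  assumes "vertex a" "vertex b" "cell (a \<union> b)"
  shows "Rep (seg (pt a) (pt b)) a (tau a b) b"
proof -
  let ?p = "seg (pt a) (pt b)"
  have co: "coc (pt a) (pt b)" using coc_cell[OF assms(3)] by simp
  have S: "?p t \<in> S" if "t \<in> {0..1}" for t by (rule seg_S[OF pt_S(1)[OF assms(1)] pt_S(1)[OF assms(2)] co that])
  have sa: "?p t \<in> star a" if "0 \<le> t" "t \<le> 1 / 2" for t
    using S[of t] that by (auto simp: star_def seg_def pt_def intro!: add_pos_nonneg)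
  have sb: "?p t \<in> star b" if "1 / 2 \<le> t" "t \<le> 1" for t
    using S[of t] that by (auto simp: star_def seg_def pt_def intro!: add_nonneg_pos)
  define u where "u i = (if i \<le> Suc 0 then a else b)" for i :: nat
  have "Sub (Suc 0) ?p u"
    unfolding Sub_def
  proof (intro conjI allI impI)
    show "vertex (u i)" for i using assms by (simp add: u_def)
    show "?p 0 \<in> star (u 0)" using sa[of 0] by (simp add: u_def)
    show "?p 1 \<in> star (u (Suc (2 ^ Suc 0)))" using sb[of 1] by (simp add: u_def)
    fix i :: nat and t :: real assume "i < 2 ^ Suc 0" "real i / 2 ^ Suc 0 \<le> t \<and> t \<le> real (Suc i) / 2 ^ Suc 0"
    then show "?p t \<in> star (u (Suc i))" using sa[of t] sb[of t] by (cases "i = 0") (auto simp: u_def)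
  qed
  moreover have "geq (tau a b) (pw (Suc 0) u)"
  proof -
    have "pw (Suc 0) u = (tau a a @ tau a b) @ tau b b" by (simp add: u_def numeral_2_eq_2)
    moreover have "geq ((tau a a @ tau a b) @ tau b b) (([] @ tau a b) @ [])"
      by (intro geq_append tau_self assms geq_refl)
    ultimately show ?thesis using geq_sym by simp
  qed
  ultimately show ?thesis unfolding Rep_def
    by (intro exI[of _ "Suc 0"] exI[of _ u]) (simp add: u_def)
qed

text \<open>Reading off words inverts realisation. For a single edge, the transition word and
  \<open>[e]\<close> have the same ends inside one cell, hence agree up to
  \<open>geq\<close>.\<close>

lemma Rep_rp: "vpath a w \<Longrightarrow> Rep (rp a w) a w (endp a w)"
proof (induction w arbitrary: a)
  case Nil
  then show ?case using Rep_cst pt_S by simp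
next
  case (Cons e w)
  then have h: "vertex a" "edge_at a e" "vpath (mv a e) w" by auto
  note st = edge_step[OF h(1,2)]
  have "geq (tau a (mv a e)) [e]"
  proof (rule paths_in_cell[OF tau(1)[OF h(1) st(1,3)] _ st(3)])
    show "vpath a [e]" using h st by simp
    show "\<forall>f\<in>set (tau a (mv a e)). f \<subseteq> a \<union> mv a e" using tau(3)[OF h(1) st(1,3)] by blast
    show "\<forall>f\<in>set [e]. f \<subseteq> a \<union> mv a e" by (auto simp: mv_def)
    show "endp a (tau a (mv a e)) = endp a [e]" using tau(2)[OF h(1) st(1,3)] by simp
  qed
  then have "Rep (seg (pt a) (pt (mv a e))) a [e] (mv a e)"
    by (rule Rep_geq[OF Rep_edge[OF h(1) st(1,3)]])
  moreover have "rp (mv a e) w 0 = pt (mv a e)" using pth_ends[OF rp_pth[OF h(3)]] by simp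
  ultimately have "Rep (seg (pt a) (pt (mv a e)) +++ rp (mv a e) w) a ([e] @ w) (endp (mv a e) w)"
    by (intro Rep_join[OF _ Cons.IH[OF h(3)]]) simp_all
  then show ?case by simp
qed

end

section \<open>Recovering the homotopy class of a path from its word\<close>

context coupled
begin

text \<open>Each piece runs in one star, so it may be rerouted through the centre of that star; at a
  division point the two centres are joined by the transition word. The word \<open>w'\<close> is
  that of a subdivision, because \<open>w\<close> itself need not be valid.\<close>

lemma Rep_path:
  assumes p: "pth S p x y" and r: "Rep p a w b"
  obtains w' where "vpath a w'" "endp a w' = b" "geq w w'"
    "homotopic_paths S p (seg x (pt a) +++ (rp a w' +++ seg (pt b) y))"
proof -
  obtain m v where v: "Sub m p v" "v 0 = a" "v (Suc (2 ^ m)) = b" "geq w (pw m v)"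
    using r unfolding Rep_def by (elim exE conjE) (rule that)
  let ?N = "2 ^ m :: nat" and ?t = "\<lambda>i. real i / 2 ^ m"
  have vx: "vertex (v i)" if "i \<le> Suc ?N" for i using v(1) that by (simp add: Sub_def)
  have com: "p (?t i) \<in> star (v i)" "p (?t i) \<in> star (v (Suc i))" if "i \<le> ?N" for i
    using Sub_common[OF v(1) that] by blast+
  have cl: "cell (v i \<union> v (Suc i))" if "i \<le> ?N" for i
    using star_common[OF com(1)[OF that] com(2)[OF that]] vx that by simp
  have p0: "p 0 = x" using pth_ends[OF p] by simp
  have vp: "vpath (v 0) (prodw v k)" "endp (v 0) (prodw v k) = v k" if "k \<le> Suc ?N" for k
    using prodw_vpath[of k v] vx cl that by simp_all
  have tw: "e \<subseteq> v 0 \<union> v 1" if "e \<in> set (prodw v 1)" for e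
  proof -
    have v01: "vertex (v 0)" "vertex (v (Suc 0))" "cell (v 0 \<union> v (Suc 0))" by (intro vx cl; simp)+
    show ?thesis using tau(3)[OF v01, of e] that by (simp only: One_nat_def prodw.simps append_Nil)
  qed
  have main: "homotopic_paths S (piece p 0 (?t k))
      (seg x (pt (v 0)) +++ (rp (v 0) (prodw v (Suc k)) +++ seg (pt (v (Suc k))) (p (?t k))))" if "k \<le> ?N" for k
    using that
  proof (induction k)
    case 0
    have x0: "x \<in> star (v 0)" "x \<in> star (v 1)" using com[of 0] p0 by simp_all
    have xS: "x \<in> S" using star_S x0 by blast
    have sub: "v 0 \<subseteq> supp x" "v 1 \<subseteq> supp x" using star_supp x0 by blast+
    have c0: "piece p 0 (?t 0) = cst x" using p0 by (simp add: piece_def cst_def o_def)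
    have P: "pth S (seg x (pt (v 0)) +++ (rp (v 0) (prodw v 1) +++ seg (pt (v 1)) x)) x x"
      using star_seg_pth(1)[OF vx x0(1)] star_seg_pth(2)[OF vx x0(2)] rp_pth[OF vp(1)[of 1]] vp(2)[of 1]
      by (intro pth_join) simp_all
    have "homotopic_paths S (cst x) (seg x (pt (v 0)) +++ (rp (v 0) (prodw v 1) +++ seg (pt (v 1)) x))"
    proof (rule hp_in_cell[OF supp_cell[OF xS] pth_cst[OF xS] P])
      fix t :: real assume t: "t \<in> {0..1}"
      show "supp (cst x t) \<subseteq> supp x" by (simp add: cst_app)
      have "\<forall>e\<in>set (prodw v 1). e \<subseteq> supp x" using tw sub by blast
      then have "supp (rp (v 0) (prodw v 1) t) \<subseteq> supp x" if "t \<in> {0..1}" for t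
        using rp_in_cell[OF vp(1)[of 1] sub(1)] that by simp
      moreover have "supp (seg x (pt (v 0)) t) \<subseteq> supp x" "supp (seg (pt (v 1)) x t) \<subseteq> supp x" for t
        using supp_seg[of x "pt (v 0)" t] supp_seg[of "pt (v 1)" x t] sub by auto
      ultimately show "supp ((seg x (pt (v 0)) +++ (rp (v 0) (prodw v 1) +++ seg (pt (v 1)) x)) t) \<subseteq> supp x"
        using t by (intro join_range[where P = "\<lambda>z. supp z \<subseteq> supp x"])
    qed
    then show ?case using c0 p0 by simp
  next
    case (Suc k)
    then have k: "k \<le> ?N" "Suc k \<le> ?N" "k < ?N" by simp_all
    let ?a = "v (Suc k)" and ?b = "v (Suc (Suc k))" and ?z = "p (?t k)" and ?z' = "p (?t (Suc k))"
    have ab: "vertex ?a" "vertex ?b" "cell (?a \<union> ?b)" using vx cl k by simp_all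
    note T = tau[OF ab]
    have zs: "?z \<in> star ?a" "?z' \<in> star ?a" "?z' \<in> star ?b" using com k by blast+
    let ?A = "seg x (pt (v 0))" and ?B = "rp (v 0) (prodw v (Suc k))" and ?C = "seg (pt ?a) ?z"
      and ?D = "seg ?z (pt ?a)" and ?E = "seg (pt ?a) ?z'" and ?B' = "rp ?a (tau ?a ?b)" and ?E' = "seg (pt ?b) ?z'"
    have PA: "pth S ?A x (pt (v 0))" using star_seg_pth(1)[OF vx[of 0] com(1)[of 0]] p0 by simp
    have PB: "pth S ?B (pt (v 0)) (pt ?a)" using rp_pth[OF vp(1)[of "Suc k"]] vp(2)[of "Suc k"] k by simp
    have PC: "pth S ?C (pt ?a) ?z" by (rule star_seg_pth(2)[OF ab(1) zs(1)])
    have PD: "pth S ?D ?z (pt ?a)" by (rule star_seg_pth(1)[OF ab(1) zs(1)])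
    have PE: "pth S ?E (pt ?a) ?z'" by (rule star_seg_pth(2)[OF ab(1) zs(2)])
    have PB': "pth S ?B' (pt ?a) (pt ?b)" using rp_pth[OF T(1)] T(2) by simp
    have PE': "pth S ?E' (pt ?b) ?z'" by (rule star_seg_pth(2)[OF ab(2) zs(3)])
    have tt: "0 \<le> ?t k" "?t k \<le> ?t (Suc k)" "?t (Suc k) \<le> 1"
    proof -
      have "real (Suc k) \<le> 2 ^ m" using k(2) by (metis of_nat_le_iff of_nat_numeral of_nat_power)
      then show "?t (Suc k) \<le> 1" by simp
    qed (simp_all add: divide_right_mono)
    have 1: "homotopic_paths S (piece p 0 (?t (Suc k))) (piece p 0 (?t k) +++ piece p (?t k) (?t (Suc k)))"
      by (rule piece_join[OF p order.refl tt])
    have P1: "pth S (piece p 0 (?t k)) x ?z" using piece_pth[OF p order.refl tt(1) order_trans[OF tt(2,3)]] p0 by simp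
    have P2: "pth S (piece p (?t k) (?t (Suc k))) ?z ?z'" by (rule piece_pth[OF p tt])
    have 2: "homotopic_paths S (piece p (?t k) (?t (Suc k))) (?D +++ ?E)"
    proof (rule hp_star[OF ab(1) P2])
      fix t :: real assume t: "t \<in> {0..1}"
      have "(1 - t) * ?t k + t * ?t (Suc k) \<in> {?t k..?t (Suc k)}" by (rule piece_arg(1)[OF tt t])
      then show "piece p (?t k) (?t (Suc k)) t \<in> star ?a"
        using v(1) k(3) unfolding Sub_def piece_def by simp
    qed
    have 3: "homotopic_paths S (?C +++ ?D) (cst (pt ?a))"
    proof (rule hp_in_cell[OF supp_cell[OF star_S[OF zs(1)]] pth_join[OF PC PD] pth_cst[OF pt_S(1)[OF ab(1)]]])
      have "supp (?C t) \<subseteq> supp ?z" "supp (?D t) \<subseteq> supp ?z" for t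
        using supp_seg[of "pt ?a" ?z t] supp_seg[of ?z "pt ?a" t] star_supp[OF zs(1)] by auto
      then show "supp ((?C +++ ?D) t) \<subseteq> supp ?z" if "t \<in> {0..1}" for t
        using that by (intro join_range[where P = "\<lambda>x. supp x \<subseteq> supp ?z"])
      show "supp (cst (pt ?a) t) \<subseteq> supp ?z" for t using star_supp[OF zs(1)] by (simp add: cst_app)
    qed
    have 4: "homotopic_paths S ?E (?B' +++ ?E')"
    proof (rule hp_in_cell[OF supp_cell[OF star_S[OF zs(2)]] PE pth_join[OF PB' PE']])
      have s: "?a \<subseteq> supp ?z'" "?b \<subseteq> supp ?z'" using star_supp zs by blast+
      show "supp (?E t) \<subseteq> supp ?z'" for t using supp_seg[of "pt ?a" ?z' t] s by auto
      have "\<forall>e\<in>set (tau ?a ?b). e \<subseteq> supp ?z'" using T(3) s by blast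
      then have "supp (?B' t) \<subseteq> supp ?z'" if "t \<in> {0..1}" for t by (rule rp_in_cell[OF T(1) s(1) _ that])
      moreover have "supp (?E' t) \<subseteq> supp ?z'" for t using supp_seg[of "pt ?b" ?z' t] s by auto
      ultimately show "supp ((?B' +++ ?E') t) \<subseteq> supp ?z'" if "t \<in> {0..1}" for t
        using that by (intro join_range[where P = "\<lambda>x. supp x \<subseteq> supp ?z'"])
    qed
    note tr = homotopic_paths_trans and sy = homotopic_paths_sym
    \<comment> \<open>The way to the last division point and back to the centre cancels; the
      remaining segment is exchanged, inside one cell, for the transition word followed by the
      segment from the next centre.\<close>
    have 5: "homotopic_paths S (?C +++ (?D +++ ?E)) (?B' +++ ?E')"
    proof -
      have "homotopic_paths S (?C +++ (?D +++ ?E)) ((?C +++ ?D) +++ ?E)" by (rule sy[OF hp_assoc[OF PC PD PE]])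
      also have "homotopic_paths S \<dots> (cst (pt ?a) +++ ?E)" by (rule hp_join[OF 3 hp_refl[OF PE] pth_join[OF PC PD] PE])
      also have "homotopic_paths S \<dots> ?E" by (rule hp_lid[OF PE])
      finally show ?thesis using tr 4 by blast
    qed
    have vp': "vpath (v 0) (prodw v (Suc k) @ tau ?a ?b)" using vp(1)[of "Suc (Suc k)"] k by simp
    have 6: "homotopic_paths S (?B +++ ?B') (rp (v 0) (prodw v (Suc (Suc k))))"
      using sy[OF rp_append[OF vp']] vp(2)[of "Suc k"] k by simp
    have "homotopic_paths S (piece p 0 (?t (Suc k))) ((?A +++ (?B +++ ?C)) +++ (?D +++ ?E))"
      by (rule tr[OF 1 hp_join[OF Suc.IH[OF k(1)] 2 P1 P2]])
    also have "homotopic_paths S \<dots> (?A +++ ((?B +++ ?C) +++ (?D +++ ?E)))"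
      by (rule hp_assoc[OF PA pth_join[OF PB PC] pth_join[OF PD PE]])
    also have "homotopic_paths S \<dots> (?A +++ (?B +++ (?C +++ (?D +++ ?E))))"
      by (rule hp_join[OF hp_refl[OF PA] hp_assoc[OF PB PC pth_join[OF PD PE]] PA pth_join[OF pth_join[OF PB PC] pth_join[OF PD PE]]])
    also have "homotopic_paths S \<dots> (?A +++ (?B +++ (?B' +++ ?E')))"
      by (rule hp_join[OF hp_refl[OF PA] hp_join[OF hp_refl[OF PB] 5 PB pth_join[OF PC pth_join[OF PD PE]]] PA
            pth_join[OF PB pth_join[OF PC pth_join[OF PD PE]]]])
    also have "homotopic_paths S \<dots> (?A +++ ((?B +++ ?B') +++ ?E'))"
      by (rule hp_join[OF hp_refl[OF PA] sy[OF hp_assoc[OF PB PB' PE']] PA pth_join[OF PB pth_join[OF PB' PE']]])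
    also have "homotopic_paths S \<dots> (?A +++ (rp (v 0) (prodw v (Suc (Suc k))) +++ ?E'))"
      by (rule hp_join[OF hp_refl[OF PA] hp_join[OF 6 hp_refl[OF PE'] pth_join[OF PB PB'] PE'] PA
            pth_join[OF pth_join[OF PB PB'] PE']])
    finally show ?case .
  qed
  have "homotopic_paths S p (seg x (pt a) +++ (rp a (pw m v) +++ seg (pt b) y))"
    using main[of ?N] piece_full[of p] v(2,3) pth_ends[OF p] by simp
  then show ?thesis using that[of "pw m v"] vp[of "Suc ?N"] v by simp
qed

text \<open>With \<open>Rep_homotopic\<close> and \<open>Rep_unique\<close> this embeds the homotopy
  classes of paths with given ends into the Coxeter group.\<close>

theorem Rep_inj:
  assumes p: "pth S p x y" "Rep p a w b" and q: "pth S q x y" "Rep q a w b"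
  shows "homotopic_paths S p q"
proof -
  obtain u where u: "vpath a u" "endp a u = b" "geq w u"
    "homotopic_paths S p (seg x (pt a) +++ (rp a u +++ seg (pt b) y))" by (rule Rep_path[OF p])
  obtain u' where u': "vpath a u'" "endp a u' = b" "geq w u'"
    "homotopic_paths S q (seg x (pt a) +++ (rp a u' +++ seg (pt b) y))" by (rule Rep_path[OF q])
  have ends: "vertex a" "vertex b" "x \<in> star a" "y \<in> star b"
    using p(2) pth_ends[OF p(1)] unfolding Rep_def Sub_def by auto
  note A = star_seg_pth(1)[OF ends(1,3)] and C = star_seg_pth(2)[OF ends(2,4)]
  have B: "pth S (rp a u) (pt a) (pt b)" using rp_pth[OF u(1)] u(2) by simp
  have "homotopic_paths S (rp a u) (rp a u')" by (rule rp_geq[OF u(1) u'(1) geq_trans[OF geq_sym[OF u(3)] u'(3)]])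
  then have "homotopic_paths S (seg x (pt a) +++ (rp a u +++ seg (pt b) y)) (seg x (pt a) +++ (rp a u' +++ seg (pt b) y))"
    by (intro hp_join[OF hp_refl[OF A] hp_join[OF _ hp_refl[OF C] B C] A pth_join[OF B C]])
  from homotopic_paths_trans[OF homotopic_paths_trans[OF u(4) this] homotopic_paths_sym[OF u'(4)]]
  show ?thesis .
qed

end

section \<open>Lengths of paths\<close>

text \<open>\<open>\<phi>\<close> dominates arc length along \<open>g\<close>. Lengths are handled
  through such functions because they restrict, reverse and concatenate by elementary formulas;
  \<open>ctl_len\<close> and \<open>rect_ctl\<close> translate to and from suprema of polygonal
  lengths.\<close>

definition ctl :: "('p \<Rightarrow> 'p \<Rightarrow> real) \<Rightarrow> (real \<Rightarrow> 'p) \<Rightarrow> (real \<Rightarrow> real) \<Rightarrow> bool" where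
  "ctl d g \<phi> \<longleftrightarrow> (\<forall>s t. 0 \<le> s \<longrightarrow> s \<le> t \<longrightarrow> t \<le> 1 \<longrightarrow> d (g s) (g t) \<le> \<phi> t - \<phi> s)"

lemma ctlD: "ctl d g \<phi> \<Longrightarrow> 0 \<le> s \<Longrightarrow> s \<le> t \<Longrightarrow> t \<le> 1 \<Longrightarrow> d (g s) (g t) \<le> \<phi> t - \<phi> s"
  by (simp add: ctl_def)

lemma poly_nonempty: "0 \<in> polygonal_lengths d g"
  unfolding polygonal_lengths_def by (rule CollectI, rule exI[of _ 0], rule exI[of _ "\<lambda>_. 0"]) simp

lemma ctl_len:
  assumes c: "ctl d g \<phi>" and d: "\<And>x y. 0 \<le> d x y"
  shows "rectifiable d g" "path_len d g \<le> \<phi> 1 - \<phi> 0" "0 \<le> \<phi> 1 - \<phi> 0"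
proof -
  have mono: "\<phi> s \<le> \<phi> t" if "0 \<le> s" "s \<le> t" "t \<le> 1" for s t
    using ctlD[OF c that] d[of "g s" "g t"] by simp
  have le: "l \<le> \<phi> 1 - \<phi> 0" if l: "l \<in> polygonal_lengths d g" for l
  proof -
    obtain m t where t: "l = (\<Sum>i<m. d (g (t i)) (g (t (Suc i))))" "\<forall>i\<le>m. t i \<in> {0..1}" "\<forall>i<m. t i \<le> t (Suc i)"
      using l unfolding polygonal_lengths_def by blast
    have "k \<le> m \<Longrightarrow> (\<Sum>i<k. d (g (t i)) (g (t (Suc i)))) \<le> \<phi> (t k) - \<phi> (t 0)" for k
    proof (induction k)
      case (Suc k)
      then show ?case using ctlD[OF c, of "t k" "t (Suc k)"] t(2,3) by fastforce
    qed simp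
    then have "l \<le> \<phi> (t m) - \<phi> (t 0)" using t(1) by simp
    then show ?thesis using mono[of 0 "t 0"] mono[of "t m" 1] t(2) by fastforce
  qed
  then show "rectifiable d g" unfolding rectifiable_def by (intro bdd_aboveI)
  show "path_len d g \<le> \<phi> 1 - \<phi> 0" unfolding path_len_def
    using poly_nonempty le by (intro cSup_least) auto
  show "0 \<le> \<phi> 1 - \<phi> 0" using le[OF poly_nonempty] .
qed

lemma rect_ctl:
  assumes r: "rectifiable d g" and d: "\<And>x y. 0 \<le> d x y"
  obtains \<phi> where "ctl d g \<phi>" "\<phi> 1 - \<phi> 0 \<le> path_len d g"
proof -
  \<comment> \<open>The polygonal sums up to the parameter \<open>u\<close>; their supremum is the
    arc length function, which serves as control.\<close>
  define L where "L u = {(\<Sum>i<m. d (g (t i)) (g (t (Suc i)))) | (m::nat) t.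
        (\<forall>i\<le>m. t i \<in> {0..u}) \<and> (\<forall>i<m. t i \<le> t (Suc i))}" for u :: real
  have sub: "L u \<subseteq> polygonal_lengths d g" if "u \<le> 1" for u
  proof
    fix l assume "l \<in> L u"
    then obtain m t where t: "l = (\<Sum>i<m. d (g (t i)) (g (t (Suc i))))" "\<forall>i\<le>m. t i \<in> {0..u}" "\<forall>i<m. t i \<le> t (Suc i)"
      unfolding L_def by blast
    have "\<forall>i\<le>m. t i \<in> {0..1}" using t(2) that by auto
    then show "l \<in> polygonal_lengths d g" unfolding polygonal_lengths_def using t(1,3) by blast
  qed
  have bdd: "bdd_above (L u)" if "u \<le> 1" for u
    by (rule bdd_above_mono[OF r[unfolded rectifiable_def] sub[OF that]])
  have z: "0 \<in> L u" if "0 \<le> u" for u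
    unfolding L_def by (rule CollectI, rule exI[of _ 0], rule exI[of _ "\<lambda>_. 0"]) (use that in simp)
  have "ctl d g (\<lambda>u. Sup (L u))"
    unfolding ctl_def
  proof (intro allI impI)
    fix s t :: real assume st: "0 \<le> s" "s \<le> t" "t \<le> 1"
    have "l \<le> Sup (L t) - d (g s) (g t)" if l: "l \<in> L s" for l
    proof -
      obtain m u where u: "l = (\<Sum>i<m. d (g (u i)) (g (u (Suc i))))" "\<forall>i\<le>m. u i \<in> {0..s}" "\<forall>i<m. u i \<le> u (Suc i)"
        using l unfolding L_def by blast
      \<comment> \<open>The partition is continued by the points \<open>s\<close> and
        \<open>t\<close>, which adds at least \<open>d (g s) (g t)\<close> to the sum.\<close>
      define u' where "u' i = (if i \<le> m then u i else if i = Suc m then s else t)" for i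
      have "(\<Sum>i<m. d (g (u' i)) (g (u' (Suc i)))) = l" unfolding u(1) u'_def by (intro sum.cong) auto
      then have eq: "(\<Sum>i<Suc (Suc m). d (g (u' i)) (g (u' (Suc i)))) = l + d (g (u m)) (g s) + d (g s) (g t)"
        by (simp add: u'_def)
      have "(\<Sum>i<Suc (Suc m). d (g (u' i)) (g (u' (Suc i)))) \<in> L t"
        unfolding L_def
      proof (rule CollectI, rule exI[of _ "Suc (Suc m)"], rule exI[of _ u'], intro conjI allI impI)
        show "u' i \<in> {0..t}" for i using u(2) st by (auto simp: u'_def)
        show "u' i \<le> u' (Suc i)" if "i < Suc (Suc m)" for i
          using u(2,3) st that by (auto simp: u'_def less_Suc_eq le_less)
      qed simp
      then have "l + d (g (u m)) (g s) + d (g s) (g t) \<le> Sup (L t)"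
        using cSup_upper[OF _ bdd[OF st(3)]] unfolding eq by blast
      then show ?thesis using d[of "g (u m)" "g s"] by simp
    qed
    then have "Sup (L s) \<le> Sup (L t) - d (g s) (g t)" using z[OF st(1)] by (intro cSup_least) auto
    then show "d (g s) (g t) \<le> Sup (L t) - Sup (L s)" by simp
  qed
  moreover have "Sup (L 1) - Sup (L 0) \<le> path_len d g"
  proof -
    have "0 \<le> Sup (L 0)" using cSup_upper[OF z bdd] by simp
    moreover have "L 1 = polygonal_lengths d g" unfolding L_def polygonal_lengths_def by simp
    ultimately show ?thesis by (simp add: path_len_def)
  qed
  ultimately show ?thesis by (rule that)
qed

lemma ctl_join:
  assumes g: "ctl d g \<phi>" and h: "ctl d h \<psi>" and e: "g 1 = h 0" and tri: "\<And>x y z. d x z \<le> d x y + d y z"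
  obtains \<omega> where "ctl d (g +++ h) \<omega>" "\<omega> 1 - \<omega> 0 = (\<phi> 1 - \<phi> 0) + (\<psi> 1 - \<psi> 0)"
proof -
  define \<omega> where "\<omega> t = (if t \<le> 1 / 2 then \<phi> (2 * t) else \<phi> 1 - \<psi> 0 + \<psi> (2 * t - 1))" for t :: real
  have "ctl d (g +++ h) \<omega>"
    unfolding ctl_def
  proof (intro allI impI)
    fix s t :: real assume st: "0 \<le> s" "s \<le> t" "t \<le> 1"
    consider "t \<le> 1 / 2" | "s \<le> 1 / 2" "\<not> t \<le> 1 / 2" | "\<not> s \<le> 1 / 2" by linarith
    then show "d ((g +++ h) s) ((g +++ h) t) \<le> \<omega> t - \<omega> s"
    proof cases
      case 1
      then show ?thesis using st ctlD[OF g, of "2 * s" "2 * t"] by (simp add: joinpaths_def \<omega>_def)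
    next
      case 2
      have "d (g (2 * s)) (h (2 * t - 1)) \<le> d (g (2 * s)) (g 1) + d (h 0) (h (2 * t - 1))"
        using tri e by metis
      then show ?thesis using 2 st ctlD[OF g, of "2 * s" 1] ctlD[OF h, of 0 "2 * t - 1"]
        by (simp add: joinpaths_def \<omega>_def)
    next
      case 3
      then show ?thesis using st ctlD[OF h, of "2 * s - 1" "2 * t - 1"] by (simp add: joinpaths_def \<omega>_def)
    qed
  qed
  then show ?thesis by (rule that) (simp add: \<omega>_def)
qed

lemma ctl_reverse:
  assumes "ctl d g \<phi>" and sym: "\<And>x y. d x y = d y x"
  shows "ctl d (reversepath g) (\<lambda>t. - \<phi> (1 - t))"
  unfolding ctl_def
proof (intro allI impI)
  fix s t :: real assume "0 \<le> s" "s \<le> t" "t \<le> 1"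
  then have "d (g (1 - t)) (g (1 - s)) \<le> \<phi> (1 - s) - \<phi> (1 - t)" using ctlD[OF assms(1), of "1 - t" "1 - s"] by simp
  then show "d (reversepath g s) (reversepath g t) \<le> - \<phi> (1 - t) - - \<phi> (1 - s)"
    by (simp add: reversepath_def sym[of "g (1 - s)"])
qed

lemma ctl_piece:
  assumes "ctl d g \<phi>" "0 \<le> a" "a \<le> b" "b \<le> 1"
  obtains \<psi> where "ctl d (piece g a b) \<psi>" "\<psi> 1 - \<psi> 0 = \<phi> b - \<phi> a"
proof -
  let ?f = "\<lambda>x. (1 - x) * a + x * b"
  have "ctl d (piece g a b) (\<lambda>t. \<phi> (?f t))"
    unfolding ctl_def piece_def o_def
  proof (intro allI impI)
    fix s t :: real assume st: "0 \<le> s" "s \<le> t" "t \<le> 1"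
    have "s * (b - a) \<le> t * (b - a)" using st assms by (intro mult_right_mono) auto
    then have "?f s \<le> ?f t" by (simp add: algebra_simps)
    moreover have "?f s \<in> {0..1}" "?f t \<in> {0..1}" using piece_arg(2)[OF assms(2-4)] st by auto
    ultimately show "d (g (?f s)) (g (?f t)) \<le> \<phi> (?f t) - \<phi> (?f s)" using ctlD[OF assms(1)] by simp
  qed
  then show ?thesis by (rule that) simp
qed

lemma cube_dist_nonneg: "0 \<le> cube_dist V x y" by (simp add: cube_dist_def)

lemma cube_dist_self [simp]: "cube_dist V x x = 0" by (simp add: cube_dist_def L2_set_def)

lemma cube_dist_sym: "cube_dist V x y = cube_dist V y x"
  by (simp add: cube_dist_def L2_set_def power2_commute)

lemma cube_dist_tri: "cube_dist V x z \<le> cube_dist V x y + cube_dist V y z"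
proof -
  have "L2_set (\<lambda>v. x v - z v) V = L2_set (\<lambda>v. (x v - y v) + (y v - z v)) V" by simp
  also have "\<dots> \<le> L2_set (\<lambda>v. x v - y v) V + L2_set (\<lambda>v. y v - z v) V" by (rule L2_set_triangle_ineq)
  finally show ?thesis by (simp add: cube_dist_def add_divide_distrib[symmetric] divide_right_mono)
qed

lemma cube_dist_coord: "finite V \<Longrightarrow> v \<in> V \<Longrightarrow> \<bar>x v - y v\<bar> \<le> sqrt 2 * cube_dist V x y"
proof -
  assume "finite V" "v \<in> V"
  then have "\<bar>x v - y v\<bar>\<^sup>2 \<le> (\<Sum>v\<in>V. (x v - y v)\<^sup>2)"
    by (simp add: member_le_sum[of v V "\<lambda>v. (x v - y v)\<^sup>2"])
  then have "\<bar>x v - y v\<bar> \<le> L2_set (\<lambda>v. x v - y v) V" unfolding L2_set_def using real_le_rsqrt by blast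
  then show ?thesis by (simp add: cube_dist_def)
qed

lemma cube_dist_le_card:
  assumes "finite V" "\<And>v. v \<in> V \<Longrightarrow> \<bar>x v - y v\<bar> \<le> 1"
  shows "cube_dist V x y \<le> card V"
proof -
  have "L2_set (\<lambda>v. x v - y v) V \<le> (\<Sum>v\<in>V. \<bar>x v - y v\<bar>)" by (rule L2_set_le_sum_abs)
  also have "\<dots> \<le> (\<Sum>v\<in>V. 1)" using assms(2) by (intro sum_mono)
  finally have "L2_set (\<lambda>v. x v - y v) V \<le> card V" by simp
  moreover have "L2_set (\<lambda>v. x v - y v) V / sqrt 2 \<le> L2_set (\<lambda>v. x v - y v) V"
    using mult_left_mono[of 1 "sqrt 2" "L2_set (\<lambda>v. x v - y v) V"] L2_set_nonneg[of "\<lambda>v. x v - y v" V]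
    by (simp add: divide_le_eq)
  ultimately show ?thesis unfolding cube_dist_def by linarith
qed

lemma ctl_seg: "ctl (cube_dist V) (seg x y) (\<lambda>t. cube_dist V x y * t)"
  unfolding ctl_def
proof (intro allI impI)
  fix s t :: real assume st: "0 \<le> s" "s \<le> t" "t \<le> 1"
  have "L2_set (\<lambda>v. seg x y s v - seg x y t v) V = L2_set (\<lambda>v. (t - s) * (x v - y v)) V"
    by (simp add: seg_def algebra_simps)
  also have "\<dots> = (t - s) * L2_set (\<lambda>v. x v - y v) V"
    using st by (intro L2_set_right_distrib[symmetric]) simp
  finally have "cube_dist V (seg x y s) (seg x y t) = (t - s) * cube_dist V x y"
    by (simp add: cube_dist_def)
  then show "cube_dist V (seg x y s) (seg x y t) \<le> cube_dist V x y * t - cube_dist V x y * s"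
    by (simp add: algebra_simps)
qed

lemma ctl_cst: "ctl (cube_dist V) (cst x) (\<lambda>_. 0)"
  by (simp add: ctl_def cst_app)

definition cls :: "'p::topological_space set \<Rightarrow> (real \<Rightarrow> 'p) \<Rightarrow> (real \<Rightarrow> 'p) set" where
  "cls S p = {q. homotopic_paths S p q}"

lemma universal_cover_cls: "P \<in> universal_cover S x0 \<longleftrightarrow> (\<exists>p y. pth S p x0 y \<and> P = cls S p)"
  unfolding universal_cover_def cls_def pth_def by blast

lemma cls_eq: "homotopic_paths S p q \<Longrightarrow> cls S p = cls S q"
proof -
  assume h: "homotopic_paths S p q"
  have "homotopic_paths S p r \<longleftrightarrow> homotopic_paths S q r" for r
    using homotopic_paths_trans[OF h] homotopic_paths_trans[OF homotopic_paths_sym[OF h]] by blast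
  then show ?thesis by (simp add: cls_def)
qed

text \<open>The lift of \<open>g\<close> that starts at the class of \<open>p\<close> ends at the
  class of \<open>q\<close>.\<close>

definition links :: "'p::topological_space set \<Rightarrow> (real \<Rightarrow> 'p) \<Rightarrow> (real \<Rightarrow> 'p) \<Rightarrow> (real \<Rightarrow> 'p) \<Rightarrow> bool" where
  "links S p g q \<longleftrightarrow> pth S g (pathfinish p) (pathfinish q) \<and> homotopic_paths S (p +++ g) q"

text \<open>The class of \<open>p +++ g\<close> depends on the class of \<open>p\<close> only, so
  fixed representatives may be used.\<close>

lemma cover_dist_alt:
  assumes p: "pth S p x0 y" and q: "pth S q x0 z"
  shows "universal_cover_dist d S (cls S p) (cls S q) = Inf {path_len d g | g. rectifiable d g \<and> links S p g q}"
proof -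
  have "(path g \<and> path_image g \<subseteq> S \<and> rectifiable d g \<and> (\<exists>p'\<in>cls S p. pathfinish p' = pathstart g \<and> p' +++ g \<in> cls S q))
      \<longleftrightarrow> rectifiable d g \<and> links S p g q" for g
  proof
    assume h: "path g \<and> path_image g \<subseteq> S \<and> rectifiable d g \<and> (\<exists>p'\<in>cls S p. pathfinish p' = pathstart g \<and> p' +++ g \<in> cls S q)"
    then obtain p' where p': "homotopic_paths S p p'" "pathfinish p' = pathstart g" "homotopic_paths S q (p' +++ g)"
      by (auto simp: cls_def)
    have g: "pth S g y z"
      using h p'(2) homotopic_paths_imp_pathfinish[OF p'(1)] homotopic_paths_imp_pathfinish[OF p'(3)] p q
      by (simp add: pth_def)
    have "homotopic_paths S (p +++ g) (p' +++ g)" by (rule hp_join[OF p'(1) hp_refl[OF g] p g])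
    from homotopic_paths_trans[OF this homotopic_paths_sym[OF p'(3)]]
    show "rectifiable d g \<and> links S p g q"
      using h g p q by (simp add: links_def pth_def)
  next
    assume h: "rectifiable d g \<and> links S p g q"
    then have "p \<in> cls S p" "pathfinish p = pathstart g" "p +++ g \<in> cls S q" "path g" "path_image g \<subseteq> S"
      using hp_refl[OF p] homotopic_paths_sym unfolding links_def cls_def pth_def by auto
    then show "path g \<and> path_image g \<subseteq> S \<and> rectifiable d g \<and> (\<exists>p'\<in>cls S p. pathfinish p' = pathstart g \<and> p' +++ g \<in> cls S q)"
      using h by blast
  qed
  then show ?thesis unfolding universal_cover_dist_def by simp
qed

lemma links_trans:
  assumes "pth S p x0 y" "links S p g q" "links S q h r"
  shows "links S p (g +++ h) r"
proof -
  have g: "pth S g y (pathfinish q)" and gq: "homotopic_paths S (p +++ g) q"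
    and h: "pth S h (pathfinish q) (pathfinish r)" and hr: "homotopic_paths S (q +++ h) r"
    using assms unfolding links_def pth_def by auto
  note pg = pth_join[OF assms(1) g]
  have "homotopic_paths S (p +++ (g +++ h)) ((p +++ g) +++ h)"
    by (rule homotopic_paths_sym[OF hp_assoc[OF assms(1) g h]])
  also have "homotopic_paths S \<dots> (q +++ h)" by (rule hp_join[OF gq hp_refl[OF h] pg h])
  also have "homotopic_paths S \<dots> r" by (rule hr)
  finally show ?thesis using pth_join[OF g h] assms(1) by (simp add: links_def pth_def)
qed

lemma links_sym:
  assumes "pth S p x0 y" "links S p g q"
  shows "links S q (reversepath g) p"
proof -
  have g: "pth S g y (pathfinish q)" and gq: "homotopic_paths S (p +++ g) q"
    using assms unfolding links_def pth_def by auto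
  note pg = pth_join[OF assms(1) g] and rg = pth_reverse[OF g]
  have yS: "y \<in> S" using pth_in(3)[OF assms(1)] .
  have "homotopic_paths S (q +++ reversepath g) ((p +++ g) +++ reversepath g)"
    by (rule homotopic_paths_sym[OF hp_join[OF gq hp_refl[OF rg] pg rg]])
  also have "homotopic_paths S \<dots> (p +++ (g +++ reversepath g))" by (rule hp_assoc[OF assms(1) g rg])
  also have "homotopic_paths S \<dots> (p +++ cst y)"
    by (rule hp_join[OF hp_refl[OF assms(1)] hp_rinv[OF g] assms(1) pth_join[OF g rg]])
  also have "homotopic_paths S \<dots> p" by (rule hp_rid[OF assms(1)])
  finally show ?thesis using rg assms(1) by (simp add: links_def pth_def)
qed

section \<open>Hyperbolicity of the universal cover\<close>

context coupled
begin

section \<open>Comparison of path length and word length\<close>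

abbreviation dS :: "('u \<Rightarrow> real) \<Rightarrow> ('u \<Rightarrow> real) \<Rightarrow> real" where "dS \<equiv> cube_dist U"

abbreviation ucd :: "(real \<Rightarrow> 'u \<Rightarrow> real) set \<Rightarrow> (real \<Rightarrow> 'u \<Rightarrow> real) set \<Rightarrow> real" where
  "ucd \<equiv> universal_cover_dist dS S"

lemma S_le1: "x \<in> S \<Longrightarrow> v \<in> U \<Longrightarrow> x v \<le> 1"
proof -
  assume x: "x \<in> S" and v: "v \<in> U"
  have "x v \<le> (\<Sum>u\<in>{u\<in>U. col u = col v}. x u)"
    using x v finU by (intro member_le_sum) (auto simp: S_def)
  also have "\<dots> = 1" using x col_range[OF v] by (simp add: S_def)
  finally show ?thesis .
qed

lemma dS_le: "x \<in> S \<Longrightarrow> y \<in> S \<Longrightarrow> dS x y \<le> card U"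
proof (rule cube_dist_le_card[OF finU])
  fix v assume h: "x \<in> S" "y \<in> S" "v \<in> U"
  have "0 \<le> x v" "0 \<le> y v" using h by (simp_all add: S_def)
  then show "\<bar>x v - y v\<bar> \<le> 1" using S_le1[OF h(1,3)] S_le1[OF h(2,3)] by linarith
qed

lemma ctl_rp:
  assumes "vpath a w"
  shows "\<exists>\<phi>. ctl dS (rp a w) \<phi> \<and> \<phi> 1 - \<phi> 0 \<le> card U * real (length w)"
  using assms
proof (induction w arbitrary: a)
  case Nil
  then show ?case using ctl_cst[of U "pt a"] by (intro exI[of _ "\<lambda>_. 0"]) simp
next
  case (Cons e w)
  then have h: "vertex a" "edge_at a e" "vpath (mv a e) w" by auto
  obtain \<phi> where \<phi>: "ctl dS (rp (mv a e) w) \<phi>" "\<phi> 1 - \<phi> 0 \<le> card U * real (length w)"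
    using Cons.IH[OF h(3)] by blast
  have "seg (pt a) (pt (mv a e)) 1 = rp (mv a e) w 0" using pth_ends[OF rp_pth[OF h(3)]] by simp
  then obtain \<psi> where \<psi>: "ctl dS (seg (pt a) (pt (mv a e)) +++ rp (mv a e) w) \<psi>"
    "\<psi> 1 - \<psi> 0 = (dS (pt a) (pt (mv a e)) * 1 - dS (pt a) (pt (mv a e)) * 0) + (\<phi> 1 - \<phi> 0)"
    by (rule ctl_join[OF ctl_seg \<phi>(1) _ cube_dist_tri])
  have "dS (pt a) (pt (mv a e)) \<le> card U" using dS_le pt_S(1) h edge_step(1) by blast
  then have "\<psi> 1 - \<psi> 0 \<le> card U * real (length (e # w))" using \<psi>(2) \<phi>(2) by (simp add: algebra_simps)
  then show ?case using \<psi>(1) by (intro exI[of _ \<psi>]) simp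
qed

lemma floor_group:
  fixes x y :: real
  assumes "0 \<le> x" "0 \<le> y" "nat \<lfloor>4 * x\<rfloor> = nat \<lfloor>4 * y\<rfloor>"
  shows "\<bar>x - y\<bar> < 1 / 4"
proof -
  have "\<lfloor>4 * x\<rfloor> = \<lfloor>4 * y\<rfloor>" using assms by (simp add: eq_nat_nat_iff)
  then show ?thesis by linarith
qed

text \<open>Pieces along which the length stays within the same quarter are covered by one star, so the
  number of changes of star is at most four times the length.\<close>

lemma word_length:
  assumes g: "pth S g x y" and c: "ctl dS g \<phi>" and a: "vertex a" "x \<in> star a" and b: "vertex b" "y \<in> star b"
  obtains w where "Rep g a w b" "real (ln w) \<le> 4 * real n * (\<phi> 1 - \<phi> 0) + 2 * real n"
proof -
  have "continuous_on {0..1} g" using g by (simp add: pth_def path_def)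
  then obtain d where d: "0 < d" "\<And>s t v. s \<in> {0..1} \<Longrightarrow> t \<in> {0..1} \<Longrightarrow> dist s t < d \<Longrightarrow> v \<in> U \<Longrightarrow> \<bar>g s v - g t v\<bar> < 1 / 8"
    using dyadic_fine[OF compact_Icc, of 0 1 g "1 / 8"] by auto
  obtain m where m: "1 / 2 ^ m < d" using dyadic_below d(1) by blast
  let ?N = "2 ^ m :: nat"
  define t where "t i = real i / 2 ^ m" for i :: nat
  \<comment> \<open>\<open>q i\<close> numbers the quarter of length reached at the
    \<open>i\<close>-th division point, and \<open>f i\<close> is the first index in the same
    quarter. All pieces of a quarter use the vertex near \<open>g (t (f i))\<close>, so the vertex
    changes only between quarters.\<close>
  define q where "q i = nat \<lfloor>4 * (\<phi> (t i) - \<phi> 0)\<rfloor>" for i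
  define f where "f i = (LEAST j. q j = q i)" for i
  define v where "v i = nv (g (t (f i)))" for i
  have t01: "t i \<in> {0..1}" if "i \<le> ?N" for i using that by (simp add: t_def)
  have tm: "t i \<le> t j" if "i \<le> j" for i j using that by (simp add: t_def divide_right_mono)
  have f: "f i \<le> i" "q (f i) = q i" for i unfolding f_def by (rule Least_le, simp, rule LeastI) simp
  have \<phi>m: "\<phi> s \<le> \<phi> u" if "0 \<le> s" "s \<le> u" "u \<le> 1" for s u
    using ctlD[OF c that] cube_dist_nonneg[of U "g s" "g u"] by linarith
  have qm: "q i \<le> q j" if "i \<le> j" "j \<le> ?N" for i j
    unfolding q_def using \<phi>m[of "t i" "t j"] t01[of i] t01[of j] tm[of i j] that by (intro nat_mono floor_mono) auto
  have gS: "g s \<in> S" if "s \<in> {0..1}" for s using pth_in(1)[OF g that] .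
  have sub: "Sub m g (\<lambda>j. if j = 0 then a else if j = Suc ?N then b else v (j - 1))"
  proof (rule Sub_from_fine[OF g a b])
    fix i :: nat assume i: "i < ?N"
    have fi: "t (f i) \<in> {0..1}" "t i \<in> {0..1}" using t01 f(1)[of i] i by auto
    show "vertex (v i)" unfolding v_def using nv_vertex gS fi by blast
    fix s assume s: "real i / 2 ^ m \<le> s" "s \<le> real (Suc i) / 2 ^ m"
    have s1: "s \<in> {0..1}" using dyadic_unit[OF i s] .
    have "s - t i \<le> 1 / 2 ^ m" using s(2) by (simp add: t_def add_divide_distrib)
    then have ds: "dist (t i) s < d" using s(1) m by (simp add: dist_real_def t_def)
    have "\<bar>(\<phi> (t (f i)) - \<phi> 0) - (\<phi> (t i) - \<phi> 0)\<bar> < 1 / 4"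
      using floor_group[of "\<phi> (t (f i)) - \<phi> 0" "\<phi> (t i) - \<phi> 0"] f(2)[of i] \<phi>m[of 0 "t (f i)"] \<phi>m[of 0 "t i"] fi
      unfolding q_def by auto
    moreover have "dS (g (t (f i))) (g (t i)) \<le> \<phi> (t i) - \<phi> (t (f i))"
      using ctlD[OF c] tm[OF f(1)[of i]] fi by simp
    ultimately have D: "dS (g (t (f i))) (g (t i)) \<le> 1 / 4" by linarith
    show "g s \<in> star (v i)"
      unfolding v_def
    proof (rule nv_near[OF gS[OF fi(1)] gS[OF s1]])
      fix u assume u: "u \<in> U"
      have "\<bar>g (t (f i)) u - g (t i) u\<bar> \<le> sqrt 2 * dS (g (t (f i))) (g (t i))" by (rule cube_dist_coord[OF finU u])
      also have "\<dots> \<le> sqrt 2 * (1 / 4)" by (rule mult_left_mono[OF D]) simp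
      \<comment> \<open>\<open>3 / 8\<close> from the position within the quarter and strictly less
        than \<open>1 / 8\<close> from the fineness of the subdivision stay below the margin
        \<open>1 / 2\<close> of \<open>nv_near\<close>.\<close>
      also have "\<dots> \<le> 3 / 8"
      proof -
        have "sqrt 2 \<le> 3 / 2" by (rule real_le_lsqrt) (simp_all add: power2_eq_square)
        then show ?thesis by simp
      qed
      finally have "\<bar>g (t (f i)) u - g (t i) u\<bar> \<le> 3 / 8" .
      moreover have "\<bar>g (t i) u - g s u\<bar> < 1 / 8" by (rule d(2)[OF fi(2) s1 ds u])
      ultimately show "\<bar>g (t (f i)) u - g s u\<bar> < 1 / 2" by linarith
    qed
  qed
  define V where "V j = (if j = 0 then a else if j = Suc ?N then b else v (j - 1))" for j
  have sub: "Sub m g V" using sub unfolding V_def .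
  have vx: "vertex (V i)" if "i \<le> Suc ?N" for i using sub that by (simp add: Sub_def)
  have cl: "cell (V i \<union> V (Suc i))" if "i \<le> ?N" for i
    using star_common[OF Sub_common(1)[OF sub that] Sub_common(2)[OF sub that]] vx that by simp
  have lt: "ln (tau (V i) (V (Suc i))) \<le> n" if "i \<le> ?N" for i
  proof -
    have "length (tau (V i) (V (Suc i))) \<le> n" by (rule tau(4)[OF vx vx cl]) (use that in simp_all)
    then show ?thesis using ln_le_length[of "tau (V i) (V (Suc i))"] by simp
  qed
  \<comment> \<open>A change of vertex costs at most \<open>n\<close> letters and happens only where
    \<open>q\<close> increases; the transition from \<open>a\<close> accounts for the other
    \<open>n\<close>.\<close>
  have bound: "ln (prodw V (Suc k)) \<le> n + n * q k" if "k < ?N" for k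
    using that
  proof (induction k)
    case 0 then show ?case using lt[of 0] by simp
  next
    case (Suc k)
    have V: "V (Suc k) = v k" "V (Suc (Suc k)) = v (Suc k)" using Suc.prems by (simp_all add: V_def)
    have p: "ln (prodw V (Suc (Suc k))) \<le> ln (prodw V (Suc k)) + ln (tau (v k) (v (Suc k)))"
      using ln_append[of "prodw V (Suc k)" "tau (v k) (v (Suc k))"] V by simp
    have IH: "ln (prodw V (Suc k)) \<le> n + n * q k" using Suc by simp
    show ?case
    proof (cases "q k = q (Suc k)")
      case True
      then have "v k = v (Suc k)" by (simp add: v_def f_def)
      moreover have "vertex (v k)" using vx[of "Suc k"] V Suc.prems by simp
      ultimately have "ln (tau (v k) (v (Suc k))) = 0" using ln_geq[OF tau_self] ln_le_length[of "[]"] by simp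
      then show ?thesis using p IH True by simp
    next
      case False
      then have "Suc (q k) \<le> q (Suc k)" using qm[of k "Suc k"] Suc.prems by simp
      then have "n + n * q k + n \<le> n + n * q (Suc k)"
        using mult_le_mono2[of "Suc (q k)" "q (Suc k)" n] by simp
      moreover have "ln (tau (v k) (v (Suc k))) \<le> n" using lt[of "Suc k"] V Suc.prems by simp
      ultimately show ?thesis using p IH by linarith
    qed
  qed
  obtain k where k: "?N = Suc k" by (metis nat.exhaust power_not_zero zero_neq_numeral)
  have "ln (pw m V) \<le> ln (prodw V ?N) + ln (tau (V ?N) (V (Suc ?N)))" by (simp add: ln_append)
  also have "\<dots> \<le> (n + n * q k) + n" using bound[of k] lt[of ?N] k by (intro add_mono) simp_all
  finally have "real (ln (pw m V)) \<le> real (n + n * q k + n)" by (rule of_nat_mono)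
  moreover have "real (q k) \<le> 4 * (\<phi> 1 - \<phi> 0)"
  proof -
    have "0 \<le> \<phi> (t k) - \<phi> 0" "\<phi> (t k) \<le> \<phi> 1" using \<phi>m[of 0 "t k"] \<phi>m[of "t k" 1] t01[of k] k by auto
    then have "real (q k) \<le> 4 * (\<phi> (t k) - \<phi> 0)" "4 * (\<phi> (t k) - \<phi> 0) \<le> 4 * (\<phi> 1 - \<phi> 0)"
      unfolding q_def by simp_all
    then show ?thesis by (rule order_trans)
  qed
  then have "real n * real (q k) \<le> real n * (4 * (\<phi> 1 - \<phi> 0))" by (intro mult_left_mono) auto
  ultimately have "real (ln (pw m V)) \<le> 4 * real n * (\<phi> 1 - \<phi> 0) + 2 * real n" by (simp add: algebra_simps)
  moreover have "Rep g a (pw m V) b"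
    unfolding Rep_def by (intro exI[of _ m] exI[of _ V] conjI sub geq_refl) (simp_all add: V_def)
  ultimately show ?thesis using that by blast
qed

lemma nearly_shortest:
  assumes p: "pth S p x0 y" and q: "pth S q x0 z" and l: "links S p h q" "rectifiable dS h" and e: "0 < e"
  obtains g \<phi> where "links S p g q" "ctl dS g \<phi>" "\<phi> 1 - \<phi> 0 \<le> ucd (cls S p) (cls S q) + e"
proof -
  let ?A = "{path_len dS g | g. rectifiable dS g \<and> links S p g q}"
  have lt: "Inf ?A < Inf ?A + e" using e by simp
  have "?A \<noteq> {}" using l by blast
  from cInf_lessD[OF this lt] obtain g where g: "rectifiable dS g" "links S p g q" "path_len dS g < Inf ?A + e"
    by auto
  obtain \<phi> where "ctl dS g \<phi>" "\<phi> 1 - \<phi> 0 \<le> path_len dS g" by (rule rect_ctl[OF g(1) cube_dist_nonneg])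
  then show ?thesis using that[OF g(2)] g(3) cover_dist_alt[OF p q, of dS] by simp
qed

lemma ucd_le:
  assumes p: "pth S p x0 y" and q: "pth S q x0 z" and l: "links S p g q" "ctl dS g \<phi>"
  shows "ucd (cls S p) (cls S q) \<le> \<phi> 1 - \<phi> 0"
proof -
  let ?A = "{path_len dS g | g. rectifiable dS g \<and> links S p g q}"
  have "0 \<le> path_len dS h" if "rectifiable dS h" for h
    using that cSup_upper[OF poly_nonempty] unfolding rectifiable_def path_len_def by blast
  then have "bdd_below ?A" by (intro bdd_belowI[of _ 0]) blast
  moreover have "path_len dS g \<in> ?A" using ctl_len(1)[OF l(2) cube_dist_nonneg] l(1) by blast
  ultimately have "Inf ?A \<le> path_len dS g" by (rule cInf_lower[rotated])
  then show ?thesis using ctl_len(2)[OF l(2) cube_dist_nonneg] cover_dist_alt[OF p q, of dS] by simp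
qed

section \<open>The universal cover at a base point\<close>

context
  fixes x0 :: "'u \<Rightarrow> real"
  assumes x0: "x0 \<in> S"
begin

abbreviation v0 :: "'u set" where "v0 \<equiv> nv x0"

definition represents :: "(real \<Rightarrow> 'u \<Rightarrow> real) set \<Rightarrow> 'u set list \<Rightarrow> bool" where
  "represents P w \<longleftrightarrow> vpath v0 w \<and> (\<exists>p y. pth S p x0 y \<and> P = cls S p \<and> Rep p v0 w (nv y) \<and> endp v0 w = nv y)"

definition word :: "(real \<Rightarrow> 'u \<Rightarrow> real) set \<Rightarrow> 'u set list" where "word P = (SOME w. represents P w)"

lemma cls_in: "pth S p x0 y \<Longrightarrow> cls S p \<in> universal_cover S x0"
  unfolding universal_cover_cls by blast

text \<open>The word is chosen for some representative of the class; \<open>Rep_homotopic\<close>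
  transfers it to \<open>p\<close>.\<close>

lemma word_cls:
  assumes p: "pth S p x0 y"
  shows "vpath v0 (word (cls S p))" "Rep p v0 (word (cls S p)) (nv y)" "endp v0 (word (cls S p)) = nv y"
proof -
  have y: "y \<in> S" using pth_in(3)[OF p] .
  obtain w where "Rep p v0 w (nv y)" "vpath v0 w" "endp v0 w = nv y"
    by (rule Rep_exists[OF p nv_vertex[OF x0] nv_star[OF x0] nv_vertex[OF y] nv_star[OF y]])
  then have "represents (cls S p) w" unfolding represents_def using p by blast
  then have r: "represents (cls S p) (word (cls S p))" unfolding word_def by (rule someI)
  then obtain q z where q: "pth S q x0 z" "cls S p = cls S q" "Rep q v0 (word (cls S p)) (nv z)"
    "endp v0 (word (cls S p)) = nv z" unfolding represents_def by blast
  have "p \<in> cls S p" using hp_refl[OF p] by (simp add: cls_def)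
  then have "p \<in> cls S q" by (rule subst[OF q(2)])
  then have h: "homotopic_paths S q p" by (simp add: cls_def)
  then have "z = y" using homotopic_paths_imp_pathfinish[OF h] p q(1) by (simp add: pth_def)
  then show "vpath v0 (word (cls S p))" "Rep p v0 (word (cls S p)) (nv y)" "endp v0 (word (cls S p)) = nv y"
    using r q Rep_homotopic[OF h] unfolding represents_def by simp_all
qed

lemma word_valid: "P \<in> universal_cover S x0 \<Longrightarrow> vpath v0 (word P)"
  using word_cls(1) unfolding universal_cover_cls by blast

text \<open>Every valid edge path is, up to \<open>geq\<close>, the word of a class. Medians and
  geodesic points found among words can thus be pulled back to the cover.\<close>

lemma realize:
  assumes u: "vpath v0 u"
  obtains P where "P \<in> universal_cover S x0" "geq (word P) u"
proof -
  let ?r = "seg x0 (pt v0) +++ rp v0 u" and ?b = "endp v0 u"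
  note v = nv_vertex[OF x0] and st = nv_star[OF x0]
  note sp = star_seg_pth(1)[OF v st]
  have r: "pth S ?r x0 (pt ?b)" by (rule pth_join[OF sp rp_pth[OF u]])
  have vb: "vertex ?b" using vpath_end[OF u] .
  have "seg x0 (pt v0) t \<in> star v0" if "t \<in> {0..1}" for t
  proof -
    have "0 < seg x0 (pt v0) t s" if s: "s \<in> v0" for s
    proof (cases "t = 0")
      case False
      have "0 < x0 s" "pt v0 s = 1" using s st by (simp_all add: star_def pt_def)
      then show ?thesis using \<open>t \<in> {0..1}\<close> False by (auto simp: seg_def intro!: add_nonneg_pos)
    qed (use s st in \<open>simp add: star_def\<close>)
    then show ?thesis using pth_in(1)[OF sp that] by (simp add: star_def)
  qed
  then have "Rep (seg x0 (pt v0)) v0 (tau v0 v0 @ tau v0 v0) v0"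
    by (intro Rep_in_star v) (simp_all add: st pt_S v)
  moreover have "geq (tau v0 v0 @ tau v0 v0) ([] @ [])" by (intro geq_append tau_self v)
  ultimately have "Rep (seg x0 (pt v0)) v0 ([] @ []) v0" by (rule Rep_geq)
  then have "Rep ?r v0 (([] @ []) @ u) ?b"
    by (rule Rep_join[OF _ Rep_rp[OF u]]) (use pth_ends[OF rp_pth[OF u]] in simp)
  then have R: "Rep ?r v0 u ?b" by simp
  have "nv (pt ?b) = ?b" using star_pt[OF vb nv_vertex nv_star] pt_S[OF vb] by blast
  then have "geq (word (cls S ?r)) u" using Rep_unique[OF word_cls(2)[OF r]] R by simp
  then show ?thesis using that cls_in[OF r] by blast
qed

text \<open>The word of \<open>q\<close> is that of \<open>p\<close> followed by that of
  \<open>g\<close>, so by left invariance only the latter counts.\<close>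

lemma links_word:
  assumes p: "pth S p x0 y" and q: "pth S q x0 z" and l: "links S p g q" and w: "Rep g (nv y) w (nv z)"
  shows "wd (word (cls S p)) (word (cls S q)) = ln w"
proof -
  have g: "pth S g y z" and h: "homotopic_paths S (p +++ g) q" using l p q by (auto simp: links_def pth_def)
  have "Rep (p +++ g) v0 (word (cls S p) @ w) (nv z)"
    by (rule Rep_join[OF word_cls(2)[OF p] w]) (use pth_ends[OF p] pth_ends[OF g] in simp)
  then have "Rep q v0 (word (cls S p) @ w) (nv z)" by (rule Rep_homotopic[OF h])
  then have "geq (word (cls S q)) (word (cls S p) @ w)" by (rule Rep_unique[OF word_cls(2)[OF q]])
  then have "wd (word (cls S p)) (word (cls S q)) = wd (word (cls S p) @ []) (word (cls S p) @ w)"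
    using wd_geq[OF geq_refl] by simp
  also have "\<dots> = wd [] w" by (rule wd_translate)
  also have "\<dots> = ln w" by (simp add: wd_def)
  finally show ?thesis .
qed

text \<open>Realise the reduced difference of the two words; \<open>Rep_inj\<close> shows that this
  path really leads to the class of \<open>q\<close>. The segments between the end points and their
  vertices account for \<open>2 * card U\<close>. Besides an upper bound for \<open>ucd\<close>,
  this shows that the infimum in \<open>ucd\<close> runs over a non-empty set.\<close>

lemma links_exist:
  assumes p: "pth S p x0 y" and q: "pth S q x0 z"
  obtains g \<phi> where "links S p g q" "ctl dS g \<phi>"
    "\<phi> 1 - \<phi> 0 \<le> card U * real (wd (word (cls S p)) (word (cls S q))) + 2 * card U"
proof -
  let ?w = "word (cls S p)" and ?w' = "word (cls S q)"
  let ?W = "nf (rev ?w @ ?w')"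
  have y: "y \<in> S" and z: "z \<in> S" using pth_in(3)[OF p] pth_in(3)[OF q] by blast+
  let ?a = "nv y" and ?b = "nv z"
  note a = nv_vertex[OF y] nv_star[OF y] and b = nv_vertex[OF z] nv_star[OF z]
  have W: "vpath ?a ?W" "endp ?a ?W = ?b"
    using vpath_nf vpath_between[OF word_cls(1)[OF p] word_cls(1)[OF q]] word_cls(3)[OF p] word_cls(3)[OF q] by simp_all
  let ?A = "seg y (pt ?a)" and ?B = "rp ?a ?W" and ?C = "seg (pt ?b) z"
  note A = star_seg_pth(1)[OF a] and C = star_seg_pth(2)[OF b]
  have B: "pth S ?B (pt ?a) (pt ?b)" using rp_pth[OF W(1)] W(2) by simp
  let ?g = "?A +++ (?B +++ ?C)"
  have g: "pth S ?g y z" by (intro pth_join[OF A pth_join[OF B C]])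
  have inst: "seg x (pt v) t \<in> star v" "seg (pt v) x t \<in> star v" if "vertex v" "x \<in> star v" "t \<in> {0..1}" for x v t
  proof -
    have pos: "0 < seg x (pt v) t s" "0 < seg (pt v) x t s" if s: "s \<in> v" for s
    proof -
      have "0 < x s" "pt v s = 1" using s \<open>x \<in> star v\<close> by (simp_all add: star_def pt_def)
      then show "0 < seg x (pt v) t s" using \<open>t \<in> {0..1}\<close>
        by (cases "t = 0") (auto simp: seg_def intro!: add_nonneg_pos)
      show "0 < seg (pt v) x t s" using \<open>t \<in> {0..1}\<close> \<open>0 < x s\<close> \<open>pt v s = 1\<close>
        by (cases "t = 1") (auto simp: seg_def intro!: add_pos_nonneg)
    qed
    then show "seg x (pt v) t \<in> star v" "seg (pt v) x t \<in> star v"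
      using pth_in(1)[OF star_seg_pth(1)[OF that(1,2)] that(3)] pth_in(1)[OF star_seg_pth(2)[OF that(1,2)] that(3)]
      by (simp_all add: star_def)
  qed
  have triv: "geq (tau v v @ tau v v) ([] @ [])" if "vertex v" for v
    by (intro geq_append tau_self that)
  have RA: "Rep ?A ?a ([] @ []) ?a"
    by (rule Rep_geq[OF Rep_in_star[OF a(1) a(1) a(1)] triv[OF a(1)]]) (simp_all add: a pt_S inst)
  have RC: "Rep ?C ?b ([] @ []) ?b"
    by (rule Rep_geq[OF Rep_in_star[OF b(1) b(1) b(1)] triv[OF b(1)]]) (simp_all add: b pt_S inst)
  have RB: "Rep ?B ?a ?W ?b" using Rep_rp[OF W(1)] W(2) by simp
  have "Rep (?B +++ ?C) ?a (?W @ ([] @ [])) ?b"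
    by (rule Rep_join[OF RB RC]) (use pth_ends[OF B] in simp)
  then have "Rep ?g ?a (([] @ []) @ (?W @ ([] @ []))) ?b"
    by (rule Rep_join[OF RA]) (use pth_ends(1)[OF pth_join[OF B C]] in simp)
  then have Rg: "Rep ?g ?a ?W ?b" by simp
  have "Rep (p +++ ?g) v0 (?w @ ?W) ?b"
    by (rule Rep_join[OF word_cls(2)[OF p] Rg]) (use pth_ends(2)[OF p] pth_ends(1)[OF g] in simp)
  moreover have "geq (?w @ ?W) ?w'"
    using geq_trans[OF geq_append[OF geq_refl geq_nf] geq_cancel_left(2)] .
  ultimately have "Rep (p +++ ?g) v0 ?w' ?b" by (rule Rep_geq)
  then have "homotopic_paths S (p +++ ?g) q"
    by (rule Rep_inj[OF pth_join[OF p g] _ q word_cls(2)[OF q]])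
  then have l: "links S p ?g q" using g p q by (simp add: links_def pth_def)
  obtain \<phi> where \<phi>: "ctl dS ?B \<phi>" "\<phi> 1 - \<phi> 0 \<le> card U * real (length ?W)" using ctl_rp[OF W(1)] by blast
  have "?B 1 = ?C 0" using pth_ends[OF B] by simp
  then obtain \<psi> where \<psi>: "ctl dS (?B +++ ?C) \<psi>" "\<psi> 1 - \<psi> 0 = (\<phi> 1 - \<phi> 0) + (dS (pt ?b) z * 1 - dS (pt ?b) z * 0)"
    by (rule ctl_join[OF \<phi>(1) ctl_seg _ cube_dist_tri])
  have "?A 1 = (?B +++ ?C) 0" using pth_ends[OF pth_join[OF B C]] by simp
  then obtain \<omega> where \<omega>: "ctl dS ?g \<omega>" "\<omega> 1 - \<omega> 0 = (dS y (pt ?a) * 1 - dS y (pt ?a) * 0) + (\<psi> 1 - \<psi> 0)"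
    by (rule ctl_join[OF ctl_seg \<psi>(1) _ cube_dist_tri])
  have "dS y (pt ?a) \<le> card U" "dS (pt ?b) z \<le> card U" using dS_le y z pt_S(1) a(1) b(1) by blast+
  then have "\<omega> 1 - \<omega> 0 \<le> card U * real (length ?W) + 2 * card U" using \<omega>(2) \<psi>(2) \<phi>(2) by simp
  moreover have "length ?W = wd ?w ?w'" by (simp add: wd_def ln_def)
  ultimately show ?thesis using that[OF l \<omega>(1)] by simp
qed

lemma ucd_approx:
  assumes p: "pth S p x0 y" and q: "pth S q x0 z" and e: "0 < e"
  obtains g \<phi> where "links S p g q" "ctl dS g \<phi>" "\<phi> 1 - \<phi> 0 \<le> ucd (cls S p) (cls S q) + e"
proof -
  obtain h \<psi> where h: "links S p h q" "ctl dS h \<psi>" by (rule links_exist[OF p q])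
  show ?thesis by (rule nearly_shortest[OF p q h(1) ctl_len(1)[OF h(2) cube_dist_nonneg] e]) (rule that)
qed

lemma ucd_nonneg:
  assumes p: "pth S p x0 y" and q: "pth S q x0 z"
  shows "0 \<le> ucd (cls S p) (cls S q)"
proof (rule field_le_epsilon)
  fix e :: real assume "0 < e"
  then obtain g \<phi> where "ctl dS g \<phi>" "\<phi> 1 - \<phi> 0 \<le> ucd (cls S p) (cls S q) + e" by (rule ucd_approx[OF p q])
  then show "0 \<le> ucd (cls S p) (cls S q) + e" using ctl_len(3)[of dS g \<phi>] cube_dist_nonneg by fastforce
qed

lemma ucd_self:
  assumes p: "pth S p x0 y"
  shows "ucd (cls S p) (cls S p) = 0"
proof -
  have "links S p (cst y) p"
    using hp_rid[OF p] pth_cst[OF pth_in(3)[OF p]] p by (simp add: links_def pth_def)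
  then have "ucd (cls S p) (cls S p) \<le> 0 - 0" by (rule ucd_le[OF p p _ ctl_cst])
  then show ?thesis using ucd_nonneg[OF p p] by simp
qed

lemma ucd_sym_le:
  assumes p: "pth S p x0 y" and q: "pth S q x0 z"
  shows "ucd (cls S q) (cls S p) \<le> ucd (cls S p) (cls S q)"
proof (rule field_le_epsilon)
  fix e :: real assume "0 < e"
  then obtain g \<phi> where g: "links S p g q" "ctl dS g \<phi>" "\<phi> 1 - \<phi> 0 \<le> ucd (cls S p) (cls S q) + e"
    by (rule ucd_approx[OF p q])
  have "ucd (cls S q) (cls S p) \<le> - \<phi> (1 - 1) - - \<phi> (1 - 0)"
    by (rule ucd_le[OF q p links_sym[OF p g(1)] ctl_reverse[OF g(2) cube_dist_sym]])
  then show "ucd (cls S q) (cls S p) \<le> ucd (cls S p) (cls S q) + e" using g(3) by simp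
qed

lemma ucd_tri:
  assumes p: "pth S p x0 y" and q: "pth S q x0 z" and r: "pth S r x0 w"
  shows "ucd (cls S p) (cls S r) \<le> ucd (cls S p) (cls S q) + ucd (cls S q) (cls S r)"
proof (rule field_le_epsilon)
  fix e :: real assume "0 < e"
  then have e2: "0 < e / 2" by simp
  obtain g \<phi> where g: "links S p g q" "ctl dS g \<phi>" "\<phi> 1 - \<phi> 0 \<le> ucd (cls S p) (cls S q) + e / 2"
    by (rule ucd_approx[OF p q e2])
  obtain h \<psi> where h: "links S q h r" "ctl dS h \<psi>" "\<psi> 1 - \<psi> 0 \<le> ucd (cls S q) (cls S r) + e / 2"
    by (rule ucd_approx[OF q r e2])
  have "g 1 = h 0" using g(1) h(1) q unfolding links_def pth_def by (simp add: pathstart_def pathfinish_def)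
  then obtain \<omega> where w: "ctl dS (g +++ h) \<omega>" "\<omega> 1 - \<omega> 0 = (\<phi> 1 - \<phi> 0) + (\<psi> 1 - \<psi> 0)"
    by (rule ctl_join[OF g(2) h(2) _ cube_dist_tri])
  have "ucd (cls S p) (cls S r) \<le> \<omega> 1 - \<omega> 0" by (rule ucd_le[OF p r links_trans[OF p g(1) h(1)] w(1)])
  then show "ucd (cls S p) (cls S r) \<le> ucd (cls S p) (cls S q) + ucd (cls S q) (cls S r) + e" using g h w by simp
qed

text \<open>\<open>word_length\<close> for a path within 1 of the infimum; this 1 raises the
  constant from \<open>2 * real n\<close> to \<open>6 * real n\<close>.\<close>

lemma wd_le_ucd:
  assumes p: "pth S p x0 y" and q: "pth S q x0 z"
  shows "real (wd (word (cls S p)) (word (cls S q))) \<le> 4 * real n * ucd (cls S p) (cls S q) + 6 * real n"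
proof -
  have y: "y \<in> S" and z: "z \<in> S" using pth_in(3)[OF p] pth_in(3)[OF q] by blast+
  obtain g \<phi> where g: "links S p g q" "ctl dS g \<phi>" "\<phi> 1 - \<phi> 0 \<le> ucd (cls S p) (cls S q) + 1"
    by (rule ucd_approx[OF p q zero_less_one])
  have gp: "pth S g y z" using g(1) p q by (auto simp: links_def pth_def)
  obtain w where w: "Rep g (nv y) w (nv z)" "real (ln w) \<le> 4 * real n * (\<phi> 1 - \<phi> 0) + 2 * real n"
    by (rule word_length[OF gp g(2) nv_vertex[OF y] nv_star[OF y] nv_vertex[OF z] nv_star[OF z]])
  have "4 * real n * (\<phi> 1 - \<phi> 0) \<le> 4 * real n * (ucd (cls S p) (cls S q) + 1)" using g(3) by (intro mult_left_mono) auto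
  then show ?thesis using w(2) links_word[OF p q g(1) w(1)] by (simp add: algebra_simps)
qed

text \<open>The chain consists of the classes of \<open>p\<close> followed by initial stretches of a
  nearly shortest linking path. Each further piece lies in one star, so its word consists of two
  transitions, at most \<open>2 * n\<close> letters.\<close>

lemma ucd_chain:
  assumes p: "pth S p x0 y" and q: "pth S q x0 z"
  obtains m P where "P 0 = cls S p" "P m = cls S q" "\<forall>i\<le>m. P i \<in> universal_cover S x0"
    "(\<Sum>i<m. ucd (P i) (P (Suc i))) \<le> ucd (cls S p) (cls S q) + 1"
    "\<forall>i<m. wd (word (P i)) (word (P (Suc i))) \<le> 2 * n"
proof -
  obtain g \<phi> where l: "links S p g q" and c: "ctl dS g \<phi>" and len: "\<phi> 1 - \<phi> 0 \<le> ucd (cls S p) (cls S q) + 1"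
    by (rule ucd_approx[OF p q zero_less_one])
  have g: "pth S g y z" and gq: "homotopic_paths S (p +++ g) q" using l p q by (auto simp: links_def pth_def)
  have y: "y \<in> S" using pth_in(3)[OF p] .
  have z: "z \<in> S" using pth_in(3)[OF q] .
  obtain w where "Rep g (nv y) w (nv z)"
    by (rule Rep_exists[OF g nv_vertex[OF y] nv_star[OF y] nv_vertex[OF z] nv_star[OF z]])
  then obtain m v where v: "Sub m g v" unfolding Rep_def by blast
  let ?N = "2 ^ m :: nat"
  define t where "t i = real i / 2 ^ m" for i :: nat
  have tt: "0 \<le> t i" "t i \<le> t (Suc i)" for i by (simp_all add: t_def divide_right_mono)
  have t1: "t i \<le> 1" if "i \<le> ?N" for i using that by (simp add: t_def)
  define pp where "pp i = p +++ piece g 0 (t i)" for i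
  have g0: "g 0 = y" "g 1 = z" using pth_ends[OF g] by auto
  have P: "pth S (piece g 0 (t i)) y (g (t i))" if "i \<le> ?N" for i
    using piece_pth[OF g order.refl tt(1) t1[OF that]] g0 by simp
  have pp: "pth S (pp i) x0 (g (t i))" if "i \<le> ?N" for i unfolding pp_def by (rule pth_join[OF p P[OF that]])
  have step: "links S (pp i) (piece g (t i) (t (Suc i))) (pp (Suc i))"
    "pth S (piece g (t i) (t (Suc i))) (g (t i)) (g (t (Suc i)))" if i: "i < ?N" for i
  proof -
    have i': "i \<le> ?N" "Suc i \<le> ?N" using i by auto
    have s: "pth S (piece g (t i) (t (Suc i))) (g (t i)) (g (t (Suc i)))"
      by (rule piece_pth[OF g tt t1[OF i'(2)]])
    then show "pth S (piece g (t i) (t (Suc i))) (g (t i)) (g (t (Suc i)))" .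
    have "homotopic_paths S (pp i +++ piece g (t i) (t (Suc i))) (p +++ (piece g 0 (t i) +++ piece g (t i) (t (Suc i))))"
      unfolding pp_def by (rule hp_assoc[OF p P[OF i'(1)] s])
    also have "homotopic_paths S \<dots> (p +++ piece g 0 (t (Suc i)))"
      by (rule hp_join[OF hp_refl[OF p] homotopic_paths_sym[OF piece_join[OF g order.refl tt t1[OF i'(2)]]] p pth_join[OF P[OF i'(1)] s]])
    finally show "links S (pp i) (piece g (t i) (t (Suc i))) (pp (Suc i))"
      using s pp[OF i'(1)] pp[OF i'(2)] unfolding links_def pth_def pp_def by simp
  qed
  show ?thesis
  proof (rule that[of "\<lambda>i. cls S (pp i)" ?N])
    have "piece g 0 (t 0) = cst y" using g0 by (simp add: piece_def cst_def o_def t_def)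
    then show "cls S (pp 0) = cls S p" unfolding pp_def using cls_eq[OF hp_rid[OF p]] by simp
    show "cls S (pp ?N) = cls S q" unfolding pp_def using cls_eq[OF gq] piece_full[of g] by (simp add: t_def)
    show "\<forall>i\<le>?N. cls S (pp i) \<in> universal_cover S x0" using cls_in[OF pp] by blast
    have "ucd (cls S (pp i)) (cls S (pp (Suc i))) \<le> \<phi> (t (Suc i)) - \<phi> (t i)" if i: "i < ?N" for i
    proof -
      have i': "i \<le> ?N" "Suc i \<le> ?N" using i by auto
      obtain \<psi> where "ctl dS (piece g (t i) (t (Suc i))) \<psi>" "\<psi> 1 - \<psi> 0 = \<phi> (t (Suc i)) - \<phi> (t i)"
        by (rule ctl_piece[OF c tt t1[OF i'(2)]])
      then show ?thesis using ucd_le[OF pp[OF i'(1)] pp[OF i'(2)] step(1)[OF i]] by metis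
    qed
    then have "(\<Sum>i<?N. ucd (cls S (pp i)) (cls S (pp (Suc i)))) \<le> (\<Sum>i<?N. \<phi> (t (Suc i)) - \<phi> (t i))"
      by (intro sum_mono) auto
    also have "\<dots> = \<phi> (t ?N) - \<phi> (t 0)" by (rule sum_lessThan_telescope)
    also have "\<dots> = \<phi> 1 - \<phi> 0" by (simp add: t_def)
    finally show "(\<Sum>i<?N. ucd (cls S (pp i)) (cls S (pp (Suc i)))) \<le> ucd (cls S p) (cls S q) + 1" using len by simp
    show "\<forall>i<?N. wd (word (cls S (pp i))) (word (cls S (pp (Suc i)))) \<le> 2 * n"
    proof (intro allI impI)
      fix i assume i: "i < ?N"
      then have i': "i \<le> ?N" "Suc i \<le> ?N" by auto
      let ?a = "nv (g (t i))" and ?b = "nv (g (t (Suc i)))" and ?h = "piece g (t i) (t (Suc i))"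
      have S2: "g (t i) \<in> S" "g (t (Suc i)) \<in> S" using pth_in(3)[OF pp] i' by blast+
      have vv: "vertex (v (Suc i))" using v i unfolding Sub_def by simp
      have hst: "?h s \<in> star (v (Suc i))" if s: "s \<in> {0..1}" for s
      proof -
        have "(1 - s) * t i + s * t (Suc i) \<in> {t i..t (Suc i)}" by (rule piece_arg(1)[OF tt t1[OF i'(2)] s])
        then show ?thesis using v i unfolding Sub_def piece_def t_def by simp
      qed
      have h01: "?h 0 = g (t i)" "?h 1 = g (t (Suc i))" using pth_ends[OF step(2)[OF i]] by auto
      note A = nv_vertex[OF S2(1)] nv_star[OF S2(1)] and B = nv_vertex[OF S2(2)] nv_star[OF S2(2)]
      have R: "Rep ?h ?a (tau ?a (v (Suc i)) @ tau (v (Suc i)) ?b) ?b"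
        by (rule Rep_in_star[OF vv A(1) B(1)]) (simp_all add: h01 A B hst)
      have c1: "cell (?a \<union> v (Suc i))" using star_common[OF A(2) _ A(1)] hst[of 0] h01 by simp
      have c2: "cell (v (Suc i) \<union> ?b)" using star_common[OF _ B(2) vv] hst[of 1] h01 by simp
      have "ln (tau ?a (v (Suc i)) @ tau (v (Suc i)) ?b) \<le> 2 * n"
        using ln_le_length[of "tau ?a (v (Suc i)) @ tau (v (Suc i)) ?b"] tau(4)[OF A(1) vv c1] tau(4)[OF vv B(1) c2] by simp
      then show "wd (word (cls S (pp i))) (word (cls S (pp (Suc i)))) \<le> 2 * n"
        using links_word[OF pp[OF i'(1)] pp[OF i'(2)] step(1)[OF i] R] by simp
    qed
  qed
qed

theorem universal_cover_hyperbolic: "gromov_hyperbolic (universal_cover S x0) ucd"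
proof -
  let ?Y = "universal_cover S x0" and ?e = "\<lambda>P Q. real (wd (word P) (word Q))"
  \<comment> \<open>One constant for all coarse bounds: \<open>6 * real n\<close> covers
    \<open>wd_le_ucd\<close> and the steps of \<open>ucd_chain\<close>,
    \<open>2 * real (card U)\<close> covers \<open>links_exist\<close>, and the last summand gives
    \<open>1 \<le> ?C\<close>.\<close>
  let ?C = "6 * real n + 2 * real (card U) + 1"
  have ex: "\<exists>p y. pth S p x0 y \<and> P = cls S p" if "P \<in> ?Y" for P using that unfolding universal_cover_cls .
  interpret thin_median ?Y ucd ?e ?C "4 * real n"
  proof
    show "1 \<le> ?C" "0 \<le> 4 * real n" by simp_all
    fix P Q assume P: "P \<in> ?Y" and Q: "Q \<in> ?Y"
    obtain p y where p: "pth S p x0 y" "P = cls S p" using ex[OF P] by blast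
    obtain q z where q: "pth S q x0 z" "Q = cls S q" using ex[OF Q] by blast
    show "ucd P P = 0" using ucd_self[OF p(1)] p(2) by simp
    show nn: "0 \<le> ucd P Q" using ucd_nonneg[OF p(1) q(1)] p(2) q(2) by simp
    show "ucd P Q = ucd Q P" using ucd_sym_le[OF p(1) q(1)] ucd_sym_le[OF q(1) p(1)] p(2) q(2) by simp
    show "?e P P = 0" "0 \<le> ?e P Q" "?e P Q \<in> \<nat>" by simp_all
    show "?e P Q = ?e Q P" by (simp add: wd_sym)
    have "4 * real n * ucd P Q \<le> ?C * ucd P Q" using nn by (intro mult_right_mono) auto
    then show "?e P Q \<le> ?C * ucd P Q + ?C" using wd_le_ucd[OF p(1) q(1)] p(2) q(2) by simp
    obtain g \<phi> where g: "links S p g q" "ctl dS g \<phi>"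
      "\<phi> 1 - \<phi> 0 \<le> card U * ?e P Q + 2 * card U" using links_exist[OF p(1) q(1)] p(2) q(2) by metis
    have "card U * ?e P Q \<le> ?C * ?e P Q" by (intro mult_right_mono) auto
    then show "ucd P Q \<le> ?C * ?e P Q + ?C" using ucd_le[OF p(1) q(1) g(1,2)] g(3) p(2) q(2) by simp
    show "\<exists>u\<in>?Y. ?e P u + ?e u Q = ?e P Q \<and> ?e P u = real k" if "real k \<le> ?e P Q" for k
    proof -
      have "k \<le> wd (word P) (word Q)" using that by simp
      then obtain u where u: "vpath v0 u" "wd (word P) u + wd u (word Q) = wd (word P) (word Q)" "wd (word P) u = k"
        by (rule geodesic_wd[OF word_valid[OF P] word_valid[OF Q]])
      obtain R where R: "R \<in> ?Y" "geq (word R) u" by (rule realize[OF u(1)])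
      have "wd (word P) (word R) = wd (word P) u" "wd (word R) (word Q) = wd u (word Q)"
        using wd_geq[OF geq_refl R(2)] wd_geq[OF R(2) geq_refl] by blast+
      then show ?thesis using u R(1) by (intro bexI[of _ R]) (simp_all flip: of_nat_add)
    qed
    obtain m X where X: "X 0 = cls S p" "X m = cls S q" "\<forall>i\<le>m. X i \<in> ?Y"
      "(\<Sum>i<m. ucd (X i) (X (Suc i))) \<le> ucd (cls S p) (cls S q) + 1"
      "\<forall>i<m. wd (word (X i)) (word (X (Suc i))) \<le> 2 * n"
      by (rule ucd_chain[OF p(1) q(1)])
    have "?e (X i) (X (Suc i)) \<le> ?C" if "i < m" for i
    proof -
      have "?e (X i) (X (Suc i)) \<le> real (2 * n)" using X(5) that by (intro of_nat_mono) blast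
      then show ?thesis by simp
    qed
    then show "\<exists>m X. X 0 = P \<and> X m = Q \<and> (\<forall>i\<le>m. X i \<in> ?Y) \<and>
        (\<Sum>i<m. ucd (X i) (X (Suc i))) \<le> ucd P Q + 1 \<and> (\<forall>i<m. ?e (X i) (X (Suc i)) \<le> ?C)"
      using X p(2) q(2) by (intro exI[of _ m] exI[of _ X]) simp
    fix R assume R: "R \<in> ?Y"
    obtain r w where r: "pth S r x0 w" "R = cls S r" using ex[OF R] by blast
    show "ucd P R \<le> ucd P Q + ucd Q R" using ucd_tri[OF p(1) q(1) r(1)] p(2) q(2) r(2) by simp
    show "?e P R \<le> ?e P Q + ?e Q R" using wd_triangle[of "word P" "word R" "word Q"] by simp
    show "\<exists>m\<in>?Y. ?e P m + ?e m Q = ?e P Q \<and> ?e Q m + ?e m R = ?e Q R \<and> ?e P m + ?e m R = ?e P R"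
    proof -
      obtain m where m: "vpath v0 m" "wd (word P) m + wd m (word Q) = wd (word P) (word Q)"
        "wd (word Q) m + wd m (word R) = wd (word Q) (word R)" "wd (word P) m + wd m (word R) = wd (word P) (word R)"
        by (rule median_wd[OF word_valid[OF P] word_valid[OF Q] word_valid[OF R]])
      obtain M where M: "M \<in> ?Y" "geq (word M) m" by (rule realize[OF m(1)])
      have "wd u (word M) = wd u m" "wd (word M) u = wd m u" for u
        using wd_geq[OF geq_refl M(2)] wd_geq[OF M(2) geq_refl] by blast+
      then show ?thesis using m M(1) by (intro bexI[of _ M]) (simp_all flip: of_nat_add)
    qed
    fix T assume T: "T \<in> ?Y" and e: "?e P R + ?e R Q = ?e P Q" "?e P T + ?e T Q = ?e P Q" "?e P R = ?e P T"
    have e': "wd (word P) (word R) + wd (word R) (word Q) = wd (word P) (word Q)"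
      "wd (word P) (word T) + wd (word T) (word Q) = wd (word P) (word Q)" "wd (word P) (word R) = wd (word P) (word T)"
      using e by (simp_all flip: of_nat_add)
    have "wd (word R) (word T) \<le> 4 * n"
      by (rule thin_wd[OF word_valid[OF P] word_valid[OF Q] word_valid[OF R] word_valid[OF T] e'])
    then have "?e R T \<le> real (4 * n)" by (rule of_nat_mono)
    then show "?e R T \<le> 4 * real n" by simp
  qed
  show ?thesis by (rule hyperbolic)
qed

end

end

section \<open>The coupled link complex of two coloured flag complexes\<close>

lemma simplex_adjacent:
  assumes "abstract_complex A" "s \<in> A" "a \<in> s" "b \<in> s" "a \<noteq> b"
  shows "adjacent A a b"
proof -
  have "{a, b} \<subseteq> s" using assms by simp
  then show ?thesis using assms by (auto simp: abstract_complex_def adjacent_def)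
qed

lemma simplex_colour_inj:
  assumes "coloured_complex n A c" "s \<in> A"
  shows "inj_on c s"
proof (rule inj_onI, rule ccontr)
  fix a b assume "a \<in> s" "b \<in> s" "c a = c b" "a \<noteq> b"
  then show False using simplex_adjacent[of A s a b] assms by (auto simp: coloured_complex_def)
qed

lemma flag_complexD:
  assumes "flag_complex \<Gamma>" "T \<subseteq> \<Union>\<Gamma>" "\<And>u v. u \<in> T \<Longrightarrow> v \<in> T \<Longrightarrow> u \<noteq> v \<Longrightarrow> adjacent \<Gamma> u v"
  shows "T \<in> \<Gamma>"
  using assms(1)[unfolded flag_complex_def, THEN spec, of T] assms(2,3) by blast

text \<open>\<open>no_common\<close> excludes every coincidence of adjacent colours of flat squares
  in the two complexes, whereas pairwise 5-largeness asks, for each flat square, for one side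
  without a coincidence. The stronger form lets the argument use whichever colours
  \<open>long_word\<close> happens to produce.\<close>

locale coupled_complexes =
  fixes n :: nat and A :: "'v set set" and cA :: "'v \<Rightarrow> nat" and B :: "'w set set" and cB :: "'w \<Rightarrow> nat"
  assumes colA: "coloured_complex n A cA" and colB: "coloured_complex n B cB"
    and flagA: "flag_complex A" and flagB: "flag_complex B"
    and no_common: "\<And>a a' g g' b b' h h'. adjacent A a g \<Longrightarrow> adjacent A a g' \<Longrightarrow> adjacent A a' g \<Longrightarrow> adjacent A a' g' \<Longrightarrow>
      \<not> adjacent A a a' \<Longrightarrow> a \<noteq> a' \<Longrightarrow> \<not> adjacent A g g' \<Longrightarrow> g \<noteq> g' \<Longrightarrow>
      adjacent B b h \<Longrightarrow> adjacent B b h' \<Longrightarrow> adjacent B b' h \<Longrightarrow> adjacent B b' h' \<Longrightarrow>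
      \<not> adjacent B b b' \<Longrightarrow> b \<noteq> b' \<Longrightarrow> \<not> adjacent B h h' \<Longrightarrow> h \<noteq> h' \<Longrightarrow>
      cA a = cB b \<Longrightarrow> cA g = cB h \<Longrightarrow> False"
begin

lemma abstract: "abstract_complex A" "abstract_complex B"
  using colA colB by (simp_all add: coloured_complex_def)

abbreviation U :: "('v + 'w) set" where "U \<equiv> \<Union>A <+> \<Union>B"

abbreviation col :: "'v + 'w \<Rightarrow> nat" where "col \<equiv> case_sum cA cB"

definition compat :: "'v + 'w \<Rightarrow> 'v + 'w \<Rightarrow> bool" where
  "compat u v \<longleftrightarrow> (case (u, v) of (Inl a, Inl b) \<Rightarrow> a = b \<or> adjacent A a b
     | (Inr a, Inr b) \<Rightarrow> a = b \<or> adjacent B a b | _ \<Rightarrow> True)"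

lemma compat_simps [simp]:
  "compat (Inl a) (Inl a') \<longleftrightarrow> a = a' \<or> adjacent A a a'"
  "compat (Inr b) (Inr b') \<longleftrightarrow> b = b' \<or> adjacent B b b'"
  "compat (Inl a) (Inr b)" "compat (Inr b) (Inl a)"
  by (simp_all add: compat_def)

sublocale coupled U n col isl compat
proof
  show "finite U" using abstract by (auto simp: abstract_complex_def)
  show "col u \<in> {1..n}" if "u \<in> U" for u
    using that colA colB unfolding coloured_complex_def by (auto elim!: PlusE)
  show "compat u u" for u by (cases u) auto
  show "compat v u" if "compat u v" for u v
    using that by (cases u; cases v) (auto simp: adjacent_def insert_commute)
  show "col u \<noteq> col v" if "u \<noteq> v" "isl u = isl v" "compat u v" for u v
    using that colA colB by (cases u; cases v) (auto simp: coloured_complex_def)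
  show "compat u v" if "isl u \<noteq> isl v" for u v using that by (cases u; cases v) auto
  show "\<exists>\<sigma>. \<not> (\<exists>c\<in>U. \<exists>c'\<in>U. \<exists>g\<in>U. \<exists>g'\<in>U. isl c = \<sigma> \<and> isl c' = \<sigma> \<and> isl g = \<sigma> \<and> isl g' = \<sigma> \<and>
        col c = i \<and> col g = j \<and> \<not> compat c c' \<and> \<not> compat g g' \<and>
        compat c g \<and> compat c g' \<and> compat c' g \<and> compat c' g')" (is "\<exists>\<sigma>. \<not> ?P \<sigma>") for i j
  proof (rule ccontr)
    assume "\<not> (\<exists>\<sigma>. \<not> ?P \<sigma>)"
    then have "\<forall>\<sigma>. ?P \<sigma>" by (rule not_ex[THEN iffD1, THEN all_forward]) (erule notnotD)
    then have all: "?P \<sigma>" for \<sigma> by (rule spec)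
    have sym: "adjacent A x y \<longleftrightarrow> adjacent A y x" "adjacent B z w \<longleftrightarrow> adjacent B w z" for x y z w
      by (auto simp: adjacent_def insert_commute)
    have L: "\<exists>a. u = Inl a" if "isl u" for u :: "'v + 'w" using that by (cases u) auto
    have R: "\<exists>b. u = Inr b" if "\<not> isl u" for u :: "'v + 'w" using that by (cases u) auto
    obtain c c' g g' where 1: "isl c" "isl c'" "isl g" "isl g'" "col c = i" "col g = j" "\<not> compat c c'" "\<not> compat g g'"
      "compat c g" "compat c g'" "compat c' g" "compat c' g'" using all[of True] by blast
    obtain a a' p p' where e: "c = Inl a" "c' = Inl a'" "g = Inl p" "g' = Inl p'"
      using L[OF 1(1)] L[OF 1(2)] L[OF 1(3)] L[OF 1(4)] by blast
    have a: "cA a = i" "cA p = j" "\<not> adjacent A a a'" "a \<noteq> a'" "\<not> adjacent A p p'" "p \<noteq> p'"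
      "adjacent A a p" "adjacent A a p'" "adjacent A a' p" "adjacent A a' p'"
      using 1 sym unfolding e by auto
    obtain d d' h h' where 2: "\<not> isl d" "\<not> isl d'" "\<not> isl h" "\<not> isl h'" "col d = i" "col h = j" "\<not> compat d d'" "\<not> compat h h'"
      "compat d h" "compat d h'" "compat d' h" "compat d' h'" using all[of False] by blast
    obtain b b' q q' where f: "d = Inr b" "d' = Inr b'" "h = Inr q" "h' = Inr q'"
      using R[OF 2(1)] R[OF 2(2)] R[OF 2(3)] R[OF 2(4)] by blast
    have b: "cB b = i" "cB q = j" "\<not> adjacent B b b'" "b \<noteq> b'" "\<not> adjacent B q q'" "q \<noteq> q'"
      "adjacent B b q" "adjacent B b q'" "adjacent B b' q" "adjacent B b' q'"
      using 2 sym unfolding f by auto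
    show False
      by (rule no_common[OF a(7-10) a(3-6) b(7-10) b(3-6)]) (simp_all add: a b)
  qed
qed

lemma factor_vertices_eq: "factor_vertices A cA B cB i = {v \<in> U. col v = i}"
  unfolding factor_vertices_def colour_class_def by (auto elim!: PlusE)

text \<open>A cube of \<open>K\<close> has a vertex that contains all its elements from
  \<open>A\<close>, and one that contains all those from \<open>B\<close>; fullness thus says that
  both parts are simplices. Conversely, colours are injective on simplices, so each colour class of
  \<open>c\<close> is one vertex or one vertex from each side.\<close>

lemma X_cubes_iff:
  "c \<in> X_cubes n A cA B cB \<longleftrightarrow> Inl -` c \<in> A \<and> Inr -` c \<in> B \<and> (\<forall>i\<in>{1..n}. \<exists>u\<in>c. col u = i)"
proof
  assume c: "c \<in> X_cubes n A cA B cB"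
  then obtain \<sigma> where \<sigma>: "c = (\<Union>i\<in>{1..n}. \<sigma> i)" "\<forall>i\<in>{1..n}. \<sigma> i \<in> factor_cells A cA B cB i"
    unfolding X_cubes_def K_cubes_def by blast
  \<comment> \<open>The end of \<open>\<sigma> i\<close> on side \<open>b\<close> if there is one,
    otherwise its only vertex.\<close>
  have cell: "\<exists>u. u \<in> \<sigma> i \<and> u \<in> factor_vertices A cA B cB i \<and> (\<forall>v\<in>\<sigma> i. v \<noteq> u \<longrightarrow> isl v \<noteq> b \<and> isl u = b)"
    if "i \<in> {1..n}" for i b
  proof -
    have "\<sigma> i \<in> factor_cells A cA B cB i" using \<sigma>(2) that by blast
    then consider x where "\<sigma> i = {x}" "x \<in> factor_vertices A cA B cB i"
      | p q where "\<sigma> i = {Inl p, Inr q}" "p \<in> colour_class A cA i" "q \<in> colour_class B cB i"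
      unfolding factor_cells_def by blast
    then show ?thesis
    proof cases
      case 2
      then show ?thesis by (intro exI[of _ "if b then Inl p else Inr q"]) (auto simp: factor_vertices_def)
    qed auto
  qed
  have pick: "\<exists>x. x \<in> K_vertices n A cA B cB \<and> x \<subseteq> c \<and> (\<forall>v\<in>c. isl v = b \<longrightarrow> v \<in> x)" for b
  proof -
    have "\<forall>i\<in>{1..n}. \<exists>u. u \<in> \<sigma> i \<and> u \<in> factor_vertices A cA B cB i \<and>
        (\<forall>v\<in>\<sigma> i. v \<noteq> u \<longrightarrow> isl v \<noteq> b \<and> isl u = b)" by (intro ballI cell)
    from bchoice[OF this] obtain x where x: "\<forall>i\<in>{1..n}. x i \<in> \<sigma> i \<and> x i \<in> factor_vertices A cA B cB i \<and>
        (\<forall>v\<in>\<sigma> i. v \<noteq> x i \<longrightarrow> isl v \<noteq> b \<and> isl (x i) = b)" ..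
    have "x ` {1..n} \<in> K_vertices n A cA B cB" unfolding K_vertices_def using x by blast
    moreover have "x ` {1..n} \<subseteq> c" using x \<sigma>(1) by blast
    moreover have "\<forall>v\<in>c. isl v = b \<longrightarrow> v \<in> x ` {1..n}" using x \<sigma>(1) by blast
    ultimately show ?thesis by blast
  qed
  have sub: "Inl -` x \<in> A \<and> Inr -` x \<in> B" if "x \<in> K_vertices n A cA B cB" "x \<subseteq> c" for x
    using c that unfolding X_cubes_def X_vertices_def by blast
  obtain x where x: "x \<in> K_vertices n A cA B cB" "x \<subseteq> c" "\<forall>v\<in>c. isl v = True \<longrightarrow> v \<in> x" using pick by blast
  obtain y where y: "y \<in> K_vertices n A cA B cB" "y \<subseteq> c" "\<forall>v\<in>c. isl v = False \<longrightarrow> v \<in> y" using pick by blast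
  have "Inl -` c = Inl -` x" "Inr -` c = Inr -` y" using x y by auto
  moreover have "\<exists>u\<in>c. col u = i" if "i \<in> {1..n}" for i
    using cell[OF that] \<sigma>(1) that unfolding factor_vertices_eq by blast
  ultimately show "Inl -` c \<in> A \<and> Inr -` c \<in> B \<and> (\<forall>i\<in>{1..n}. \<exists>u\<in>c. col u = i)"
    using sub x y by simp
next
  assume h: "Inl -` c \<in> A \<and> Inr -` c \<in> B \<and> (\<forall>i\<in>{1..n}. \<exists>u\<in>c. col u = i)"
  have cU: "c \<subseteq> U"
  proof
    fix u assume "u \<in> c" then show "u \<in> U" using h by (cases u) auto
  qed
  define \<sigma> where "\<sigma> i = {u\<in>c. col u = i}" for i
  have inj: "inj_on cA (Inl -` c)" "inj_on cB (Inr -` c)" using simplex_colour_inj colA colB h by blast+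
  have "\<sigma> i \<in> factor_cells A cA B cB i" if i: "i \<in> {1..n}" for i
  proof -
    have fv: "\<sigma> i \<subseteq> factor_vertices A cA B cB i" using cU unfolding \<sigma>_def factor_vertices_eq by blast
    have uA: "p = q" if "Inl p \<in> \<sigma> i" "Inl q \<in> \<sigma> i" for p q
      using that inj_onD[OF inj(1), of p q] unfolding \<sigma>_def by simp
    have uB: "p = q" if "Inr p \<in> \<sigma> i" "Inr q \<in> \<sigma> i" for p q
      using that inj_onD[OF inj(2), of p q] unfolding \<sigma>_def by simp
    have ne: "\<sigma> i \<noteq> {}" using h i unfolding \<sigma>_def by blast
    consider (both) p q where "Inl p \<in> \<sigma> i" "Inr q \<in> \<sigma> i" | (l) p where "Inl p \<in> \<sigma> i" "\<forall>q. Inr q \<notin> \<sigma> i"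
      | (r) q where "Inr q \<in> \<sigma> i" "\<forall>p. Inl p \<notin> \<sigma> i"
      using ne by (metis ex_in_conv old.sum.exhaust)
    then show ?thesis
    proof cases
      case both
      have "u \<in> {Inl p, Inr q}" if "u \<in> \<sigma> i" for u using that uA uB both by (cases u) auto
      then have "\<sigma> i = {Inl p, Inr q}" using both by blast
      moreover have "p \<in> colour_class A cA i" "q \<in> colour_class B cB i"
        using both fv by (auto simp: factor_vertices_def)
      ultimately show ?thesis unfolding factor_cells_def by blast
    next
      case l
      have "u = Inl p" if "u \<in> \<sigma> i" for u using that uA l by (cases u) auto
      then have "\<sigma> i = {Inl p}" using l by blast
      then show ?thesis using fv unfolding factor_cells_def by blast
    next
      case r
      have "u = Inr q" if "u \<in> \<sigma> i" for u using that uB r by (cases u) auto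
      then have "\<sigma> i = {Inr q}" using r by blast
      then show ?thesis using fv unfolding factor_cells_def by blast
    qed
  qed
  moreover have "c = (\<Union>i\<in>{1..n}. \<sigma> i)" using cU col_range unfolding \<sigma>_def by blast
  ultimately have "c \<in> K_cubes n A cA B cB" unfolding K_cubes_def by blast
  moreover have "x \<in> X_vertices n A cA B cB" if x: "x \<in> K_vertices n A cA B cB" "x \<subseteq> c" for x
  proof -
    have "Inl -` x \<subseteq> Inl -` c" "Inr -` x \<subseteq> Inr -` c" using x(2) by auto
    then have "Inl -` x \<in> A" "Inr -` x \<in> B" using h abstract by (auto simp: abstract_complex_def)
    then show ?thesis using x(1) by (simp add: X_vertices_def)
  qed
  ultimately show "c \<in> X_cubes n A cA B cB" unfolding X_cubes_def by blast
qed

text \<open>Flagness enters in the second direction, where pairwise compatibility has to yield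
  simplices of \<open>A\<close> and \<open>B\<close>.\<close>

lemma X_cubes_cell: "c \<in> X_cubes n A cA B cB \<longleftrightarrow> cell c"
proof
  assume "c \<in> X_cubes n A cA B cB"
  then have h: "Inl -` c \<in> A" "Inr -` c \<in> B" "\<forall>i\<in>{1..n}. \<exists>u\<in>c. col u = i" unfolding X_cubes_iff by blast+
  have "c \<subseteq> U"
  proof
    fix u assume "u \<in> c" then show "u \<in> U" using h by (cases u) auto
  qed
  moreover have "compat u v" if "u \<in> c" "v \<in> c" for u v
    using that simplex_adjacent[OF abstract(1) h(1)] simplex_adjacent[OF abstract(2) h(2)]
    by (cases u; cases v) auto
  ultimately show "cell c" unfolding cell_def using h(3) by blast
next
  assume c: "cell c"
  have comp: "compat u v" if "u \<in> c" "v \<in> c" for u v by (rule cell_compat[OF c that])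
  have cU: "c \<subseteq> U" using c by (simp add: cell_def)
  have "Inl -` c \<subseteq> \<Union>A" "Inr -` c \<subseteq> \<Union>B" using cU by auto
  moreover have "adjacent A u v" if "u \<in> Inl -` c" "v \<in> Inl -` c" "u \<noteq> v" for u v using comp[of "Inl u" "Inl v"] that by simp
  moreover have "adjacent B u v" if "u \<in> Inr -` c" "v \<in> Inr -` c" "u \<noteq> v" for u v using comp[of "Inr u" "Inr v"] that by simp
  ultimately have "Inl -` c \<in> A" "Inr -` c \<in> B"
    by (auto intro!: flag_complexD[OF flagA] flag_complexD[OF flagB])
  then show "c \<in> X_cubes n A cA B cB" unfolding X_cubes_iff using cell_colour[OF c] by blast
qed

lemma X_space_eq: "X_space n A cA B cB = S"
proof (rule equalityI; rule subsetI)
  fix x assume "x \<in> X_space n A cA B cB"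
  then obtain c where "c \<in> X_cubes n A cA B cB" and cx: "x \<in> cube_points n A cA B cB c"
    unfolding X_space_def by (rule UN_E)
  then have c: "cell c" by (simp only: X_cubes_cell)
  have cU: "c \<subseteq> U" using c by (simp add: cell_def)
  have x: "\<forall>v. 0 \<le> x v" "\<forall>v. v \<notin> c \<longrightarrow> x v = 0"
    "\<forall>i\<in>{1..n}. (\<Sum>v \<in> c \<inter> {v\<in>U. col v = i}. x v) = 1"
    using cx unfolding cube_points_def factor_vertices_eq by blast+
  have "(\<Sum>v\<in>{v\<in>U. col v = i}. x v) = 1" if "i \<in> {1..n}" for i
  proof -
    have "(\<Sum>v \<in> c \<inter> {v\<in>U. col v = i}. x v) = (\<Sum>v\<in>{v\<in>U. col v = i}. x v)"
      using finU x(2) by (intro sum.mono_neutral_left) auto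
    then show ?thesis using x(3) that by simp
  qed
  moreover have "compat u v" if "x u \<noteq> 0" "x v \<noteq> 0" for u v using cell_compat[OF c] x(2) that by blast
  moreover have "\<forall>v. v \<notin> U \<longrightarrow> x v = 0" using x(2) cU by blast
  ultimately show "x \<in> S" using x(1) unfolding S_def by blast
next
  fix x assume x: "x \<in> S"
  have "(\<Sum>v \<in> supp x \<inter> {v\<in>U. col v = i}. x v) = 1" if "i \<in> {1..n}" for i
  proof -
    have "(\<Sum>v \<in> supp x \<inter> {v\<in>U. col v = i}. x v) = (\<Sum>v\<in>{v\<in>U. col v = i}. x v)"
      using finU by (intro sum.mono_neutral_left) (auto simp: supp_def)
    then show ?thesis using x that by (simp add: S_def)
  qed
  then have "x \<in> cube_points n A cA B cB (supp x)"
    using x unfolding cube_points_def factor_vertices_eq by (auto simp: S_def supp_def)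
  moreover have "supp x \<in> X_cubes n A cA B cB" using supp_cell[OF x] by (simp only: X_cubes_cell)
  ultimately show "x \<in> X_space n A cA B cB" unfolding X_space_def by (rule UN_I[rotated])
qed

theorem cover_hyperbolic: "universal_cover_components_hyperbolic n A cA B cB"
  unfolding universal_cover_components_hyperbolic_def X_space_eq X_dist_def
  using universal_cover_hyperbolic by blast

end

section \<open>Barycentric subdivisions\<close>

lemma bary_vertices: "\<Union>(barycentric_subdivision \<Gamma>) = \<Gamma> - {{}}"
proof -
  have "{s} \<in> barycentric_subdivision \<Gamma>" if "s \<in> \<Gamma> - {{}}" for s
    using that by (simp add: barycentric_subdivision_def)
  then have "\<Gamma> - {{}} \<subseteq> \<Union>(barycentric_subdivision \<Gamma>)" by blast
  moreover have "C \<subseteq> \<Gamma> - {{}}" if "C \<in> barycentric_subdivision \<Gamma>" for C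
    using that by (simp add: barycentric_subdivision_def)
  ultimately show ?thesis by blast
qed

lemma bary_adjacent: "adjacent (barycentric_subdivision \<Gamma>) s t \<longleftrightarrow>
    s \<noteq> t \<and> s \<in> \<Gamma> - {{}} \<and> t \<in> \<Gamma> - {{}} \<and> (s \<subseteq> t \<or> t \<subseteq> s)"
  by (auto simp: adjacent_def barycentric_subdivision_def)

lemma bary_abstract: "abstract_complex \<Gamma> \<Longrightarrow> abstract_complex (barycentric_subdivision \<Gamma>)"
proof -
  assume a: "abstract_complex \<Gamma>"
  then have f: "finite \<Gamma>" by (simp add: abstract_complex_def)
  have "barycentric_subdivision \<Gamma> \<subseteq> Pow \<Gamma>" by (auto simp: barycentric_subdivision_def)
  then have "finite (barycentric_subdivision \<Gamma>)" using f finite_subset by blast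
  moreover have "finite C" if "C \<in> barycentric_subdivision \<Gamma>" for C
    using that f finite_subset[of C \<Gamma>] by (auto simp: barycentric_subdivision_def)
  moreover have "{} \<in> barycentric_subdivision \<Gamma>" by (simp add: barycentric_subdivision_def)
  moreover have "D \<in> barycentric_subdivision \<Gamma>" if "C \<in> barycentric_subdivision \<Gamma>" "D \<subseteq> C" for C D
    using that unfolding barycentric_subdivision_def mem_Collect_eq by (meson subset_iff)
  ultimately show ?thesis unfolding abstract_complex_def by (intro conjI ballI allI impI) auto
qed

lemma bary_flag: "flag_complex (barycentric_subdivision \<Gamma>)"
  unfolding flag_complex_def bary_vertices
proof (intro allI impI)
  fix C assume C: "C \<subseteq> \<Gamma> - {{}}"
    "\<forall>u\<in>C. \<forall>v\<in>C. u \<noteq> v \<longrightarrow> adjacent (barycentric_subdivision \<Gamma>) u v"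
  have "s \<subseteq> t \<or> t \<subseteq> s" if "s \<in> C" "t \<in> C" for s t
    using C(2) that bary_adjacent[of \<Gamma> s t] by (cases "s = t") auto
  then show "C \<in> barycentric_subdivision \<Gamma>" using C(1) by (simp add: barycentric_subdivision_def)
qed

lemma complex_card_le:
  assumes "abstract_complex \<Gamma>" "complex_dim \<Gamma> = int d" "s \<in> \<Gamma>"
  shows "card s \<le> Suc d"
proof -
  have "card s \<le> Max (card ` \<Gamma>)" using assms by (intro Max_ge) (auto simp: abstract_complex_def)
  then show ?thesis using assms(2) by (simp add: complex_dim_def)
qed

lemma bary_coloured:
  assumes a: "abstract_complex \<Gamma>" and d: "\<And>s. s \<in> \<Gamma> \<Longrightarrow> card s \<le> n"
    and f: "inj_on f {1..n}" "f ` {1..n} \<subseteq> {1..n}"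
  shows "coloured_complex n (barycentric_subdivision \<Gamma>) (\<lambda>s. f (card s))"
proof -
  have fin: "finite s" if "s \<in> \<Gamma>" for s using a that by (simp add: abstract_complex_def)
  have card: "card s \<in> {1..n}" if "s \<in> \<Gamma> - {{}}" for s
    using that d[of s] fin[of s] by (auto simp: Suc_le_eq card_gt_0_iff)
  show ?thesis
    unfolding coloured_complex_def bary_vertices
  proof (intro conjI ballI allI impI bary_abstract[OF a])
    show "f (card s) \<in> {1..n}" if "s \<in> \<Gamma> - {{}}" for s using card[OF that] f(2) by blast
    fix s t assume "adjacent (barycentric_subdivision \<Gamma>) s t"
    then have h: "s \<noteq> t" "s \<in> \<Gamma> - {{}}" "t \<in> \<Gamma> - {{}}" "s \<subseteq> t \<or> t \<subseteq> s" by (simp_all add: bary_adjacent)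
    have "card s \<noteq> card t" using h fin[of s] fin[of t] card_subset_eq[of t s] card_subset_eq[of s t] by auto
    then show "f (card s) \<noteq> f (card t)" using inj_onD[OF f(1)] card h by blast
  qed
qed

text \<open>The two lower vertices of a flat square span a simplex properly between each of them and the
  upper vertices, so adjacent cardinalities in a flat square differ by at least two.\<close>

lemma flat_square_cards:
  assumes "finite s1" "finite s2" and inc: "\<not> s1 \<subseteq> s3" "\<not> s3 \<subseteq> s1" "\<not> s2 \<subseteq> s4" "\<not> s4 \<subseteq> s2"
    and co: "s1 \<subseteq> s2 \<or> s2 \<subseteq> s1" "s3 \<subseteq> s2 \<or> s2 \<subseteq> s3" "s1 \<subseteq> s4 \<or> s4 \<subseteq> s1" "s3 \<subseteq> s4 \<or> s4 \<subseteq> s3"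
  shows "card s1 + 2 \<le> card s2 \<or> card s2 + 2 \<le> card s1"
proof -
  have main: "card p + 2 \<le> card q" if "finite q" "p \<subseteq> q" "p \<subseteq> q'" "p' \<subseteq> q" "p' \<subseteq> q'" "\<not> p' \<subseteq> p" "\<not> q \<subseteq> q'"
    for p q p' q' :: "'a set"
  proof -
    have "p \<subset> p \<union> p'" "p \<union> p' \<subseteq> q \<inter> q'" "q \<inter> q' \<subset> q" using that by auto
    then have "card p < card (p \<union> p')" "card (p \<union> p') \<le> card (q \<inter> q')" "card (q \<inter> q') < card q"
      using that(1) by (meson psubset_card_mono card_mono finite_subset finite_Int inf_le1 order_trans psubset_imp_subset)+
    then show ?thesis by linarith
  qed
  from co(1) show ?thesis
  proof
    assume "s1 \<subseteq> s2"
    moreover from this have "s3 \<subseteq> s2" using co(2) inc by auto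
    moreover from \<open>s1 \<subseteq> s2\<close> have "s1 \<subseteq> s4" using co(3) inc by auto
    moreover from \<open>s3 \<subseteq> s2\<close> have "s3 \<subseteq> s4" using co(4) inc by auto
    ultimately show ?thesis using main[of s2 s1 s4 s3] assms(2) inc by blast
  next
    assume "s2 \<subseteq> s1"
    moreover from this have "s2 \<subseteq> s3" using co(2) inc by auto
    moreover from \<open>s2 \<subseteq> s1\<close> have "s4 \<subseteq> s1" using co(3) inc by auto
    moreover from \<open>s2 \<subseteq> s3\<close> have "s4 \<subseteq> s3" using co(4) inc by auto
    ultimately show ?thesis using main[of s1 s2 s3 s4] assms(1) inc by blast
  qed
qed

lemma bary_flat:
  assumes a: "abstract_complex \<Gamma>"
    and adj: "adjacent (barycentric_subdivision \<Gamma>) s1 s2" "adjacent (barycentric_subdivision \<Gamma>) s1 s4"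
      "adjacent (barycentric_subdivision \<Gamma>) s3 s2" "adjacent (barycentric_subdivision \<Gamma>) s3 s4"
    and n: "\<not> adjacent (barycentric_subdivision \<Gamma>) s1 s3" "s1 \<noteq> s3"
      "\<not> adjacent (barycentric_subdivision \<Gamma>) s2 s4" "s2 \<noteq> s4"
  shows "card s1 + 2 \<le> card s2 \<or> card s2 + 2 \<le> card s1"
proof (rule flat_square_cards[of s1 s2 s3 s4])
  show "finite s1" "finite s2" using a adj by (auto simp: abstract_complex_def bary_adjacent)
qed (use adj n in \<open>auto simp: bary_adjacent\<close>)

text \<open>On \<open>{1..4}\<close> the pairs at distance at least two form a path, and so do the remaining ones;
  \<open>switch\<close> exchanges the two paths.\<close>

definition switch :: "nat \<Rightarrow> nat" where
  "switch k = (if k = 1 then 2 else if k = 2 then 4 else if k = 3 then 1 else 3)"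

lemma four: "{1..4} = {1, 2, 3, 4::nat}" by auto

lemma switch_inj: "inj_on switch {1..4}" "switch ` {1..4} \<subseteq> {1..4}"
  unfolding four by (auto simp: switch_def)

lemma switch_far:
  assumes "i \<in> {1..4}" "j \<in> {1..4}" "i + 2 \<le> j \<or> j + 2 \<le> i"
  shows "\<not> (switch i + 2 \<le> switch j \<or> switch j + 2 \<le> switch i)"
  using assms unfolding four by (auto simp: switch_def)

section \<open>Top-dimensional cycles\<close>

lemma z2_zero_chain: "(\<lambda>_. 0) \<in> z2_chains K k" by (simp add: z2_chains_def)

lemma z2_boundary_zero: "z2_boundary K k (\<lambda>_. 0) = (\<lambda>_. 0)"
  by (simp add: z2_boundary_def fun_eq_iff)

lemma z2_zero_cycle: "(\<lambda>_. 0) \<in> z2_cycles K k"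
  by (simp add: z2_cycles_def z2_zero_chain z2_boundary_zero)

lemma z2_top_boundaries:
  assumes "K (Suc k) = {}"
  shows "z2_boundaries K k = {\<lambda>_. 0}"
proof -
  have "z2_chains K (Suc k) = {\<lambda>_. 0}" using assms by (auto simp: z2_chains_def)
  then show ?thesis unfolding z2_boundaries_def using z2_boundary_zero[of K "Suc k"] by simp
qed

text \<open>Without cells of dimension \<open>Suc k\<close> the only boundary is zero, its cosets
  are singletons, and the homology group is the cycle group.\<close>

lemma z2_top_homology_trivial:
  assumes top: "K (Suc k) = {}"
  shows "trivial_group (z2_homology K k) \<longleftrightarrow> z2_cycles K k = {\<lambda>_. 0}"
proof -
  let ?G = "z2_cycle_group K k" and ?H = "{\<lambda>_. 0} :: ('a set \<Rightarrow> bit) set"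
  have coset: "?H #>\<^bsub>?G\<^esub> z = {z}" for z
    by (simp only: r_coset_def z2_cycle_group_def monoid.select_convs UN_insert UN_empty Un_empty_right add_0_left)
  have hom: "z2_homology K k = ?G Mod ?H" unfolding z2_homology_def z2_top_boundaries[of K k, OF top] ..
  have carr: "carrier (z2_homology K k) = (\<lambda>z. {z}) ` z2_cycles K k"
  proof -
    have "carrier ?G = z2_cycles K k" by (simp add: z2_cycle_group_def)
    then show ?thesis unfolding hom FactGroup_def RCOSETS_def partial_object.select_convs coset by blast
  qed
  have one: "one (z2_homology K k) = ?H" unfolding hom FactGroup_def by simp
  show ?thesis
  proof
    assume "trivial_group (z2_homology K k)"
    then have "(\<lambda>z. {z}) ` z2_cycles K k = {?H}" using carr one by (simp add: trivial_group_def)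
    then show "z2_cycles K k = {\<lambda>_. 0}" by blast
  next
    assume c: "z2_cycles K k = {\<lambda>_. 0}"
    have cc: "carrier (z2_homology K k) = {?H}" using carr c by simp
    have m: "?H \<otimes>\<^bsub>z2_homology K k\<^esub> ?H = ?H"
      unfolding hom FactGroup_def
      by (simp only: set_mult_def z2_cycle_group_def monoid.select_convs UN_insert UN_empty Un_empty_right add_0_left)
    have "group (z2_homology K k)"
      by (rule groupI) (simp_all add: cc m one)
    then show "trivial_group (z2_homology K k)" using cc one by (simp add: trivial_group_def)
  qed
qed

lemma bary_simplex_full:
  assumes a: "abstract_complex \<Gamma>" and d: "\<And>s. s \<in> \<Gamma> \<Longrightarrow> card s \<le> n" and C: "C \<in> barycentric_subdivision \<Gamma>"
  shows "inj_on card C" "card ` C \<subseteq> {1..n}" "card C \<le> n"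
proof -
  have h: "C \<subseteq> \<Gamma> - {{}}" "\<forall>s\<in>C. \<forall>t\<in>C. s \<subseteq> t \<or> t \<subseteq> s" using C by (auto simp: barycentric_subdivision_def)
  have fin: "finite s" if "s \<in> C" for s using a h(1) that by (auto simp: abstract_complex_def)
  show inj: "inj_on card C"
  proof (rule inj_onI)
    fix s t assume st: "s \<in> C" "t \<in> C" "card s = card t"
    then show "s = t" using h(2) fin[of s] fin[of t] card_subset_eq[of t s] card_subset_eq[of s t] by metis
  qed
  show sub: "card ` C \<subseteq> {1..n}"
  proof
    fix k assume "k \<in> card ` C"
    then obtain s where s: "s \<in> C" "k = card s" by blast
    then have "s \<in> \<Gamma>" "s \<noteq> {}" "finite s" using h(1) fin by auto
    then show "k \<in> {1..n}" using d[of s] s(2) by (simp add: Suc_le_eq card_gt_0_iff)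
  qed
  show "card C \<le> n" using card_mono[OF _ sub] card_image[OF inj] by simp
qed

text \<open>The intermediate sets arise by adding to \<open>p\<close> one of the two elements of
  \<open>q - p\<close>. For a chain with an inner gap this gives two fillings, whose contributions
  cancel modulo 2.\<close>

lemma card_between:
  assumes "finite q" "p \<subseteq> q" "card q = card p + 2"
  shows "card {x. p \<subseteq> x \<and> x \<subseteq> q \<and> card x = Suc (card p)} = 2"
proof -
  have fp: "finite p" using assms finite_subset by blast
  have "card (q - p) = 2" using assms fp by (simp add: card_Diff_subset)
  then obtain u v where uv: "q - p = {u, v}" "u \<noteq> v" by (meson card_2_iff)
  have "{x. p \<subseteq> x \<and> x \<subseteq> q \<and> card x = Suc (card p)} = {insert u p, insert v p}"
  proof (intro equalityI subsetI)
    fix x assume "x \<in> {x. p \<subseteq> x \<and> x \<subseteq> q \<and> card x = Suc (card p)}"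
    then have x: "p \<subseteq> x" "x \<subseteq> q" "card x = Suc (card p)" by auto
    then have "card (x - p) = 1" using fp by (simp add: card_Diff_subset)
    then obtain w where w: "x - p = {w}" by (meson card_1_singletonE)
    then have "w \<in> q - p" using x(2) by blast
    then have "w = u \<or> w = v" using uv(1) by simp
    moreover have "x = insert w p" using w x(1) by blast
    ultimately show "x \<in> {insert u p, insert v p}" by blast
  next
    fix x assume x: "x \<in> {insert u p, insert v p}"
    have "u \<in> q" "v \<in> q" "u \<notin> p" "v \<notin> p" using uv(1) by blast+
    then show "x \<in> {x. p \<subseteq> x \<and> x \<subseteq> q \<and> card x = Suc (card p)}"
      using x assms(2) fp by auto
  qed
  moreover have "insert u p \<noteq> insert v p" using uv by blast
  ultimately show ?thesis by simp
qed

text \<open>A maximal chain lies in the simplex given by its union. A chain that misses only one cardinality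
  below the top has exactly two maximal extensions, with the same union.\<close>

lemma bary_cycle:
  assumes a: "abstract_complex \<Gamma>" and d: "\<And>s. s \<in> \<Gamma> \<Longrightarrow> card s \<le> Suc m"
    and z: "z \<in> z2_cycles (simplices \<Gamma>) m" and m: "0 < m"
    and C: "C \<in> barycentric_subdivision \<Gamma>" "card C = m"
  shows "(\<Sum>D\<in>{D\<in>barycentric_subdivision \<Gamma>. card D = Suc m \<and> C \<subseteq> D}. z (\<Union>D)) = 0"
proof -
  have h: "C \<subseteq> \<Gamma> - {{}}" "\<forall>s\<in>C. \<forall>t\<in>C. s \<subseteq> t \<or> t \<subseteq> s" using C by (auto simp: barycentric_subdivision_def)
  have finG: "finite s" if "s \<in> \<Gamma>" for s using a that by (simp add: abstract_complex_def)
  have finC: "finite C" using C(2) m card.infinite by fastforce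
  note full = bary_simplex_full[OF a d C(1)]
  have cc: "card (card ` C) = m" using card_image[OF full(1)] C(2) by simp
  \<comment> \<open>The simplices that extend the chain \<open>C\<close>; each of them has the one
    cardinality \<open>k\<close> that \<open>C\<close> misses.\<close>
  define X where "X = {x \<in> \<Gamma> - {{}}. x \<notin> C \<and> (\<forall>y\<in>C. x \<subseteq> y \<or> y \<subseteq> x)}"
  have ext: "{D\<in>barycentric_subdivision \<Gamma>. card D = Suc m \<and> C \<subseteq> D} = (\<lambda>x. insert x C) ` X"
  proof (intro equalityI subsetI)
    fix D assume "D \<in> {D\<in>barycentric_subdivision \<Gamma>. card D = Suc m \<and> C \<subseteq> D}"
    then have D: "D \<subseteq> \<Gamma> - {{}}" "\<forall>s\<in>D. \<forall>t\<in>D. s \<subseteq> t \<or> t \<subseteq> s" "card D = Suc m" "C \<subseteq> D"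
      by (auto simp: barycentric_subdivision_def)
    have "card (D - C) = 1" using D(3,4) C(2) finC by (simp add: card_Diff_subset)
    then obtain x where x: "D - C = {x}" by (meson card_1_singletonE)
    then have xD: "x \<in> D" "x \<notin> C" "D = insert x C" using D(4) by auto
    have "x \<subseteq> y \<or> y \<subseteq> x" if "y \<in> C" for y using bspec[OF bspec[OF D(2) xD(1)], of y] D(4) that by blast
    then have "x \<in> X" using xD D(1) unfolding X_def by simp
    then show "D \<in> (\<lambda>x. insert x C) ` X" using xD(3) by blast
  next
    fix D assume "D \<in> (\<lambda>x. insert x C) ` X"
    then obtain x where x: "x \<in> X" "D = insert x C" by blast
    then have xX: "x \<in> \<Gamma> - {{}}" "\<forall>y\<in>C. x \<subseteq> y \<or> y \<subseteq> x" unfolding X_def by simp_all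
    have "D \<subseteq> \<Gamma> - {{}}" using x(2) xX(1) h(1) by simp
    moreover have "\<forall>s\<in>D. \<forall>t\<in>D. s \<subseteq> t \<or> t \<subseteq> s" unfolding x(2) using xX(2) h(2) by (simp add: disj_commute)
    moreover have "card D = Suc m" using x C(2) finC unfolding X_def by simp
    ultimately show "D \<in> {D\<in>barycentric_subdivision \<Gamma>. card D = Suc m \<and> C \<subseteq> D}"
      using x by (auto simp: barycentric_subdivision_def)
  qed
  have inj: "inj_on (\<lambda>x. insert x C) X" unfolding X_def by (rule inj_onI) (auto simp: insert_ident)
  have sum: "(\<Sum>D\<in>{D\<in>barycentric_subdivision \<Gamma>. card D = Suc m \<and> C \<subseteq> D}. z (\<Union>D)) = (\<Sum>x\<in>X. z (\<Union>(insert x C)))"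
    unfolding ext by (simp add: sum.reindex[OF inj])
  have "card ({1..Suc m} - card ` C) = 1" using full(2) cc by (simp add: card_Diff_subset finC)
  then obtain k where k: "{1..Suc m} - card ` C = {k}" by (meson card_1_singletonE)
  have img: "card ` C = {1..Suc m} - {k}" using k full(2) by blast
  have kr: "k \<in> {1..Suc m}" using k by blast
  have Xk: "card x = k" if x: "x \<in> X" for x
  proof (rule ccontr)
    assume "card x \<noteq> k"
    moreover have "card x \<in> {1..Suc m}" using x d[of x] finG[of x] unfolding X_def by (auto simp: Suc_le_eq card_gt_0_iff)
    ultimately have "card x \<in> card ` C" using img by blast
    then obtain y where y: "y \<in> C" "card x = card y" by blast
    then have "x \<subseteq> y \<or> y \<subseteq> x" "finite x" "finite y" using x h(1) finG unfolding X_def by auto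
    then have "x = y" using y(2) card_subset_eq by metis
    then show False using x y unfolding X_def by blast
  qed
  have cs: "card s \<in> {1..Suc m} - {k}" if "s \<in> C" for s using img that by blast
  have leq: "s \<subseteq> t" if "s \<in> C" "t \<in> C" "card s \<le> card t" for s t
  proof (cases "s \<subseteq> t")
    case False
    then have "t \<subseteq> s" using h(2) that by blast
    moreover have "finite s" using that h(1) finG by auto
    ultimately show ?thesis using that(3) card_seteq by blast
  qed
  show ?thesis
  proof (cases "k = Suc m")
    \<comment> \<open>The gap is at the top: the extensions are the \<open>m\<close>-simplices over
      the largest member \<open>t\<close> of \<open>C\<close>, and the sum is the coefficient of
      \<open>t\<close> in the boundary of \<open>z\<close>.\<close>
    case True
    have "m \<in> card ` C" using img True m by auto
    then obtain t where t: "m = card t" "t \<in> C" by (rule imageE)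
    then have t: "t \<in> C" "card t = m" by simp_all
    have tG: "t \<in> \<Gamma>" "t \<noteq> {}" using t h(1) by auto
    have top: "s \<subseteq> t" if "s \<in> C" for s
    proof -
      have "card s \<in> {1..Suc m} - {k}" using img that by blast
      then have "card s \<le> card t" using t True by auto
      then show ?thesis using leq that t by blast
    qed
    have X: "X = {e \<in> simplices \<Gamma> m. t \<subseteq> e}"
    proof (intro equalityI subsetI)
      fix x assume x: "x \<in> X"
      then have "card x = Suc m" "x \<in> \<Gamma>" "x \<subseteq> t \<or> t \<subseteq> x" using Xk True t unfolding X_def by auto
      moreover have "\<not> x \<subseteq> t" using calculation(1) t card_mono[of t x] finG[OF tG(1)] by auto
      ultimately show "x \<in> {e \<in> simplices \<Gamma> m. t \<subseteq> e}" by (simp add: simplices_def)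
    next
      fix x assume "x \<in> {e \<in> simplices \<Gamma> m. t \<subseteq> e}"
      then have x: "x \<in> \<Gamma>" "card x = Suc m" "t \<subseteq> x" by (auto simp: simplices_def)
      have "x \<notin> C" using x(2) cs[of x] True by auto
      then show "x \<in> X" using x tG top unfolding X_def by auto
    qed
    have un: "\<Union>(insert x C) = x" if "x \<in> X" for x using that top t unfolding X by blast
    have "z2_boundary (simplices \<Gamma>) m z t = 0" using z by (simp add: z2_cycles_def)
    moreover have "t \<in> simplices \<Gamma> (m - 1)" using t tG m by (simp add: simplices_def)
    ultimately have "(\<Sum>e\<in>{e \<in> simplices \<Gamma> m. t \<subseteq> e}. z e) = 0" using m by (simp add: z2_boundary_def)
    moreover have "(\<Sum>x\<in>X. z (\<Union>(insert x C))) = (\<Sum>x\<in>X. z x)" using un by (intro sum.cong) simp_all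
    ultimately show ?thesis using sum X by simp
  next
    case False
    have "Suc m \<in> card ` C" using img False by auto
    then obtain t where t: "Suc m = card t" "t \<in> C" by (rule imageE)
    then have t: "t \<in> C" "card t = Suc m" by simp_all
    have "Suc k \<in> card ` C" unfolding img using False kr by simp
    then obtain q where q: "Suc k = card q" "q \<in> C" by (rule imageE)
    then have q: "q \<in> C" "card q = Suc k" by simp_all
    \<comment> \<open>The member of \<open>C\<close> just below the gap; if the missing cardinality
      is 1, the empty set takes its place.\<close>
    obtain p where p: "p = {} \<or> p \<in> C" "card p = k - 1" "p = {} \<longleftrightarrow> k = 1"
    proof (cases "k = 1")
      case True then show ?thesis using that[of "{}"] by simp
    next
      case False
      then have "k - 1 \<in> card ` C" unfolding img using kr by auto
      then obtain p where p: "k - 1 = card p" "p \<in> C" by (rule imageE)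
      then have p: "p \<in> C" "card p = k - 1" by simp_all
      then have "p \<noteq> {}" using h(1) by blast
      then show ?thesis using that[of p] p False by blast
    qed
    have qG: "q \<in> \<Gamma>" "finite q" using q h(1) finG by auto
    have "card p \<le> card q" using p(2) q(2) by linarith
    then have pq: "p \<subseteq> q" using p(1) leq[OF _ q(1)] by blast
    have cpq: "card q = card p + 2" "Suc (card p) = k" using p q kr by auto
    have below: "s \<subseteq> p" if "s \<in> C" "card s < k" for s
    proof -
      have "card s \<noteq> 0" using cs[OF that(1)] by auto
      then have "k \<noteq> 1" using that(2) by simp
      then have "p \<in> C" using p by blast
      then show ?thesis using leq[of s p] that p by auto
    qed
    have above: "q \<subseteq> s" if "s \<in> C" "\<not> card s < k" for s
    proof -
      have "card s \<noteq> k" using cs[OF that(1)] by simp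
      then show ?thesis using leq[of q s] that q by auto
    qed
    have X: "X = {x. p \<subseteq> x \<and> x \<subseteq> q \<and> card x = Suc (card p)}"
    proof (intro equalityI subsetI)
      fix x assume x: "x \<in> X"
      have cx: "card x = k" using Xk[OF x] .
      have xx: "finite x" "x \<subseteq> q \<or> q \<subseteq> x" "p = {} \<or> x \<subseteq> p \<or> p \<subseteq> x" using x q p finG unfolding X_def by auto
      have "\<not> q \<subseteq> x" using card_mono[OF xx(1), of q] q cx by auto
      moreover have "finite p" using pq qG(2) finite_subset by blast
      then have "p \<noteq> {} \<longrightarrow> \<not> x \<subseteq> p" using card_mono[of p x] cpq cx by auto
      ultimately show "x \<in> {x. p \<subseteq> x \<and> x \<subseteq> q \<and> card x = Suc (card p)}" using xx cx cpq by auto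
    next
      fix x assume "x \<in> {x. p \<subseteq> x \<and> x \<subseteq> q \<and> card x = Suc (card p)}"
      then have x: "p \<subseteq> x" "x \<subseteq> q" "card x = k" using cpq by auto
      have "x \<in> \<Gamma>" using x(2) qG a by (simp add: abstract_complex_def)
      moreover have "x \<noteq> {}" using x(3) kr by auto
      moreover have "x \<notin> C" using x(3) cs[of x] by auto
      moreover have "x \<subseteq> y \<or> y \<subseteq> x" if "y \<in> C" for y using below[OF that] above[OF that] x by blast
      ultimately show "x \<in> X" unfolding X_def by blast
    qed
    have top: "s \<subseteq> t" if "s \<in> C" for s using leq[OF that t(1)] cs[OF that] t(2) by simp
    have "\<Union>(insert x C) = t" if "x \<in> X" for x
    proof -
      have "x \<subseteq> t" using that top[OF q(1)] unfolding X by auto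
      then show ?thesis using top t(1) by blast
    qed
    then have "(\<Sum>x\<in>X. z (\<Union>(insert x C))) = (\<Sum>x\<in>X. z t)" by (intro sum.cong) simp_all
    also have "\<dots> = of_nat 2 * z t" using card_between[OF qG(2) pq cpq(1)] X by simp
    also have "\<dots> = 0" by simp
    finally show ?thesis using sum by simp
  qed
qed

text \<open>Adding the elements of \<open>T\<close> one at a time builds a maximal chain. It carries
  the coefficient of \<open>T\<close> in the induced cycle, so a non-zero coefficient survives
  subdivision.\<close>

lemma full_flag_exists:
  assumes a: "abstract_complex \<Gamma>" and T: "T \<in> \<Gamma>"
  shows "\<exists>C\<in>barycentric_subdivision \<Gamma>. card C = card T \<and> \<Union>C = T"
proof -
  have "finite T" using a T by (simp add: abstract_complex_def)
  then show ?thesis using T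
  proof (induction T)
    case empty
    then show ?case by (intro bexI[of _ "{}"]) (auto simp: barycentric_subdivision_def)
  next
    case (insert x T)
    then have "T \<in> \<Gamma>" using a by (auto simp: abstract_complex_def)
    then obtain C where C: "C \<in> barycentric_subdivision \<Gamma>" "card C = card T" "\<Union>C = T" using insert by blast
    have "insert x T \<notin> C" using C(3) insert by auto
    moreover have "finite C" using C(1) bary_abstract[OF a] by (simp add: abstract_complex_def)
    moreover have "insert (insert x T) C \<in> barycentric_subdivision \<Gamma>"
      using C insert.prems by (auto simp: barycentric_subdivision_def)
    ultimately show ?case using C insert by (intro bexI[of _ "insert (insert x T) C"]) auto
  qed
qed

lemma nontrivial_top_cycle:
  assumes a: "abstract_complex \<Gamma>" and d: "\<And>s. s \<in> \<Gamma> \<Longrightarrow> card s \<le> Suc m"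
    and nt: "\<not> trivial_group (z2_homology (simplices \<Gamma>) m)"
  obtains z T where "z \<in> z2_cycles (simplices \<Gamma>) m" "T \<in> \<Gamma>" "card T = Suc m" "z T = 1"
proof -
  have "simplices \<Gamma> (Suc m) = {}" using d by (force simp: simplices_def)
  then obtain z where z: "z \<in> z2_cycles (simplices \<Gamma>) m" "z \<noteq> (\<lambda>_. 0)"
    using nt z2_top_homology_trivial z2_zero_cycle by blast
  then obtain T where T: "z T \<noteq> 0" by blast
  then have "T \<in> simplices \<Gamma> m" using z(1) by (auto simp: z2_cycles_def z2_chains_def)
  then show ?thesis using that[OF z(1), of T] T by (simp add: simplices_def)
qed

context coupled_complexes
begin

section \<open>Products of top-dimensional cycles\<close>

lemma full_simplex_colours:
  assumes "coloured_complex n K c" "s \<in> K" "card s = n"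
  shows "c ` s = {1..n}"
proof -
  have "c ` s \<subseteq> {1..n}" using assms(1,2) by (auto simp: coloured_complex_def)
  moreover have "card (c ` s) = n" using card_image[OF simplex_colour_inj[OF assms(1,2)]] assms(3) by simp
  ultimately show ?thesis by (intro card_subset_eq) auto
qed

lemma simplex_card_le:
  assumes "coloured_complex n K c" "s \<in> K"
  shows "card s \<le> n"
proof -
  have "c ` s \<subseteq> {1..n}" using assms by (auto simp: coloured_complex_def)
  then have "card (c ` s) \<le> n" using card_mono[of "{1..n}"] by fastforce
  then show ?thesis using card_image[OF simplex_colour_inj[OF assms]] by simp
qed

lemma card_sum_set: "finite c \<Longrightarrow> card c = card (Inl -` c) + card (Inr -` c)"
proof -
  assume f: "finite c"
  have fin: "finite (Inl -` c)" "finite (Inr -` c)" using f by (auto intro!: finite_vimageI)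
  have c: "c = Inl -` c <+> Inr -` c"
  proof (intro equalityI subsetI)
    fix u assume "u \<in> c" then show "u \<in> Inl -` c <+> Inr -` c" by (cases u) auto
  qed auto
  show ?thesis using card_Plus[OF fin] c by simp
qed

lemma cube_finite: "c \<in> X_cubes n A cA B cB \<Longrightarrow> finite c"
  using finU unfolding X_cubes_cell cell_def by (meson finite_subset)

text \<open>A cube of dimension \<open>n\<close> has \<open>2 * n\<close> elements, hence is a pair
  of simplices with \<open>n\<close> vertices each, and no larger cubes exist. A face of codimension
  1 lacks one vertex on one side; the cubes over it vary on that side only, so the sum factors into
  a vanishing boundary sum and a constant.\<close>

lemma product_cycle:
  fixes \<alpha> :: "'v set \<Rightarrow> bit" and \<beta> :: "'w set \<Rightarrow> bit"
  assumes n: "0 < n"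
    and \<alpha>: "\<And>s. s \<in> A \<Longrightarrow> card s = n - 1 \<Longrightarrow> (\<Sum>t\<in>{t\<in>A. card t = n \<and> s \<subseteq> t}. \<alpha> t) = 0"
    and \<beta>: "\<And>s. s \<in> B \<Longrightarrow> card s = n - 1 \<Longrightarrow> (\<Sum>t\<in>{t\<in>B. card t = n \<and> s \<subseteq> t}. \<beta> t) = 0"
    and nz: "s0 \<in> A" "card s0 = n" "\<alpha> s0 = 1" "t0 \<in> B" "card t0 = n" "\<beta> t0 = 1"
  shows "\<not> trivial_group (z2_homology (X_cubes_of_dim n A cA B cB) n)"
proof -
  let ?K = "X_cubes_of_dim n A cA B cB"
  have K: "c \<in> ?K k \<longleftrightarrow> Inl -` c \<in> A \<and> Inr -` c \<in> B \<and> (\<forall>i\<in>{1..n}. \<exists>u\<in>c. col u = i) \<and> card c = n + k" for c k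
    unfolding X_cubes_of_dim_def X_cubes_iff by blast
  have cardK: "card c = card (Inl -` c) + card (Inr -` c)" "card (Inl -` c) \<le> n" "card (Inr -` c) \<le> n"
    if "c \<in> X_cubes n A cA B cB" for c
    using card_sum_set[OF cube_finite[OF that]] that simplex_card_le[OF colA] simplex_card_le[OF colB]
    unfolding X_cubes_iff by auto
  have top: "?K (Suc n) = {}"
  proof -
    have False if "c \<in> ?K (Suc n)" for c using cardK[of c] that unfolding X_cubes_of_dim_def by simp
    then show ?thesis by blast
  qed
  have full: "card (Inl -` c) = n" "card (Inr -` c) = n" if "c \<in> ?K n" for c
    using cardK[of c] that unfolding X_cubes_of_dim_def by simp_all
  have vim: "Inl -` (s <+> t) = s" "Inr -` (s <+> t) = t" for s :: "'v set" and t :: "'w set" by auto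
  have split: "c = Inl -` c <+> Inr -` c" for c :: "('v + 'w) set"
  proof (intro equalityI subsetI)
    fix u assume "u \<in> c" then show "u \<in> Inl -` c <+> Inr -` c" by (cases u) auto
  qed auto
  have finAB: "finite s" "finite t" if "s \<in> A" "t \<in> B" for s t using that abstract by (auto simp: abstract_complex_def)
  have plusK: "s <+> t \<in> ?K n" if "s \<in> A" "card s = n" "t \<in> B" "card t = n" for s t
    unfolding K vim
  proof (intro conjI that ballI)
    show "card (s <+> t) = n + n" using card_Plus[OF finAB[OF that(1,3)]] that(2,4) by simp
    fix i assume "i \<in> {1..n}"
    then have "i \<in> cA ` s" using full_simplex_colours[OF colA that(1,2)] by simp
    then show "\<exists>u\<in>s <+> t. col u = i" by force
  qed
  define \<zeta> where "\<zeta> c = (if c \<in> ?K n then \<alpha> (Inl -` c) * \<beta> (Inr -` c) else 0)" for c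
  have "z2_boundary ?K n \<zeta> f = 0" for f
  proof (cases "f \<in> ?K (n - 1)")
    case False
    then show ?thesis by (simp add: z2_boundary_def)
  next
    case True
    let ?s = "Inl -` f" and ?t = "Inr -` f"
    have st: "?s \<in> A" "?t \<in> B" "card ?s + card ?t = n + (n - 1)" "card ?s \<le> n" "card ?t \<le> n"
      using True cardK[of f] unfolding X_cubes_of_dim_def X_cubes_iff by auto
    then consider (l) "card ?s = n - 1" "card ?t = n" | (r) "card ?s = n" "card ?t = n - 1" using n by linarith
    then have "(\<Sum>e\<in>{e\<in>?K n. f \<subseteq> e}. \<zeta> e) = 0"
    proof cases
      case l
      let ?T = "{s\<in>A. card s = n \<and> ?s \<subseteq> s}"
      have im: "{e\<in>?K n. f \<subseteq> e} = (\<lambda>s. s <+> ?t) ` ?T"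
      proof (intro equalityI subsetI)
        fix e assume e: "e \<in> {e\<in>?K n. f \<subseteq> e}"
        then have sub: "?s \<subseteq> Inl -` e" "?t \<subseteq> Inr -` e" by auto
        have eK: "Inl -` e \<in> A" "Inr -` e \<in> B" "card (Inl -` e) = n" "card (Inr -` e) = n"
          using e full[of e] K by auto
        have "?t = Inr -` e" using card_subset_eq[OF finAB(2)[OF st(1) eK(2)] sub(2)] l eK by simp
        then have "e = Inl -` e <+> ?t" using split[of e] by simp
        then show "e \<in> (\<lambda>s. s <+> ?t) ` ?T" using eK sub by blast
      next
        fix e assume "e \<in> (\<lambda>s. s <+> ?t) ` ?T"
        then obtain s where s: "s \<in> A" "card s = n" "?s \<subseteq> s" "e = s <+> ?t" by blast
        have "f = ?s <+> ?t" by (rule split)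
        also have "\<dots> \<subseteq> e" unfolding s(4) Plus_def using s(3) by blast
        finally have "f \<subseteq> e" .
        then show "e \<in> {e\<in>?K n. f \<subseteq> e}" using plusK[OF s(1,2) st(2) l(2)] s(4) by simp
      qed
      have inj: "inj_on (\<lambda>s. s <+> ?t) ?T" by (rule inj_onI) (metis vim(1))
      have "(\<Sum>e\<in>{e\<in>?K n. f \<subseteq> e}. \<zeta> e) = (\<Sum>s\<in>?T. \<zeta> (s <+> ?t))"
        unfolding im by (simp add: sum.reindex[OF inj])
      also have "\<dots> = (\<Sum>s\<in>?T. \<alpha> s * \<beta> ?t)"
        using plusK st(2) l(2) by (intro sum.cong) (simp_all add: \<zeta>_def vim)
      also have "\<dots> = (\<Sum>s\<in>?T. \<alpha> s) * \<beta> ?t" by (rule sum_distrib_right[symmetric])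
      finally show ?thesis using \<alpha>[OF st(1) l(1)] by simp
    next
      case r
      let ?T = "{t\<in>B. card t = n \<and> ?t \<subseteq> t}"
      have im: "{e\<in>?K n. f \<subseteq> e} = (\<lambda>t. ?s <+> t) ` ?T"
      proof (intro equalityI subsetI)
        fix e assume e: "e \<in> {e\<in>?K n. f \<subseteq> e}"
        then have sub: "?s \<subseteq> Inl -` e" "?t \<subseteq> Inr -` e" by auto
        have eK: "Inl -` e \<in> A" "Inr -` e \<in> B" "card (Inl -` e) = n" "card (Inr -` e) = n"
          using e full[of e] K by auto
        have "?s = Inl -` e" using card_subset_eq[OF finAB(1)[OF eK(1) st(2)] sub(1)] r eK by simp
        then have "e = ?s <+> Inr -` e" using split[of e] by simp
        then show "e \<in> (\<lambda>t. ?s <+> t) ` ?T" using eK sub by blast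
      next
        fix e assume "e \<in> (\<lambda>t. ?s <+> t) ` ?T"
        then obtain t where t: "t \<in> B" "card t = n" "?t \<subseteq> t" "e = ?s <+> t" by blast
        have "f = ?s <+> ?t" by (rule split)
        also have "\<dots> \<subseteq> e" unfolding t(4) Plus_def using t(3) by blast
        finally have "f \<subseteq> e" .
        then show "e \<in> {e\<in>?K n. f \<subseteq> e}" using plusK[OF st(1) r(1) t(1,2)] t(4) by simp
      qed
      have inj: "inj_on (\<lambda>t. ?s <+> t) ?T" by (rule inj_onI) (metis vim(2))
      have "(\<Sum>e\<in>{e\<in>?K n. f \<subseteq> e}. \<zeta> e) = (\<Sum>t\<in>?T. \<zeta> (?s <+> t))"
        unfolding im by (simp add: sum.reindex[OF inj])
      also have "\<dots> = (\<Sum>t\<in>?T. \<alpha> ?s * \<beta> t)"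
        using plusK st(1) r(1) by (intro sum.cong) (simp_all add: \<zeta>_def vim)
      also have "\<dots> = \<alpha> ?s * (\<Sum>t\<in>?T. \<beta> t)" by (rule sum_distrib_left[symmetric])
      finally show ?thesis using \<beta>[OF st(2) r(2)] by simp
    qed
    then show ?thesis by (simp add: z2_boundary_def)
  qed
  then have "\<zeta> \<in> z2_cycles ?K n" by (auto simp: z2_cycles_def z2_chains_def \<zeta>_def)
  moreover have "\<zeta> (s0 <+> t0) = 1" using plusK[OF nz(1,2,4,5)] nz(3,6) by (simp add: \<zeta>_def vim)
  then have "\<zeta> \<noteq> (\<lambda>_. 0)" by auto
  ultimately show ?thesis using z2_top_homology_trivial[of ?K n, OF top] by auto
qed

end

section \<open>The main theorem\<close>

text \<open>\<open>p\<close> and \<open>q\<close> are the corners opposite to \<open>w i\<close> and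
  to its successor; this replaces indices modulo 4 by relations between four named vertices.\<close>

lemma flat_square_neighbours:
  assumes f: "flat_square K w" and i: "i < 4"
  obtains p q where "adjacent K (w i) (w ((i + 1) mod 4))" "adjacent K (w i) q"
    "adjacent K p (w ((i + 1) mod 4))" "adjacent K p q"
    "\<not> adjacent K (w i) p" "w i \<noteq> p" "\<not> adjacent K (w ((i + 1) mod 4)) q" "w ((i + 1) mod 4) \<noteq> q"
proof -
  have sym: "adjacent K a b \<Longrightarrow> adjacent K b a" for a b by (auto simp: adjacent_def insert_commute)
  have adj: "adjacent K (w j) (w ((j + 1) mod 4))" "\<not> adjacent K (w j) (w ((j + 2) mod 4))" if "j < 4" for j
    using f that by (auto simp: flat_square_def square_def)
  have inj: "w j \<noteq> w k" if "j < 4" "k < 4" "j \<noteq> k" for j k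
    using f that by (auto simp: flat_square_def square_def inj_on_def)
  let ?a = "w i" and ?b = "w ((i + 1) mod 4)" and ?c = "w ((i + 2) mod 4)" and ?d = "w ((i + 3) mod 4)"
  have m: "((i + 1) mod 4 + 1) mod 4 = (i + 2) mod 4" "((i + 2) mod 4 + 1) mod 4 = (i + 3) mod 4"
    "((i + 3) mod 4 + 1) mod 4 = i" "((i + 1) mod 4 + 2) mod 4 = (i + 3) mod 4"
    using i by presburger+
  have l: "(i + 1) mod 4 < 4" "(i + 2) mod 4 < 4" "(i + 3) mod 4 < 4" by simp_all
  have ne: "i \<noteq> (i + 2) mod 4" "(i + 1) mod 4 \<noteq> (i + 3) mod 4" using i by presburger+
  show ?thesis
  proof (rule that[of ?d ?c])
    show "adjacent K ?a ?b" using adj(1)[OF i] .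
    show "adjacent K ?a ?d" using sym[OF adj(1)[OF l(3)]] unfolding m .
    show "adjacent K ?c ?b" using sym[OF adj(1)[OF l(1)]] unfolding m .
    show "adjacent K ?c ?d" using adj(1)[OF l(2)] unfolding m .
    show "\<not> adjacent K ?a ?c" using adj(2)[OF i] .
    show "\<not> adjacent K ?b ?d" using adj(2)[OF l(1)] unfolding m .
    show "?a \<noteq> ?c" using inj[OF i l(2) ne(1)] .
    show "?b \<noteq> ?d" using inj[OF l(1,3) ne(2)] .
  qed
qed

lemma bary_flat_square:
  assumes "abstract_complex \<Gamma>" "flat_square (barycentric_subdivision \<Gamma>) w" "i < 4"
  shows "w i \<in> \<Gamma> - {{}}" "w ((i + 1) mod 4) \<in> \<Gamma> - {{}}"
    "card (w i) + 2 \<le> card (w ((i + 1) mod 4)) \<or> card (w ((i + 1) mod 4)) + 2 \<le> card (w i)"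
proof -
  obtain p q where h: "adjacent (barycentric_subdivision \<Gamma>) (w i) (w ((i + 1) mod 4))"
    "adjacent (barycentric_subdivision \<Gamma>) (w i) q" "adjacent (barycentric_subdivision \<Gamma>) p (w ((i + 1) mod 4))"
    "adjacent (barycentric_subdivision \<Gamma>) p q" "\<not> adjacent (barycentric_subdivision \<Gamma>) (w i) p" "w i \<noteq> p"
    "\<not> adjacent (barycentric_subdivision \<Gamma>) (w ((i + 1) mod 4)) q" "w ((i + 1) mod 4) \<noteq> q"
    by (rule flat_square_neighbours[OF assms(2,3)])
  show "w i \<in> \<Gamma> - {{}}" "w ((i + 1) mod 4) \<in> \<Gamma> - {{}}" using h(1) by (simp_all add: bary_adjacent)
  show "card (w i) + 2 \<le> card (w ((i + 1) mod 4)) \<or> card (w ((i + 1) mod 4)) + 2 \<le> card (w i)"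
    by (rule bary_flat[OF assms(1) h])
qed

theorem theorem5p23:
  fixes \<Gamma> :: "'a set set" and \<Lambda> :: "'b set set"
  assumes "abstract_complex \<Gamma>" and "complex_dim \<Gamma> = 3"
    and "abstract_complex \<Lambda>" and "complex_dim \<Lambda> = 3"
  shows "\<exists>(c :: 'a set \<Rightarrow> nat) (d :: 'b set \<Rightarrow> nat).
    coloured_complex 4 (barycentric_subdivision \<Gamma>) c \<and>
    coloured_complex 4 (barycentric_subdivision \<Lambda>) d \<and>
    pairwise_5_large 4 (barycentric_subdivision \<Gamma>) c (barycentric_subdivision \<Lambda>) d \<and>
    universal_cover_components_hyperbolic 4
      (barycentric_subdivision \<Gamma>) c (barycentric_subdivision \<Lambda>) d \<and>
    (\<not> trivial_group (z2_homology (simplices \<Gamma>) 3) \<and>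
     \<not> trivial_group (z2_homology (simplices \<Lambda>) 3) \<longrightarrow>
     \<not> trivial_group (z2_homology
         (X_cubes_of_dim 4 (barycentric_subdivision \<Gamma>) c (barycentric_subdivision \<Lambda>) d) 4))"
proof -
  let ?A = "barycentric_subdivision \<Gamma>" and ?B = "barycentric_subdivision \<Lambda>"
  let ?c = "\<lambda>s :: 'a set. card s" and ?d = "\<lambda>s :: 'b set. switch (card s)"
  note G = assms(1) and L = assms(3)
  have dG: "card s \<le> 4" if "s \<in> \<Gamma>" for s using complex_card_le[OF G, of 3 s] assms(2) that by simp
  have dL: "card s \<le> 4" if "s \<in> \<Lambda>" for s using complex_card_le[OF L, of 3 s] assms(4) that by simp
  have cA: "coloured_complex 4 ?A ?c" using bary_coloured[OF G dG, of "\<lambda>k. k"] by simp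
  have cB: "coloured_complex 4 ?B ?d" by (rule bary_coloured[OF L dL switch_inj])
  have rG: "card s \<in> {1..4}" if "s \<in> \<Gamma> - {{}}" for s
    using that dG[of s] G by (auto simp: abstract_complex_def Suc_le_eq card_gt_0_iff)
  have rL: "card s \<in> {1..4}" if "s \<in> \<Lambda> - {{}}" for s
    using that dL[of s] L by (auto simp: abstract_complex_def Suc_le_eq card_gt_0_iff)
  \<comment> \<open>Flat squares of the first subdivision have adjacent colours at distance at least
    2; by \<open>switch_far\<close> those of the second have adjacent colours at distance at most 1.
    So no pair is common, in either order.\<close>
  have clash: False
    if "s \<in> \<Gamma> - {{}}" "s' \<in> \<Gamma> - {{}}" "card s + 2 \<le> card s' \<or> card s' + 2 \<le> card s"
      "t \<in> \<Lambda> - {{}}" "t' \<in> \<Lambda> - {{}}" "card t + 2 \<le> card t' \<or> card t' + 2 \<le> card t"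
      "{card s, card s'} = {switch (card t), switch (card t')}" for s s' t t'
    using switch_far[OF rL[OF that(4)] rL[OF that(5)] that(6)] that(3,7) by (auto simp: doubleton_eq_iff)
  have 1: "five_large_against ?A ?c ?B ?d"
    unfolding five_large_against_def
  proof (intro allI impI)
    fix v assume v: "flat_square ?A v"
    \<comment> \<open>Every edge of the square avoids the colour pairs of the other complex; the one
      at index 0 is taken.\<close>
    have "\<not> has_flat_square_with_colours ?B ?d (?c (v 0)) (?c (v ((0 + 1) mod 4)))"
    proof
      assume "has_flat_square_with_colours ?B ?d (?c (v 0)) (?c (v ((0 + 1) mod 4)))"
      then obtain w i where w: "flat_square ?B w" "i < 4"
        "{?d (w i), ?d (w ((i + 1) mod 4))} = {?c (v 0), ?c (v ((0 + 1) mod 4))}"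
        unfolding has_flat_square_with_colours_def by blast
      have i0: "(0::nat) < 4" by simp
      show False by (rule clash[OF bary_flat_square[OF G v i0] bary_flat_square[OF L w(1,2)] w(3)[symmetric]])
    qed
    then show "\<exists>j<4. \<not> has_flat_square_with_colours ?B ?d (?c (v j)) (?c (v ((j + 1) mod 4)))"
      by (intro exI[of _ 0]) simp
  qed
  have 2: "five_large_against ?B ?d ?A ?c"
    unfolding five_large_against_def
  proof (intro allI impI)
    fix v assume v: "flat_square ?B v"
    have "\<not> has_flat_square_with_colours ?A ?c (?d (v 0)) (?d (v ((0 + 1) mod 4)))"
    proof
      assume "has_flat_square_with_colours ?A ?c (?d (v 0)) (?d (v ((0 + 1) mod 4)))"
      then obtain w i where w: "flat_square ?A w" "i < 4"
        "{?c (w i), ?c (w ((i + 1) mod 4))} = {?d (v 0), ?d (v ((0 + 1) mod 4))}"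
        unfolding has_flat_square_with_colours_def by blast
      have i0: "(0::nat) < 4" by simp
      show False by (rule clash[OF bary_flat_square[OF G w(1,2)] bary_flat_square[OF L v i0] w(3)])
    qed
    then show "\<exists>j<4. \<not> has_flat_square_with_colours ?A ?c (?d (v j)) (?d (v ((j + 1) mod 4)))"
      by (intro exI[of _ 0]) simp
  qed
  interpret coupled_complexes 4 ?A ?c ?B ?d
  proof
    show "coloured_complex 4 ?A ?c" "coloured_complex 4 ?B ?d" "flag_complex ?A" "flag_complex ?B"
      using cA cB bary_flag by blast+
    fix a a' g g' b b' h h'
    assume A: "adjacent ?A a g" "adjacent ?A a g'" "adjacent ?A a' g" "adjacent ?A a' g'"
      "\<not> adjacent ?A a a'" "a \<noteq> a'" "\<not> adjacent ?A g g'" "g \<noteq> g'"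
      and B: "adjacent ?B b h" "adjacent ?B b h'" "adjacent ?B b' h" "adjacent ?B b' h'"
      "\<not> adjacent ?B b b'" "b \<noteq> b'" "\<not> adjacent ?B h h'" "h \<noteq> h'"
      and e: "card a = switch (card b)" "card g = switch (card h)"
    have "a \<in> \<Gamma> - {{}}" "g \<in> \<Gamma> - {{}}" "b \<in> \<Lambda> - {{}}" "h \<in> \<Lambda> - {{}}"
      using A(1) B(1) by (simp_all add: bary_adjacent)
    then show False using clash[OF _ _ bary_flat[OF G A] _ _ bary_flat[OF L B]] e by simp
  qed
  have hom: "\<not> trivial_group (z2_homology (X_cubes_of_dim 4 ?A ?c ?B ?d) 4)"
    if nt: "\<not> trivial_group (z2_homology (simplices \<Gamma>) 3)" "\<not> trivial_group (z2_homology (simplices \<Lambda>) 3)"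
  proof -
    have dG': "card s \<le> Suc 3" if "s \<in> \<Gamma>" for s using dG[OF that] by simp
    have dL': "card s \<le> Suc 3" if "s \<in> \<Lambda>" for s using dL[OF that] by simp
    obtain z T where z: "z \<in> z2_cycles (simplices \<Gamma>) 3" "T \<in> \<Gamma>" "card T = Suc 3" "z T = 1"
      by (rule nontrivial_top_cycle[OF G dG' nt(1)])
    obtain y R where y: "y \<in> z2_cycles (simplices \<Lambda>) 3" "R \<in> \<Lambda>" "card R = Suc 3" "y R = 1"
      by (rule nontrivial_top_cycle[OF L dL' nt(2)])
    obtain C where C: "C \<in> ?A" "card C = card T" "\<Union>C = T" using full_flag_exists[OF G z(2)] by blast
    obtain D where D: "D \<in> ?B" "card D = card R" "\<Union>D = R" using full_flag_exists[OF L y(2)] by blast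
    show ?thesis
    \<comment> \<open>The induced cycle gives a maximal chain the coefficient of its union;
      \<open>C\<close> and \<open>D\<close> are maximal chains with unions \<open>T\<close> and
      \<open>R\<close>, whose coefficients are 1.\<close>
    proof (rule product_cycle[of "\<lambda>s. z (\<Union>s)" "\<lambda>t. y (\<Union>t)" C D])
      show "(\<Sum>t\<in>{t\<in>?A. card t = 4 \<and> s \<subseteq> t}. z (\<Union>t)) = 0" if "s \<in> ?A" "card s = 4 - 1" for s
        using bary_cycle[OF G dG' z(1) _ that(1)] that(2) by simp
      show "(\<Sum>t\<in>{t\<in>?B. card t = 4 \<and> s \<subseteq> t}. y (\<Union>t)) = 0" if "s \<in> ?B" "card s = 4 - 1" for s
        using bary_cycle[OF L dL' y(1) _ that(1)] that(2) by simp
    qed (use C D z y in simp_all)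
  qed
  show ?thesis
  proof (intro exI[of _ ?c] exI[of _ ?d] conjI cA cB cover_hyperbolic)
    show "pairwise_5_large 4 ?A ?c ?B ?d" unfolding pairwise_5_large_def by (intro conjI cA cB bary_flag 1 2)
  qed (rule impI, elim conjE, rule hom)
qed

end
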